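(* Let $p$ be a prime. For each $n \in \mathbb{N}$, let $N_1^{(n)}, N_2^{(n)},\ldots \in \mathbb{Z}_{\geq 0} \cup \{\infty\}$ be such that $N_j^{(n)} > n$ for all $j$ and the limiting frequencies $$\rho_n(N) := \lim_{k \to \infty} \frac{|\{1 \leq j \leq k: N_j^{(n)} = N\}|}{k}$$ exist for all $N > n$ (with $N\in\mathbb{Z}_{\ge0}\cup\{\infty\}$). For each $n$ let $A_1^{(n)},A_2^{(n)},\ldots$ be independent random matrices, where $A_j^{(n)}$ is the top left $n \times n$ corner of a Haar distributed matrix in $\mathrm{GL}_{N_j^{(n)}}(\mathbb{Z}_p)$ if $N_j^{(n)}<\infty$, and $A_j^{(n)}$ is an $n\times n$ matrix with i.i.d. entries distributed by the additive Haar probability measure on $\mathbb{Z}_p$ if $N_j^{(n)}=\infty$. Write $(\lambda_1(k),\ldots,\lambda_n(k)) := \mathrm{SN}(A_k^{(n)} \cdots A_1^{(n)})$. Then for each $n$, the Lyapunov exponents $$L_i^{(n)} := \lim_{k \to \infty} \frac{\lambda_{n-i+1}(k)}{k}, \qquad 1\le i\le n,$$ exist almost surely. Furthermore, the Lyapunov exponents have limits $$\lim_{n \to \infty} \frac{L_i^{(n)}}{p^{-n}(1-c(n))} = p^{i-1}$$ for every $i\geq 1$, where $c(n) := \sum_{N > n} \rho_n(N)\, p^{-(N-n)}$.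
   Context: $\mathbb{Q}_p$ and $\mathbb{Z}_p$ are the $p$-adic numbers and $p$-adic integers. The additive Haar probability measure on $\mathbb{Z}_p$ and the Haar probability measure on the compact group $\mathrm{GL}_N(\mathbb{Z}_p)$ are the unique translation-invariant probability measures. Singular numbers: for a nonsingular $A \in M_{n}(\mathbb{Q}_p)$ there exist $U,V \in \mathrm{GL}_n(\mathbb{Z}_p)$ with $UAV = \mathrm{diag}(p^{\lambda_1},\ldots,p^{\lambda_n})$ for a unique weakly decreasing tuple of integers $\lambda_1 \geq \cdots \geq \lambda_n$; one writes $\mathrm{SN}(A) = (\lambda_1,\ldots,\lambda_n)$. (The matrices above are nonsingular with probability $1$.) Convention: $p^{-(N-n)}=0$ when $N=\infty$. *)

theory Defs
  imports
    "HOL-Probability.Probability"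
    "HOL-Library.Extended_Nat"
    "HOL-Computational_Algebra.Polynomial_Factorial"
    "Jordan_Normal_Form.Matrix"
    "Berlekamp_Zassenhaus.Finite_Field"
begin

text \<open>The prime enters as the cardinality of a type \<open>'p\<close> of class
  \<^class>\<open>prime_card\<close>, so that the ring of p-adic integers is a type. It is the inverse
  limit of the rings \<open>\<int>/p\<^sup>m\<close>; the m-th component of an element is its residue modulo
  \<open>p\<^sup>m\<close>, represented in \<open>{0..<p\<^sup>m}\<close> (the range is forced by the
  compatibility condition).\<close>

typedef ('p::prime_card) padic_int =
    "{x :: nat \<Rightarrow> int. \<forall>m. x m = x (Suc m) mod int CARD('p) ^ m}"
  morphisms padic_res Abs_padic_int
  by (rule exI[of _ "\<lambda>_. 0"]) simp

setup_lifting type_definition_padic_int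

lemma padic_res_Suc:
  "padic_res (x :: 'p::prime_card padic_int) (Suc m) mod int CARD('p) ^ m = padic_res x m"
  by (rule padic_res[of x, unfolded mem_Collect_eq, THEN spec, symmetric])

lemma padic_res_mod_le:
  assumes "m \<le> n"
  shows "padic_res (x :: 'p::prime_card padic_int) n mod int CARD('p) ^ m = padic_res x m"
  using assms
proof (induction n rule: dec_induct)
  case base
  show ?case by (subst (1 2) padic_res_Suc[symmetric]) simp
next
  case (step n)
  have "padic_res x (Suc n) mod int CARD('p) ^ m
      = (padic_res x (Suc n) mod int CARD('p) ^ n) mod int CARD('p) ^ m"
    using step(1) by (simp add: mod_mod_cancel le_imp_power_dvd)
  then show ?case
    using step padic_res_Suc[of x n] by simp
qed

lemma padic_res_mod [simp]:
  "padic_res (x :: 'p::prime_card padic_int) m mod int CARD('p) ^ m = padic_res x m"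
  by (rule padic_res_mod_le) simp

lemma padic_eqI: "(\<And>m. padic_res x m = padic_res y m) \<Longrightarrow> x = y"
  by (metis ext padic_res_inject)

instantiation padic_int :: (prime_card) comm_ring_1
begin

lift_definition zero_padic_int :: "'a padic_int" is "\<lambda>_. 0"
  by simp

lift_definition one_padic_int :: "'a padic_int" is "\<lambda>m. 1 mod int CARD('a) ^ m"
  by (simp add: mod_mod_cancel)

lift_definition plus_padic_int :: "'a padic_int \<Rightarrow> 'a padic_int \<Rightarrow> 'a padic_int"
  is "\<lambda>x y m. (x m + y m) mod int CARD('a) ^ m"
proof -
  fix x y :: "nat \<Rightarrow> int" and m
  let ?q = "int CARD('a)"
  assume x: "\<And>m. x m = x (Suc m) mod ?q ^ m"
    and y: "\<And>m. y m = y (Suc m) mod ?q ^ m"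
  have "(x m + y m) mod ?q ^ m = (x (Suc m) mod ?q ^ m + y (Suc m) mod ?q ^ m) mod ?q ^ m"
    by (simp add: x[of m] y[of m])
  also have "\<dots> = (x (Suc m) + y (Suc m)) mod ?q ^ Suc m mod ?q ^ m"
    by (subst mod_mod_cancel) (simp_all add: mod_add_eq)
  finally show "(x m + y m) mod ?q ^ m = (x (Suc m) + y (Suc m)) mod ?q ^ Suc m mod ?q ^ m" .
qed

lift_definition uminus_padic_int :: "'a padic_int \<Rightarrow> 'a padic_int"
  is "\<lambda>x m. (- x m) mod int CARD('a) ^ m"
proof -
  fix x :: "nat \<Rightarrow> int" and m
  let ?q = "int CARD('a)"
  assume x: "\<And>m. x m = x (Suc m) mod ?q ^ m"
  have "(- x m) mod ?q ^ m = (- (x (Suc m) mod ?q ^ m)) mod ?q ^ m"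
    by (simp add: x[of m])
  also have "\<dots> = (- x (Suc m)) mod ?q ^ Suc m mod ?q ^ m"
    by (subst mod_mod_cancel) (simp_all add: mod_minus_eq)
  finally show "(- x m) mod ?q ^ m = (- x (Suc m)) mod ?q ^ Suc m mod ?q ^ m" .
qed

definition minus_padic_int :: "'a padic_int \<Rightarrow> 'a padic_int \<Rightarrow> 'a padic_int"
  where "minus_padic_int x y = x + (- y)"

lift_definition times_padic_int :: "'a padic_int \<Rightarrow> 'a padic_int \<Rightarrow> 'a padic_int"
  is "\<lambda>x y m. (x m * y m) mod int CARD('a) ^ m"
proof -
  fix x y :: "nat \<Rightarrow> int" and m
  let ?q = "int CARD('a)"
  assume x: "\<And>m. x m = x (Suc m) mod ?q ^ m"
    and y: "\<And>m. y m = y (Suc m) mod ?q ^ m"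
  have "(x m * y m) mod ?q ^ m = ((x (Suc m) mod ?q ^ m) * (y (Suc m) mod ?q ^ m)) mod ?q ^ m"
    by (simp add: x[of m] y[of m])
  also have "\<dots> = (x (Suc m) * y (Suc m)) mod ?q ^ Suc m mod ?q ^ m"
    by (subst mod_mod_cancel) (simp_all add: mod_mult_eq)
  finally show "(x m * y m) mod ?q ^ m = (x (Suc m) * y (Suc m)) mod ?q ^ Suc m mod ?q ^ m" .
qed

instance
proof
  fix a b c :: "'a padic_int"
  note rep = zero_padic_int.rep_eq one_padic_int.rep_eq plus_padic_int.rep_eq
    uminus_padic_int.rep_eq times_padic_int.rep_eq
  show "a + b + c = a + (b + c)"
    by (rule padic_eqI) (simp add: rep mod_simps add.assoc)
  show "a + b = b + a"
    by (rule padic_eqI) (simp add: rep add.commute)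
  show "0 + a = a"
    by (rule padic_eqI) (simp add: rep)
  show "- a + a = 0"
    by (rule padic_eqI) (simp add: rep mod_simps)
  show "a - b = a + - b"
    by (simp add: minus_padic_int_def)
  show "a * b * c = a * (b * c)"
    by (rule padic_eqI) (simp add: rep mod_simps mult.assoc)
  show "a * b = b * a"
    by (rule padic_eqI) (simp add: rep mult.commute)
  show "1 * a = a"
    by (rule padic_eqI) (simp add: rep mod_simps)
  show "(a + b) * c = a * c + b * c"
    by (rule padic_eqI) (simp add: rep mod_simps distrib_right)
  have "(1::int) mod int CARD('a) ^ 1 \<noteq> 0"
    using prime_card_int[where 'a='a] prime_gt_1_int by fastforce
  then show "(0::'a padic_int) \<noteq> 1"
    by (metis one_padic_int.rep_eq zero_padic_int.rep_eq)
qed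

end

instance padic_int :: (prime_card) idom
proof
  fix a b :: "'a padic_int"
  let ?q = "int CARD('a)"
  assume "a \<noteq> 0" "b \<noteq> 0"
  then obtain k l where k: "padic_res a k \<noteq> 0" and l: "padic_res b l \<noteq> 0"
    by (metis padic_eqI zero_padic_int.rep_eq)
  have pr: "prime ?q" by (rule prime_card_int)
  define x where "x = padic_res a (k + l)"
  define y where "y = padic_res b (k + l)"
  have x: "\<not> ?q ^ k dvd x"
    using k padic_res_mod_le[of k "k + l" a] by (auto simp: x_def dvd_eq_mod_eq_0)
  have y: "\<not> ?q ^ l dvd y"
    using l padic_res_mod_le[of l "k + l" b] by (auto simp: y_def dvd_eq_mod_eq_0)
  have nz: "x \<noteq> 0" "y \<noteq> 0" using x y by auto
  have "multiplicity ?q x < k" "multiplicity ?q y < l"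
    using x y by (meson multiplicity_dvd' not_le)+
  then have "multiplicity ?q (x * y) < k + l"
    using nz pr by (simp add: prime_elem_multiplicity_mult_distrib)
  then have "\<not> ?q ^ (k + l) dvd x * y"
    using nz pr by (metis mult_eq_0_iff multiplicity_geI not_le not_prime_unit)
  then have "padic_res (a * b) (k + l) \<noteq> 0"
    by (simp add: times_padic_int.rep_eq x_def y_def dvd_eq_mod_eq_0)
  then show "a * b \<noteq> 0"
    by (metis zero_padic_int.rep_eq)
qed

text \<open>The p-adic topology: the balls of radius \<open>p\<^sup>-\<^sup>m\<close> are the residue classes
  modulo \<open>p\<^sup>m\<close>.\<close>

instantiation padic_int :: (prime_card) topological_space
begin

definition open_padic_int :: "'a padic_int set \<Rightarrow> bool" where
  "open_padic_int U \<longleftrightarrow>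
     (\<forall>x\<in>U. \<exists>m. {y. padic_res y m = padic_res x m} \<subseteq> U)"

instance
proof
  show "open (UNIV :: 'a padic_int set)"
    by (simp add: open_padic_int_def)
next
  fix S T :: "'a padic_int set"
  assume S: "open S" and T: "open T"
  show "open (S \<inter> T)"
    unfolding open_padic_int_def
  proof
    fix x assume x: "x \<in> S \<inter> T"
    then have "x \<in> S" "x \<in> T" by simp_all
    obtain k where k: "{y. padic_res y k = padic_res x k} \<subseteq> S"
      using S[unfolded open_padic_int_def, rule_format, OF \<open>x \<in> S\<close>] ..
    obtain l where l: "{y. padic_res y l = padic_res x l} \<subseteq> T"
      using T[unfolded open_padic_int_def, rule_format, OF \<open>x \<in> T\<close>] ..
    have "{y. padic_res y (max k l) = padic_res x (max k l)} \<subseteq> S \<inter> T"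
    proof
      fix y :: "'a padic_int"
      assume "y \<in> {y. padic_res y (max k l) = padic_res x (max k l)}"
      then have eq: "padic_res y (max k l) = padic_res x (max k l)" by simp
      have "padic_res y k = padic_res x k"
        using padic_res_mod_le[of k "max k l" x] padic_res_mod_le[of k "max k l" y] eq by simp
      moreover have "padic_res y l = padic_res x l"
        using padic_res_mod_le[of l "max k l" x] padic_res_mod_le[of l "max k l" y] eq by simp
      ultimately show "y \<in> S \<inter> T"
        using subsetD[OF k, of y] subsetD[OF l, of y] by simp
    qed
    then show "\<exists>m. {y. padic_res y m = padic_res x m} \<subseteq> S \<inter> T" ..
  qed
next
  fix K :: "'a padic_int set set"
  assume K: "\<forall>S\<in>K. open S"
  show "open (\<Union>K)"
    unfolding open_padic_int_def
  proof
    fix x assume "x \<in> \<Union>K"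
    then obtain S where S: "S \<in> K" "x \<in> S" by (rule UnionE)
    then obtain m where "{y. padic_res y m = padic_res x m} \<subseteq> S"
      using K[rule_format, OF S(1), unfolded open_padic_int_def, rule_format, OF S(2)] by (elim exE)
    then have "{y. padic_res y m = padic_res x m} \<subseteq> \<Union>K"
      using Union_upper[OF S(1)] by (rule subset_trans)
    then show "\<exists>m. {y. padic_res y m = padic_res x m} \<subseteq> \<Union>K" ..
  qed
qed

end

type_synonym 'p padic = "'p padic_int fract"

definition GL :: "nat \<Rightarrow> 'a::semiring_1 mat set" where
  "GL n = {A \<in> carrier_mat n n. invertible_mat A}"

text \<open>The \<open>\<sigma>\<close>-algebra generated by the matrix entries; over the p-adic integers,
  whose topology has a countable base, it is the Borel \<open>\<sigma>\<close>-algebra of the product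
  topology.\<close>

definition mat_borel :: "nat \<Rightarrow> 'a::topological_space mat measure" where
  "mat_borel n = sigma (carrier_mat n n)
     {{A \<in> carrier_mat n n. A $$ (i, j) \<in> S} | i j S. i < n \<and> j < n \<and> S \<in> sets borel}"

definition GL_borel :: "nat \<Rightarrow> 'a::{semiring_1,topological_space} mat measure" where
  "GL_borel n = restrict_space (mat_borel n) (GL n)"

text \<open>Here \<open>S\<close> is a measurable space carrying a group structure with operation
  \<open>f\<close>; only its underlying set and \<open>\<sigma>\<close>-algebra matter.\<close>

definition is_haar_prob :: "'a measure \<Rightarrow> ('a \<Rightarrow> 'a \<Rightarrow> 'a) \<Rightarrow> 'a measure \<Rightarrow> bool" where
  "is_haar_prob S f \<mu> \<longleftrightarrow> prob_space \<mu> \<and> sets \<mu> = sets S \<and>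
     (\<forall>g\<in>space S. distr \<mu> S (\<lambda>x. f g x) = \<mu> \<and> distr \<mu> S (\<lambda>x. f x g) = \<mu>)"

definition haar_Zp :: "'p::prime_card padic_int measure \<Rightarrow> bool" where
  "haar_Zp = is_haar_prob borel (+)"

definition haar_GL :: "nat \<Rightarrow> 'p::prime_card padic_int mat measure \<Rightarrow> bool" where
  "haar_GL N = is_haar_prob (GL_borel N) (*)"

definition corner :: "nat \<Rightarrow> 'a mat \<Rightarrow> 'a mat" where
  "corner n G = mat n n (\<lambda>ij. G $$ ij)"

text \<open>\<open>X\<close> is a random \<open>n \<times> n\<close> matrix distributed as the corner of a Haar matrix in
  \<open>GL\<^sub>N(\<int>\<^sub>p)\<close> if \<open>N\<close> is finite, and with i.i.d. Haar entries if \<open>N = \<infinity>\<close>.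
  The first case constrains only the law of \<open>X\<close>: the ambient Haar matrix need not live on
  the probability space \<open>M\<close>.\<close>

definition corner_or_iid ::
    "'w measure \<Rightarrow> nat \<Rightarrow> enat \<Rightarrow> ('w \<Rightarrow> 'p::prime_card padic_int mat) \<Rightarrow> bool" where
  "corner_or_iid M n N X \<longleftrightarrow> X \<in> measurable M (mat_borel n) \<and>
     (case N of
        enat N' \<Rightarrow> (\<exists>\<mu>. haar_GL N' \<mu> \<and> distr M (mat_borel n) X = distr \<mu> (mat_borel n) (corner n))
      | \<infinity> \<Rightarrow> prob_space.indep_vars M (\<lambda>_. borel) (\<lambda>ij \<omega>. X \<omega> $$ ij) ({..<n} \<times> {..<n}) \<and>
          (\<forall>ij \<in> {..<n} \<times> {..<n}. haar_Zp (distr M borel (\<lambda>\<omega>. X \<omega> $$ ij))))"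

text \<open>Unspecified if \<open>A\<close> is singular. The list is indexed from \<open>0\<close>, so
  \<open>\<lambda>\<^sub>i\<close> is \<open>SN A ! (i - 1)\<close>.\<close>

definition SN :: "'p::prime_card padic mat \<Rightarrow> int list" where
  "SN A = (THE ls. length ls = dim_row A \<and> sorted_wrt (\<ge>) ls \<and>
     (\<exists>U \<in> GL (dim_row A). \<exists>V \<in> GL (dim_row A).
        map_mat to_fract U * A * map_mat to_fract V
          = mat_diag (dim_row A) (\<lambda>i. of_nat CARD('p) powi (ls ! i))))"

text \<open>\<open>A k * \<dots> * A 1\<close>\<close>

primrec mat_lprod :: "nat \<Rightarrow> (nat \<Rightarrow> 'a::semiring_1 mat) \<Rightarrow> nat \<Rightarrow> 'a mat" where
  "mat_lprod n A 0 = 1\<^sub>m n"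
| "mat_lprod n A (Suc k) = A (Suc k) * mat_lprod n A k"

text \<open>\<open>p\<^bsup>-(N-n)\<^esup>\<close> for \<open>N > n\<close>, with value \<open>0\<close> at \<open>N = \<infinity>\<close>\<close>

definition gap_weight :: "nat \<Rightarrow> nat \<Rightarrow> enat \<Rightarrow> real" where
  "gap_weight p n N = (case N of enat N' \<Rightarrow> real p powi (- (int N' - int n)) | \<infinity> \<Rightarrow> 0)"

end

theory Submission
  imports Defs "Jordan_Normal_Form.Determinant"
begin

text \<open>The product \<open>P\<^sub>k = A\<^sub>k \<cdots> A\<^sub>1\<close> is studied one column at a time. By left multiplication with elements of
  \<open>GL\<^sub>n(\<int>\<^sub>p)\<close> every integral matrix becomes upper triangular. The valuation of the \<open>i\<close>-th diagonal
  entry, the depth of column \<open>i\<close>, does not depend on the invertible matrix used, the frame: it measures how far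
  column \<open>i\<close> is from the saturated span of the columns before it. If \<open>U\<^sub>k P\<^sub>k\<close> is triangular, then
  the depths of \<open>P\<^sub>k\<^sub>+\<^sub>1\<close> are those of \<open>P\<^sub>k\<close> plus those of \<open>A\<^sub>k\<^sub>+\<^sub>1 U\<^sub>k\<^sup>-\<^sup>1\<close>.
  (Columns are counted from \<open>0\<close>, so that column \<open>i\<close> corresponds to the exponent \<open>L\<^sub>i\<^sub>+\<^sub>1\<close>.)

  The law of these increments can be computed exactly (\<open>depth_law\<close>). The law of a factor has enough
  symmetry to randomize column \<open>i\<close> modulo \<open>p\<close> while the columns before it are kept, and counting
  residue vectors shows that for every \<open>V\<close> in \<open>GL\<^sub>n(\<int>\<^sub>p)\<close> the depth of column \<open>i\<close> of \<open>A V\<close> reaches \<open>m \<ge> 1\<close>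
  with probability \<open>q\<^sub>i(N) x\<^sup>m\<close>, where \<open>x = p\<^bsup>-(n-i)\<^esup>\<close>. Here \<open>q\<^sub>i(N)\<close> is
  \<open>(1 - p\<^bsup>-(N-n)\<^esup>) / (1 - p\<^bsup>-(N-i)\<^esup>)\<close>, which is \<open>1\<close> for \<open>N = \<infinity>\<close>. The probability does not depend on \<open>V\<close>,
  and therefore not on the past: the increments are pairwise independent. A strong law of large
  numbers (\<open>slln_geometric_tails\<close>) and the convergence of the frequencies give the growth rate of the depths,
  \<open>x / (1 - x)\<close> times the limit of the average of \<open>q\<^sub>i(N\<^sub>j)\<close> over the steps \<open>j\<close>.

  These rates increase with \<open>i\<close>. Hence in the triangular form of \<open>P\<^sub>k\<close> the off-diagonal entries of a row
  are, up to \<open>o(k)\<close>, no less divisible than the growth rate of that row requires, which bounds the singular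
  numbers from below. The determinant shows that nothing is lost, so that the rates are the Lyapunov exponents
  (\<open>singular_numbers_growth\<close>).

  Finally \<open>1 - q\<^sub>i(N)\<close> lies between \<open>(1 - x) p\<^bsup>-(N-n)\<^esup>\<close> and \<open>p\<^bsup>-(N-n)\<^esup>\<close>. The average of the
  \<open>q\<^sub>i(N\<^sub>j)\<close> is thus \<open>(1 - c(n)) (1 + O(x))\<close>, and the rate is
  \<open>p\<^sup>i p\<^bsup>-n\<^esup> (1 - c(n)) (1 + O(p\<^bsup>-(n-i)\<^esup>))\<close> (\<open>rate_asymptotics\<close>).\<close>

section \<open>Divisibility of p-adic integers\<close>

abbreviation \<pi> :: "'p::prime_card padic_int" where "\<pi> \<equiv> of_nat CARD('p)"

lemmas padic_rep = zero_padic_int.rep_eq one_padic_int.rep_eq plus_padic_int.rep_eq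
    uminus_padic_int.rep_eq times_padic_int.rep_eq

lemma padic_res_diff:
  "padic_res (x - y :: 'p::prime_card padic_int) m = (padic_res x m - padic_res y m) mod int CARD('p) ^ m"
  by (simp add: diff_conv_add_uminus padic_rep mod_simps del: add_uminus_conv_diff)

lemma padic_res_of_nat: "padic_res (of_nat k :: 'p::prime_card padic_int) m = int k mod int CARD('p) ^ m"
  by (induction k) (simp_all add: padic_rep mod_simps)

lemma padic_res_of_int: "padic_res (of_int z :: 'p::prime_card padic_int) m = z mod int CARD('p) ^ m"
  by (cases z) (simp_all add: padic_res_of_nat padic_res_diff padic_rep mod_simps)

lemma padic_res_range:
  "0 \<le> padic_res (x :: 'p::prime_card padic_int) m" "padic_res x m < int CARD('p) ^ m"
proof -
  have "int CARD('p) ^ m > 0" by simp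
  then show "0 \<le> padic_res x m" "padic_res x m < int CARD('p) ^ m"
    by (metis padic_res_mod pos_mod_sign, metis padic_res_mod pos_mod_bound)
qed

lemma pi_power: "(\<pi> :: 'p::prime_card padic_int) ^ k = of_int (int CARD('p) ^ k)"
  by simp

lemma pi_power_dvd_iff: "(\<pi> :: 'p::prime_card padic_int) ^ k dvd x \<longleftrightarrow> padic_res x k = 0"
proof
  assume "\<pi> ^ k dvd x"
  then obtain y where "x = \<pi> ^ k * y" by (rule dvdE)
  then show "padic_res x k = 0"
    unfolding pi_power by (simp add: times_padic_int.rep_eq padic_res_of_int del: of_int_power)
next
  assume x: "padic_res x k = 0"
  let ?q = "int CARD('p)"
  have q: "?q > 0" by simp
  define y :: "'p padic_int" where "y = Abs_padic_int (\<lambda>m. padic_res x (k + m) div ?q ^ k) "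
  have xm: "?q ^ k dvd padic_res x (k + m)" for m
    using padic_res_mod_le[of k "k + m" x] x by (simp add: dvd_eq_mod_eq_0)
  have compat: "padic_res x (k + m) div ?q ^ k = padic_res x (k + Suc m) div ?q ^ k mod ?q ^ m" for m
  proof -
    obtain t where t: "padic_res x (k + Suc m) = ?q ^ k * t" using xm by (blast elim: dvdE)
    have "padic_res x (k + m) = ?q ^ k * t mod (?q ^ k * ?q ^ m)"
      using padic_res_mod_le[of "k + m" "k + Suc m" x] t by (simp add: power_add)
    also have "\<dots> = ?q ^ k * (t mod ?q ^ m)" by (rule mult_mod_right[symmetric])
    finally show ?thesis using t q by simp
  qed
  then have y: "padic_res y m = padic_res x (k + m) div ?q ^ k" for m
    unfolding y_def by (subst Abs_padic_int_inverse) (use compat in blast)+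
  have "x = \<pi> ^ k * y"
  proof (rule padic_eqI)
    fix m
    have "padic_res (\<pi> ^ k * y) m = ?q ^ k * (padic_res x (k + m) div ?q ^ k) mod ?q ^ m"
      unfolding pi_power times_padic_int.rep_eq padic_res_of_int y by (simp add: mod_simps)
    also have "?q ^ k * (padic_res x (k + m) div ?q ^ k) = padic_res x (k + m)"
      using xm by simp
    also have "\<dots> mod ?q ^ m = padic_res x m" by (rule padic_res_mod_le) simp
    finally show "padic_res x m = padic_res (\<pi> ^ k * y) m" by simp
  qed
  then show "\<pi> ^ k dvd x" by simp
qed

lemma pi_dvd_iff: "(\<pi> :: 'p::prime_card padic_int) dvd x \<longleftrightarrow> padic_res x 1 = 0"
  using pi_power_dvd_iff[of 1 x] by simp

lemma pi_not_dvd_1: "\<not> (\<pi> :: 'p::prime_card padic_int) dvd 1"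
proof -
  have "int CARD('p) > 1" using prime_card_int[where 'a='p] prime_gt_1_int by blast
  then show ?thesis by (simp add: pi_dvd_iff padic_rep)
qed

lemma pi_nonzero [simp]: "(\<pi> :: 'p::prime_card padic_int) \<noteq> 0"
proof
  assume "\<pi> = (0 :: 'p padic_int)"
  then have "padic_res (\<pi> :: 'p padic_int) 2 = 0" by (simp only: zero_padic_int.rep_eq)
  moreover have "int CARD('p) > 1" using prime_card_int[where 'a='p] prime_gt_1_int by blast
  then have "int CARD('p) < int CARD('p) ^ 2" by (simp add: power2_eq_square)
  ultimately show False by (simp add: padic_res_of_nat)
qed

lemma prime_card_gt_1: "real CARD('p::prime_card) > 1"
  using prime_card_int[where 'a='p] prime_gt_1_int[of "int CARD('p)"] by simp

text \<open>A residue that is prime to \<open>p\<close> has an inverse modulo every \<open>p\<^sup>m\<close>. These inverses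
  are unique, hence compatible with each other, and so they define a p-adic integer.\<close>

lemma padic_unit_iff: "x dvd 1 \<longleftrightarrow> \<not> (\<pi> :: 'p::prime_card padic_int) dvd x"
proof
  assume "x dvd 1" then show "\<not> \<pi> dvd x" using pi_not_dvd_1 dvd_trans by blast
next
  let ?q = "int CARD('p)"
  assume "\<not> \<pi> dvd x"
  then have x1: "padic_res x 1 \<noteq> 0" by (simp add: pi_dvd_iff)
  have cop: "coprime (padic_res x m) (?q ^ m)" for m
  proof (cases m)
    case (Suc k)
    have "\<not> ?q dvd padic_res x m"
      using padic_res_mod_le[of 1 m x] x1 Suc by (auto simp: dvd_eq_mod_eq_0)
    then show ?thesis
      using prime_imp_coprime[OF prime_card_int[where 'a='p]] by (simp add: coprime_commute)
  qed simp
  have "\<exists>z. (padic_res x m * z) mod ?q ^ m = 1 mod ?q ^ m" for m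
    using cong_solve_coprime_int[OF cop[of m]] by (auto simp: cong_def)
  then obtain z where z: "(padic_res x m * z m) mod ?q ^ m = 1 mod ?q ^ m" for m by metis
  define y :: "'p padic_int" where "y = Abs_padic_int (\<lambda>m. z m mod ?q ^ m)"
  have compat: "z m mod ?q ^ m = z (Suc m) mod ?q ^ Suc m mod ?q ^ m" for m
  proof -
    have "[padic_res x m * z m = padic_res x m * z (Suc m)] (mod ?q ^ m)"
    proof -
      have "padic_res x m * z (Suc m) mod ?q ^ m = padic_res x (Suc m) * z (Suc m) mod ?q ^ m"
        by (metis mod_mult_left_eq padic_res_Suc)
      also have "\<dots> = padic_res x (Suc m) * z (Suc m) mod ?q ^ Suc m mod ?q ^ m"
        by (simp add: mod_mod_cancel)
      also have "\<dots> = 1 mod ?q ^ m" by (subst z) (simp add: mod_mod_cancel)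
      finally show ?thesis using z[of m] by (simp add: cong_def)
    qed
    then have "[z m = z (Suc m)] (mod ?q ^ m)"
      using cop[of m] cong_mult_lcancel by blast
    then show ?thesis by (simp add: cong_def mod_mod_cancel)
  qed
  then have y: "padic_res y m = z m mod ?q ^ m" for m
    unfolding y_def by (subst Abs_padic_int_inverse) (use compat in blast)+
  have "1 = x * y"
    by (rule padic_eqI) (simp add: times_padic_int.rep_eq y one_padic_int.rep_eq z mod_simps)
  then show "x dvd 1" by (rule dvdI)
qed

lemma padic_decompose:
  assumes "x \<noteq> (0 :: 'p::prime_card padic_int)"
  obtains v u where "x = \<pi> ^ v * u" "u dvd 1"
proof -
  obtain m where m: "\<not> \<pi> ^ m dvd x"
    using assms by (metis padic_eqI pi_power_dvd_iff zero_padic_int.rep_eq)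
  define v where "v = (LEAST m. \<not> \<pi> ^ Suc m dvd x)"
  have "\<not> \<pi> ^ Suc m dvd x" using m by (meson dvd_trans le_imp_power_dvd lessI less_imp_le)
  then have v: "\<not> \<pi> ^ Suc v dvd x" unfolding v_def by (rule LeastI)
  have "\<pi> ^ v dvd x"
  proof (cases v)
    case (Suc w)
    then have "w < (LEAST m. \<not> \<pi> ^ Suc m dvd x)" by (simp add: v_def)
    then show ?thesis using not_less_Least Suc by blast
  qed simp
  then obtain u where u: "x = \<pi> ^ v * u" by (rule dvdE)
  have "u dvd 1" unfolding padic_unit_iff
  proof
    assume "\<pi> dvd u"
    then obtain w where "u = \<pi> * w" by (rule dvdE)
    then have "x = \<pi> ^ Suc v * w" using u by simp
    then show False using v by (metis dvd_triv_left)
  qed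
  then show thesis using that u by blast
qed

lemma unit_mult_dvd_iff:
  assumes "u dvd (1 :: 'p::prime_card padic_int)" shows "d dvd u * x \<longleftrightarrow> d dvd x"
proof -
  from assms obtain w where w: "1 = u * w" by (rule dvdE)
  have "x = w * (u * x)" using w by (metis mult.assoc mult.commute mult_1)
  then show ?thesis by (metis dvd_mult)
qed

text \<open>The integers are dense. This is what lets a quantifier over p-adic coefficients be replaced by
  one over integers, so that the sets it defines are countable unions.\<close>

lemma padic_approx_int: "\<exists>z::int. (\<pi> :: 'p::prime_card padic_int) ^ m dvd x - of_int z"
  by (rule exI[of _ "padic_res x m"])
     (simp add: pi_power_dvd_iff padic_res_diff padic_res_of_int)

lemma pi_dvd_of_nat_diff:
  assumes "a < CARD('p)" "b < CARD('p)" "(\<pi> :: 'p::prime_card padic_int) dvd of_nat a - of_nat b"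
  shows "a = b"
  using assms by (simp add: pi_dvd_iff padic_res_diff padic_res_of_nat)
    (metis dvd_eq_mod_eq_0 mod_eq_dvd_iff mod_less of_nat_eq_iff zmod_int)

lemma pi_power_mult_dvd_cancel:
  "(\<pi> :: 'p::prime_card padic_int) ^ (m + e) dvd \<pi> ^ e * x \<longleftrightarrow> \<pi> ^ m dvd x"
  by (simp add: power_add mult.commute[of "\<pi>^m"] del: of_nat_power)

section \<open>Invertible matrices over a ring\<close>

lemma mult_entry:
  assumes "A \<in> carrier_mat n m" "B \<in> carrier_mat m k" "i < n" "j < k"
  shows "(A * B) $$ (i, j) = (\<Sum>s<m. A $$ (i, s) * B $$ (s, j))"
  using assms by (simp add: scalar_prod_def atLeast0LessThan)

lemma GL_carrier [simp, dest]: "A \<in> GL n \<Longrightarrow> A \<in> carrier_mat n n"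
  by (simp add: GL_def)

lemma GL_I:
  fixes A :: "'a::comm_ring_1 mat"
  assumes "A \<in> carrier_mat n n" "B \<in> carrier_mat n n" "A * B = 1\<^sub>m n" "B * A = 1\<^sub>m n"
  shows "A \<in> GL n"
  using assms unfolding GL_def invertible_mat_def inverts_mat_def by auto

lemma GL_obtain_inverse:
  fixes A :: "'a::comm_ring_1 mat"
  assumes "A \<in> GL n"
  obtains B where "B \<in> GL n" "A * B = 1\<^sub>m n" "B * A = 1\<^sub>m n"
proof -
  from assms have A: "A \<in> carrier_mat n n" by simp
  from assms obtain B where B: "A * B = 1\<^sub>m n" "B * A = 1\<^sub>m (dim_row B)"
    using A unfolding GL_def invertible_mat_def inverts_mat_def by auto
  have "dim_col (A * B) = n" "dim_col (B * A) = dim_row B" using B by simp_all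
  then have "B \<in> carrier_mat n n" using A by auto
  then show thesis using that[of B] A B by (auto intro: GL_I)
qed

lemma GL_one [simp]: "1\<^sub>m n \<in> (GL n :: 'a::comm_ring_1 mat set)"
  by (rule GL_I[of _ _ "1\<^sub>m n"]) auto

lemma GL_mult:
  fixes A B :: "'a::comm_ring_1 mat"
  assumes "A \<in> GL n" "B \<in> GL n" shows "A * B \<in> GL n"
proof -
  from GL_obtain_inverse[OF assms(1)] obtain A' where A': "A' \<in> GL n" "A * A' = 1\<^sub>m n" "A' * A = 1\<^sub>m n" .
  from GL_obtain_inverse[OF assms(2)] obtain B' where B': "B' \<in> GL n" "B * B' = 1\<^sub>m n" "B' * B = 1\<^sub>m n" .
  have c: "A \<in> carrier_mat n n" "B \<in> carrier_mat n n" "A' \<in> carrier_mat n n" "B' \<in> carrier_mat n n"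
    using assms A' B' by auto
  have "A * B * (B' * A') = A * (B * B') * A'"
    using c by (simp add: assoc_mult_mat[where n\<^sub>2=n and n\<^sub>3=n and n\<^sub>4=n])
  moreover have "B' * A' * (A * B) = B' * (A' * A) * B"
    using c by (simp add: assoc_mult_mat[where n\<^sub>2=n and n\<^sub>3=n and n\<^sub>4=n])
  ultimately show ?thesis using A' B' c by (intro GL_I[of _ _ "B' * A'"]) auto
qed

text \<open>The identity plus the rank one matrix \<open>a v\<^sup>T\<close>. Transpositions, row and column operations
  and the transvections that act on Haar matrices below are all of this form, and a single
  criterion decides whether they are invertible.\<close>

definition rank1 :: "nat \<Rightarrow> (nat \<Rightarrow> 'a) \<Rightarrow> (nat \<Rightarrow> 'a) \<Rightarrow> 'a::comm_ring_1 mat" where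
  "rank1 n a v = mat n n (\<lambda>(r, c). (if r = c then 1 else 0) + a r * v c)"

lemma rank1_carrier [simp]: "rank1 n a v \<in> carrier_mat n n"
  by (simp add: rank1_def)

lemma sum_delta_mult: "i < (n::nat) \<Longrightarrow> (\<Sum>s<n. (if i = s then 1 else 0) * f s) = (f i :: 'a::comm_ring_1)"
  by (simp add: if_distrib[of "\<lambda>x. x * _"] cong: if_cong)

lemma sum_delta_mult': "i < (n::nat) \<Longrightarrow> (\<Sum>s<n. f s * (if s = i then 1 else 0)) = (f i :: 'a::comm_ring_1)"
  by (simp add: if_distrib[of "\<lambda>x. _ * x"] cong: if_cong)

lemma rank1_mult_entry:
  assumes "X \<in> carrier_mat n m" "r < n" "c < m"
  shows "(rank1 n a v * X) $$ (r, c) = X $$ (r, c) + a r * (\<Sum>s<n. v s * X $$ (s, c))"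
proof -
  have "(rank1 n a v * X) $$ (r, c) = (\<Sum>s<n. ((if r = s then 1 else 0) + a r * v s) * X $$ (s, c))"
    using assms by (subst mult_entry[of _ n n _ m]) (simp_all add: rank1_def)
  also have "\<dots> = (\<Sum>s<n. (if r = s then 1 else 0) * X $$ (s, c)) + a r * (\<Sum>s<n. v s * X $$ (s, c))"
    by (simp only: distrib_right sum.distrib sum_distrib_left mult.assoc)
  finally show ?thesis using assms by (simp add: sum_delta_mult)
qed

lemma mult_rank1_entry:
  assumes "X \<in> carrier_mat m n" "r < m" "c < n"
  shows "(X * rank1 n a v) $$ (r, c) = X $$ (r, c) + (\<Sum>s<n. X $$ (r, s) * a s) * v c"
proof -
  have "(X * rank1 n a v) $$ (r, c) = (\<Sum>s<n. X $$ (r, s) * ((if s = c then 1 else 0) + a s * v c))"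
    using assms by (subst mult_entry[of _ m n _ n]) (simp_all add: rank1_def)
  also have "\<dots> = (\<Sum>s<n. X $$ (r, s) * (if s = c then 1 else 0)) + (\<Sum>s<n. X $$ (r, s) * a s) * v c"
    by (simp only: distrib_left sum.distrib sum_distrib_right mult.assoc)
  finally show ?thesis using assms by (simp only: sum_delta_mult')
qed

text \<open>The Sherman--Morrison formula: the inverse of \<open>I + a v\<^sup>T\<close> is
  \<open>I - (1 + v\<^sup>T a)\<^sup>-\<^sup>1 a v\<^sup>T\<close>.\<close>

lemma rank1_inverse:
  fixes a v :: "nat \<Rightarrow> 'a::comm_ring_1"
  assumes "(1 + (\<Sum>s<n. v s * a s)) * w = 1"
  shows "rank1 n a v * rank1 n (\<lambda>r. - w * a r) v = 1\<^sub>m n"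
proof (rule eq_matI)
  fix r c assume "r < dim_row (1\<^sub>m n :: 'a mat)" "c < dim_col (1\<^sub>m n :: 'a mat)"
  then have rc: "r < n" "c < n" by auto
  define S where "S = (\<Sum>s<n. v s * a s)"
  have v: "(\<Sum>s<n. v s * rank1 n (\<lambda>r. - w * a r) v $$ (s, c)) = v c + (- w * S) * v c"
  proof -
    have "(\<Sum>s<n. v s * rank1 n (\<lambda>r. - w * a r) v $$ (s, c))
        = (\<Sum>s<n. v s * (if s = c then 1 else 0) + (v s * a s) * (- w * v c))"
      by (rule sum.cong) (use rc in \<open>auto simp: rank1_def algebra_simps\<close>)
    also have "\<dots> = v c + S * (- w * v c)"
      using rc by (simp only: sum.distrib sum_delta_mult' S_def sum_distrib_right)
    finally show ?thesis by (simp add: algebra_simps)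
  qed
  have "(rank1 n a v * rank1 n (\<lambda>r. - w * a r) v) $$ (r, c)
      = (if r = c then 1 else 0) + - w * a r * v c + a r * (v c + (- w * S) * v c)"
    using rc by (subst rank1_mult_entry[of _ n n]) (simp_all only: v rank1_carrier, simp add: rank1_def)
  also have "\<dots> = (if r = c then 1 else 0) + a r * v c * (1 - (1 + S) * w)"
    by (simp add: algebra_simps)
  finally show "(rank1 n a v * rank1 n (\<lambda>r. - w * a r) v) $$ (r, c) = 1\<^sub>m n $$ (r, c)"
    using rc assms by (simp add: S_def)
qed (auto simp: rank1_def)

lemma rank1_GL:
  fixes a v :: "nat \<Rightarrow> 'a::comm_ring_1"
  assumes "(1 + (\<Sum>s<n. v s * a s)) dvd 1"
  shows "rank1 n a v \<in> GL n"
proof -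
  from assms obtain w where w: "1 = (1 + (\<Sum>s<n. v s * a s)) * w" by (rule dvdE)
  define S where "S = (\<Sum>s<n. v s * a s)"
  have "(\<Sum>s<n. v s * (- w * a s)) = - w * S"
    unfolding S_def sum_distrib_left by (rule sum.cong) (auto simp: algebra_simps)
  then have "(1 + (\<Sum>s<n. v s * (- w * a s))) * (1 + S) = 1"
    using w unfolding S_def[symmetric] by (simp add: algebra_simps)
  then have "rank1 n (\<lambda>r. - w * a r) v * rank1 n (\<lambda>r. - (1 + S) * (- w * a r)) v = 1\<^sub>m n"
    by (rule rank1_inverse)
  also have "(\<lambda>r. - (1 + S) * (- w * a r)) = a"
  proof
    fix r
    have "- (1 + S) * (- w * a r) = ((1 + S) * w) * a r"
        by (simp only: mult.assoc minus_mult_minus mult_minus_left mult_minus_right minus_minus)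
    then show "- (1 + S) * (- w * a r) = a r" using w unfolding S_def[symmetric] by simp
  qed
  finally have "rank1 n (\<lambda>r. - w * a r) v * rank1 n a v = 1\<^sub>m n" .
  then show ?thesis using w by (intro GL_I[OF _ _ rank1_inverse[of v a n w]]) auto
qed

definition swap_mat :: "nat \<Rightarrow> nat \<Rightarrow> nat \<Rightarrow> 'a::comm_ring_1 mat" where
  "swap_mat n i j = rank1 n (\<lambda>r. (if r = i then 1 else 0) - (if r = j then 1 else 0))
                         (\<lambda>r. (if j = r then 1 else 0) - (if i = r then 1 else 0))"

lemma swap_mat_carrier [simp]: "swap_mat n i j \<in> carrier_mat n n"
  by (simp add: swap_mat_def)

lemma swap_mat_mult_entry:
  assumes "X \<in> carrier_mat n m" "r < n" "c < m" "i < n" "j < n"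
  shows "(swap_mat n i j * X) $$ (r, c) = X $$ (Transposition.transpose i j r, c)"
  using assms unfolding swap_mat_def
  by (subst rank1_mult_entry[of _ n m]) (auto simp: left_diff_distrib sum_subtractf sum_delta_mult Transposition.transpose_def)

lemma mult_swap_mat_entry:
  assumes "X \<in> carrier_mat m n" "r < m" "c < n" "i < n" "j < n"
  shows "(X * swap_mat n i j) $$ (r, c) = X $$ (r, Transposition.transpose i j c)"
  using assms unfolding swap_mat_def
  by (subst mult_rank1_entry[of _ m n]) (auto simp: right_diff_distrib sum_subtractf sum_delta_mult' Transposition.transpose_def)

lemma swap_mat_GL: "i < n \<Longrightarrow> j < n \<Longrightarrow> swap_mat n i j \<in> (GL n :: 'a::comm_ring_1 mat set)"
proof -
  assume ij: "i < n" "j < n"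
  have "swap_mat n i j * swap_mat n i j = (1\<^sub>m n :: 'a mat)"
  proof (rule eq_matI)
    fix r c assume "r < dim_row (1\<^sub>m n :: 'a mat)" "c < dim_col (1\<^sub>m n :: 'a mat)"
    then show "(swap_mat n i j * swap_mat n i j) $$ (r, c) = (1\<^sub>m n :: 'a mat) $$ (r, c)"
      using ij by (subst swap_mat_mult_entry[of _ n n])
        (auto simp: swap_mat_def rank1_def Transposition.transpose_def)
  qed (auto simp: swap_mat_def rank1_def)
  then show "swap_mat n i j \<in> (GL n :: 'a mat set)" by (intro GL_I[of _ n "swap_mat n i j"]) auto
qed

section \<open>Triangularization\<close>

lemma padic_dvd_linear: "(x :: 'p::prime_card padic_int) dvd y \<or> y dvd x"
proof (cases "x = 0 \<or> y = 0")
  case False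
  obtain a u where x: "x = \<pi> ^ a * u" "u dvd 1" using padic_decompose[of x] False by blast
  obtain b w where y: "y = \<pi> ^ b * w" "w dvd 1" using padic_decompose[of y] False by blast
  have "\<pi> ^ a * u dvd \<pi> ^ b * w" if "a \<le> b"
    using that x(2) by (meson dvd_trans le_imp_power_dvd mult_dvd_mono one_dvd)
  moreover have "\<pi> ^ b * w dvd \<pi> ^ a * u" if "b \<le> a"
    using that y(2) by (meson dvd_trans le_imp_power_dvd mult_dvd_mono one_dvd)
  ultimately show ?thesis using x y nle_le by blast
qed auto

lemma padic_min_dvd:
  fixes f :: "'b \<Rightarrow> 'p::prime_card padic_int"
  assumes "finite S" "S \<noteq> {}"
  shows "\<exists>s\<in>S. \<forall>t\<in>S. f s dvd f t"
  using assms
proof (induction S rule: finite_ne_induct)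
  case (insert x F)
  then obtain s where s: "s \<in> F" "\<forall>t\<in>F. f s dvd f t" by blast
  show ?case
  proof (cases "f s dvd f x")
    case True then show ?thesis using s by blast
  next
    case False
    then have "f x dvd f s" using padic_dvd_linear by blast
    then have "\<forall>t\<in>insert x F. f x dvd f t"
      using s(2) dvd_trans[of "f x" "f s"] by auto
    then show ?thesis by blast
  qed
qed auto

text \<open>Divisibility is a total preorder on \<open>\<int>\<^sub>p\<close>, so some entry of column \<open>i\<close> on or below the diagonal
  divides all the others. Moved to the diagonal it clears the entries below it. The row
  operations involve only the rows from \<open>i\<close> on, so that they do not disturb the columns which
  vanish there.\<close>

lemma clear_column:
  fixes X :: "'p::prime_card padic_int mat"
  assumes X: "X \<in> carrier_mat n n" and i: "i < n"
  shows "\<exists>W\<in>GL n. (\<forall>r<n. i < r \<longrightarrow> (W * X) $$ (r, i) = 0) \<and>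
           (\<forall>c<n. (\<forall>r<n. i \<le> r \<longrightarrow> X $$ (r, c) = 0) \<longrightarrow> (\<forall>r<n. (W * X) $$ (r, c) = X $$ (r, c)))"
proof -
  obtain j where j: "j \<in> {i..<n}" "\<forall>t\<in>{i..<n}. X $$ (j, i) dvd X $$ (t, i)"
    using padic_min_dvd[of "{i..<n}" "\<lambda>t. X $$ (t, i)"] i by auto
  define Y where "Y = swap_mat n i j * X"
  have Y: "Y \<in> carrier_mat n n" using X unfolding Y_def by (intro mult_carrier_mat[of _ n n]) auto
  have Ye: "Y $$ (r, c) = X $$ (Transposition.transpose i j r, c)" if "r < n" "c < n" for r c
    unfolding Y_def using that i j X by (subst swap_mat_mult_entry[of _ n n]) auto
  have dv: "Y $$ (i, i) dvd Y $$ (r, i)" if "i \<le> r" "r < n" for r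
    using that i j by (auto simp: Ye Transposition.transpose_def)
  then obtain a where a: "\<And>r. i \<le> r \<Longrightarrow> r < n \<Longrightarrow> Y $$ (r, i) = Y $$ (i, i) * a r"
    unfolding dvd_def by metis
  define b where "b r = (if i < r then - a r else 0)" for r
  define E where "E = rank1 n b (\<lambda>s. if i = s then 1 else 0)"
  have E: "E \<in> GL n" unfolding E_def
    by (rule rank1_GL) (use i in \<open>simp add: sum_delta_mult b_def\<close>)
  have Ee: "(E * Y) $$ (r, c) = Y $$ (r, c) + b r * Y $$ (i, c)" if "r < n" "c < n" for r c
    unfolding E_def using that i Y by (subst rank1_mult_entry[of _ n n]) (auto simp: sum_delta_mult)
  have EX: "E * swap_mat n i j * X = E * Y"
    unfolding Y_def using E X by (intro assoc_mult_mat) auto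
  show ?thesis
  proof (intro bexI[of _ "E * swap_mat n i j"] conjI allI impI)
    show "E * swap_mat n i j \<in> GL n" using E swap_mat_GL[OF i, of j] j by (intro GL_mult) auto
    fix r assume "r < n" "i < r"
    then show "(E * swap_mat n i j * X) $$ (r, i) = 0"
      unfolding EX using i by (simp add: Ee a[of r] b_def)
  next
    fix c r assume c: "c < n" "\<forall>r<n. i \<le> r \<longrightarrow> X $$ (r, c) = 0" and r: "r < n"
    have "Y $$ (i, c) = 0" "Y $$ (r, c) = X $$ (r, c)"
      using c r i j by (auto simp: Ye Transposition.transpose_def)
    then show "(E * swap_mat n i j * X) $$ (r, c) = X $$ (r, c)"
      unfolding EX using r c by (simp add: Ee)
  qed
qed

lemma upper_triangular_mult:
  fixes R T :: "'a::comm_ring_1 mat"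
  assumes c: "R \<in> carrier_mat n n" "T \<in> carrier_mat n n"
    and R: "\<And>l r. l < r \<Longrightarrow> r < n \<Longrightarrow> R $$ (r, l) = 0" and T: "\<And>l r. l < r \<Longrightarrow> r < n \<Longrightarrow> T $$ (r, l) = 0"
  shows "l < r \<Longrightarrow> r < n \<Longrightarrow> (R * T) $$ (r, l) = 0"
    and "r < n \<Longrightarrow> (R * T) $$ (r, r) = R $$ (r, r) * T $$ (r, r)"
proof -
  have ent: "(R * T) $$ (r, l) = (\<Sum>s<n. R $$ (r, s) * T $$ (s, l))" if "r < n" "l < n" for r l
    using that by (rule mult_entry[OF c])
  show "(R * T) $$ (r, l) = 0" if "l < r" "r < n"
  proof -
    have "R $$ (r, s) * T $$ (s, l) = 0" if "s < n" for s
      using R[of s r] T[of l s] \<open>l < r\<close> \<open>r < n\<close> that by (cases "s < r") auto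
    then show ?thesis using that by (subst ent) (auto intro!: sum.neutral)
  qed
  show "(R * T) $$ (r, r) = R $$ (r, r) * T $$ (r, r)" if r: "r < n"
  proof -
    have "(\<Sum>s<n. R $$ (r, s) * T $$ (s, r)) = (\<Sum>s<n. if s = r then R $$ (r, s) * T $$ (s, r) else 0)"
    proof (rule sum.cong)
      fix s assume "s \<in> {..<n}"
      then show "R $$ (r, s) * T $$ (s, r) = (if s = r then R $$ (r, s) * T $$ (s, r) else 0)"
        using R[of s r] T[of r s] r by (cases s r rule: linorder_cases) auto
    qed simp
    then show ?thesis using r by (subst ent[OF r r]) simp
  qed
qed

text \<open>The Iwasawa decomposition of a matrix with p-adic integer entries.\<close>

lemma triangularize:
  fixes X :: "'p::prime_card padic_int mat"
  assumes X: "X \<in> carrier_mat n n"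
  shows "\<exists>U\<in>GL n. \<forall>l<n. \<forall>r<n. l < r \<longrightarrow> (U * X) $$ (r, l) = 0"
proof -
  have "\<exists>U\<in>GL n. \<forall>l<i. \<forall>r<n. l < r \<longrightarrow> (U * X) $$ (r, l) = 0" if "i \<le> n" for i
    using that
  proof (induction i)
    case 0 show ?case by (intro bexI[of _ "1\<^sub>m n"]) auto
  next
    case (Suc i)
    then obtain U where U: "U \<in> GL n" "\<forall>l<i. \<forall>r<n. l < r \<longrightarrow> (U * X) $$ (r, l) = 0"
      by auto
    have i: "i < n" using Suc.prems by simp
    have UX: "U * X \<in> carrier_mat n n" using U X by auto
    from clear_column[OF UX i] obtain W where W: "W \<in> GL n"
      and W': "(\<forall>r<n. i < r \<longrightarrow> (W * (U * X)) $$ (r, i) = 0) \<and>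
        (\<forall>c<n. (\<forall>r<n. i \<le> r \<longrightarrow> (U * X) $$ (r, c) = 0) \<longrightarrow> (\<forall>r<n. (W * (U * X)) $$ (r, c) = (U * X) $$ (r, c)))"
      by (rule bexE)
    have "W * U * X = W * (U * X)" using W U X by (intro assoc_mult_mat) auto
    moreover have "(W * (U * X)) $$ (r, l) = 0" if "l < Suc i" "r < n" "l < r" for l r
    proof (cases "l = i")
      case False
      then have "l < i" using that by simp
      then have "\<forall>r<n. i \<le> r \<longrightarrow> (U * X) $$ (r, l) = 0" using U(2) by auto
      then have "(W * (U * X)) $$ (r, l) = (U * X) $$ (r, l)"
        using W' \<open>l < i\<close> i that(2) by (meson less_trans)
      then show ?thesis using U(2) \<open>l < i\<close> that by simp
    qed (use W' that in auto)
    ultimately show ?case using W U by (intro bexI[of _ "W * U"]) (auto intro: GL_mult)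
  qed
  from this[of n] show ?thesis by auto
qed

section \<open>Singular numbers\<close>

definition pi_diag :: "nat \<Rightarrow> (nat \<Rightarrow> nat) \<Rightarrow> 'p::prime_card padic_int mat" where
  "pi_diag n a = mat n n (\<lambda>(r, c). if r = c then \<pi> ^ a r else 0)"

lemma pi_diag_carrier [simp]: "pi_diag n a \<in> carrier_mat n n"
  by (simp add: pi_diag_def)

lemma pi_power_dvd_le:
  assumes "(\<pi> :: 'p::prime_card padic_int) ^ a dvd \<pi> ^ v * u" "u dvd 1"
  shows "a \<le> v"
proof (rule ccontr)
  assume "\<not> a \<le> v"
  then have "(\<pi> :: 'p padic_int) ^ (1 + v) dvd \<pi> ^ a" by (intro le_imp_power_dvd) simp
  then have "(\<pi> :: 'p padic_int) ^ (1 + v) dvd \<pi> ^ v * u" using assms(1) dvd_trans by blast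
  then have "(\<pi> :: 'p padic_int) ^ 1 dvd u" by (simp only: pi_power_mult_dvd_cancel)
  then show False using assms(2) padic_unit_iff[of u] by simp
qed

lemma det_zero_row:
  fixes A :: "'a::comm_ring_1 mat"
  assumes "A \<in> carrier_mat n n" "i < n" "\<And>j. j < n \<Longrightarrow> A $$ (i, j) = 0"
  shows "det A = 0"
  using laplace_expansion_row[OF assms(1,2)] assms(3) by simp

lemma GL_det_dvd:
  fixes A :: "'a::comm_ring_1 mat"
  assumes "A \<in> GL n" shows "det A dvd 1"
proof -
  obtain B where B: "B \<in> GL n" "A * B = 1\<^sub>m n" using GL_obtain_inverse[OF assms] by blast
  then have "det A * det B = 1" using det_mult[of A n B] assms by (simp add: det_one)
  then show ?thesis by (metis dvd_triv_left)
qed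

text \<open>The state of the Smith algorithm after \<open>i\<close> pivots: the first \<open>i\<close> rows and columns are
  diagonal with increasing powers of \<open>p\<close>, and each of these powers divides the remaining block.\<close>

definition smith_upto :: "nat \<Rightarrow> nat \<Rightarrow> 'p::prime_card padic_int mat \<Rightarrow> (nat \<Rightarrow> nat) \<Rightarrow> bool" where
  "smith_upto n i Y a \<longleftrightarrow>
     (\<forall>r<n. \<forall>c<n. r \<noteq> c \<longrightarrow> r < i \<or> c < i \<longrightarrow> Y $$ (r, c) = 0) \<and>
     (\<forall>r<i. Y $$ (r, r) = \<pi> ^ a r) \<and> (\<forall>r s. r \<le> s \<longrightarrow> s < i \<longrightarrow> a r \<le> a s) \<and>
     (\<forall>l<i. \<forall>r<n. \<forall>c<n. i \<le> r \<longrightarrow> i \<le> c \<longrightarrow> \<pi> ^ a l dvd Y $$ (r, c))"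

text \<open>An entry of the remaining block of least valuation is moved to the diagonal. It divides
  its row and its column, which are cleared by one row and one column operation.\<close>

lemma smith_step:
  fixes Y :: "'p::prime_card padic_int mat"
  assumes Y: "Y \<in> carrier_mat n n" and i: "i < n" and det: "det Y \<noteq> 0"
    and sm: "smith_upto n i Y a"
  shows "\<exists>U\<in>GL n. \<exists>V\<in>GL n. \<exists>a'. smith_upto n (Suc i) (U * Y * V) a'"
proof -
  have off: "Y $$ (r, c) = 0" if "r < n" "c < n" "r \<noteq> c" "r < i \<or> c < i" for r c
    using sm that by (auto simp: smith_upto_def)
  have dia: "Y $$ (r, r) = \<pi> ^ a r" if "r < i" for r
    using sm that by (simp add: smith_upto_def)
  have mono: "a r \<le> a s" if "r \<le> s" "s < i" for r s
    using sm that by (simp add: smith_upto_def)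
  have div: "\<pi> ^ a l dvd Y $$ (r, c)" if "l < i" "r < n" "c < n" "i \<le> r" "i \<le> c" for l r c
    using sm that by (simp add: smith_upto_def)
  obtain s where s: "s \<in> {i..<n} \<times> {i..<n}" "\<forall>t\<in>{i..<n} \<times> {i..<n}. Y $$ s dvd Y $$ t"
    using padic_min_dvd[of "{i..<n} \<times> {i..<n}" "\<lambda>t. Y $$ t"] i by auto
  obtain j k where "s = (j, k)" by (cases s)
  with s have jk: "i \<le> j" "j < n" "i \<le> k" "k < n"
    and min: "\<And>r c. i \<le> r \<Longrightarrow> r < n \<Longrightarrow> i \<le> c \<Longrightarrow> c < n \<Longrightarrow> Y $$ (j, k) dvd Y $$ (r, c)"
    by auto
  have "Y $$ (j, k) \<noteq> 0"
  proof
    assume "Y $$ (j, k) = 0"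
    then have "Y $$ (i, c) = 0" if "c < n" for c
      using min[of i c] off[of i c] that i by (cases "i \<le> c") auto
    then show False using det_zero_row[OF Y i] det by blast
  qed
  then obtain v u where vu: "Y $$ (j, k) = \<pi> ^ v * u" "u dvd 1" by (rule padic_decompose)
  from vu(2) obtain w where "1 = u * w" by (rule dvdE)
  then have w: "u * w = 1" by (rule sym)
  define Z where "Z = swap_mat n i j * Y * swap_mat n i k"
  have Z: "Z \<in> carrier_mat n n" unfolding Z_def by (intro mult_carrier_mat[of _ n n] Y) auto
  have Ze: "Z $$ (r, c) = Y $$ (Transposition.transpose i j r, Transposition.transpose i k c)"
    if "r < n" "c < n" for r c
  proof -
    have "Transposition.transpose i k c < n" using that i jk by (auto simp: Transposition.transpose_def)
    moreover have "swap_mat n i j * Y \<in> carrier_mat n n" by (intro mult_carrier_mat[of _ n n] Y) auto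
    ultimately show ?thesis unfolding Z_def using that i jk Y
      by (subst mult_swap_mat_entry[of _ n n]) (auto simp: swap_mat_mult_entry[of _ n n])
  qed
  have Zoff: "Z $$ (r, c) = 0" if "r < n" "c < n" "r \<noteq> c" "r < i \<or> c < i" for r c
    using that i jk by (subst Ze) (auto simp: Transposition.transpose_def intro!: off)
  have Zdia: "Z $$ (r, r) = \<pi> ^ a r" if "r < i" for r
    using that i jk by (subst Ze) (auto simp: Transposition.transpose_def dia)
  have "\<pi> ^ v dvd Y $$ (j, k)" using vu by simp
  then have Ydvd: "\<pi> ^ v dvd Y $$ (r, c)" if "r < n" "c < n" "i \<le> r" "i \<le> c" for r c
    using dvd_trans[OF _ min[of r c]] that by blast
  have Zdvd: "\<pi> ^ v dvd Z $$ (r, c)" if "r < n" "c < n" "i \<le> r" "i \<le> c" for r c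
    using that i jk by (subst Ze) (auto simp: Transposition.transpose_def intro!: Ydvd)
  have Zii: "Z $$ (i, i) = \<pi> ^ v * u" using i vu by (simp add: Ze)
  have "\<forall>r c. \<exists>z. r < n \<longrightarrow> c < n \<longrightarrow> i \<le> r \<longrightarrow> i \<le> c \<longrightarrow> Z $$ (r, c) = \<pi> ^ v * z"
    using Zdvd unfolding dvd_def by auto
  then obtain z where z: "\<And>r c. r < n \<Longrightarrow> c < n \<Longrightarrow> i \<le> r \<Longrightarrow> i \<le> c \<Longrightarrow> Z $$ (r, c) = \<pi> ^ v * z r c"
    unfolding choice_iff by blast
  \<comment> \<open>The row operation turns the pivot \<open>\<pi>\<^sup>v u\<close> into \<open>\<pi>\<^sup>v\<close> (this is the entry \<open>w - 1\<close>) and clears its column.\<close>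
  define b where "b r = (if r < i then 0 else if r = i then w - 1 else - z r i * w)" for r
  define E where "E = rank1 n b (\<lambda>s. if i = s then 1 else 0)"
  have "w dvd 1" using w by (metis dvd_triv_right)
  then have E: "E \<in> GL n" unfolding E_def
    by (intro rank1_GL) (use i in \<open>simp add: sum_delta_mult b_def\<close>)
  define d where "d c = (if c \<le> i then 0 else - w * z i c)" for c
  define F where "F = rank1 n (\<lambda>s. if s = i then 1 else 0) d"
  have F: "F \<in> GL n" unfolding F_def
    by (intro rank1_GL) (use i in \<open>simp add: sum_delta_mult' d_def\<close>)
  have EZ: "E * Z \<in> carrier_mat n n" using E Z by (intro mult_carrier_mat[of _ n n]) auto
  have EZe: "(E * Z) $$ (r, c) = Z $$ (r, c) + b r * Z $$ (i, c)" if "r < n" "c < n" for r c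
    unfolding E_def using that i Z by (subst rank1_mult_entry[of _ n n]) (auto simp: sum_delta_mult)
  define R where "R = E * Z * F"
  have Re: "R $$ (r, c) = (E * Z) $$ (r, c) + (E * Z) $$ (r, i) * d c" if "r < n" "c < n" for r c
    unfolding R_def F_def using that i EZ by (subst mult_rank1_entry[of _ n n]) (auto simp: sum_delta_mult')
  have EZii: "(E * Z) $$ (i, i) = \<pi> ^ v"
  proof -
    have "(E * Z) $$ (i, i) = \<pi> ^ v * (u * w)"
      using i by (simp add: EZe Zii b_def algebra_simps)
    then show ?thesis by (simp only: w mult_1_right)
  qed
  have EZri: "(E * Z) $$ (r, i) = 0" if "i < r" "r < n" for r
  proof -
    have "(E * Z) $$ (r, i) = \<pi> ^ v * z r i - z r i * w * (\<pi> ^ v * u)"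
      using that i by (simp add: EZe Zii z[of r i] b_def)
    also have "\<dots> = \<pi> ^ v * z r i * (1 - u * w)" by (simp add: algebra_simps)
    finally show ?thesis using w by simp
  qed
  have EZic: "(E * Z) $$ (i, c) = \<pi> ^ v * (w * z i c)" if "i < c" "c < n" for c
    using that i by (simp add: EZe z[of i c] b_def algebra_simps)
  have EZlow: "(E * Z) $$ (r, c) = Z $$ (r, c)" if "r < n" "c < n" "r < i \<or> c < i" for r c
    using that Zoff[of i c] i by (auto simp: EZe b_def)
  have Roff: "R $$ (r, c) = 0" if rc: "r < n" "c < n" "r \<noteq> c" "r < Suc i \<or> c < Suc i" for r c
  proof -
    consider "r < i" | "c < i" "i \<le> r" | "r = i" "i < c" | "c = i" "i < r" using rc by linarith
    then show ?thesis
    proof cases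
      case 1
      then show ?thesis using rc i by (simp add: Re EZlow Zoff)
    next
      case 2
      then show ?thesis using rc i by (simp add: Re EZlow Zoff d_def)
    next
      case 3
      then show ?thesis using rc i by (simp add: Re EZii EZic d_def)
    next
      case 4
      then show ?thesis using rc i by (simp add: Re EZri d_def)
    qed
  qed
  have Rdia: "R $$ (r, r) = \<pi> ^ (a(i := v)) r" if "r < Suc i" for r
    using that i by (cases "r = i") (auto simp: Re EZii EZlow Zdia Zoff d_def)
  have av: "a l \<le> v" if "l < i" for l
    using div[OF that, of j k] jk vu by (auto intro: pi_power_dvd_le)
  have Rdvd: "\<pi> ^ (a(i := v)) l dvd R $$ (r, c)" if "l < Suc i" "r < n" "c < n" "Suc i \<le> r" "Suc i \<le> c"
      for l r c
  proof -
    have "\<pi> ^ v dvd R $$ (r, c)"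
    proof -
      have "R $$ (r, c) = (E * Z) $$ (r, c)" using that i by (simp add: Re EZri)
      also have "\<dots> = Z $$ (r, c) + b r * Z $$ (i, c)" using that by (simp add: EZe)
      finally show ?thesis using that i Zdvd[of r c] Zdvd[of i c] by simp
    qed
    moreover have "(a(i := v)) l \<le> v" using that av by (cases "l = i") auto
    ultimately show ?thesis by (meson dvd_trans le_imp_power_dvd)
  qed
  have "smith_upto n (Suc i) R (a(i := v))"
    unfolding smith_upto_def
  proof (intro conjI allI impI)
    fix r s assume "r \<le> s" "s < Suc i"
    then show "(a(i := v)) r \<le> (a(i := v)) s"
      using mono[of r s] av[of r] by (cases "s = i") auto
  qed (use Roff Rdia Rdvd in blast)+
  moreover have "R = (E * swap_mat n i j) * Y * (swap_mat n i k * F)"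
    using E F Y Z by (simp add: R_def Z_def assoc_mult_mat[of _ n n _ n _ n] mult_carrier_mat[of _ n n])
  ultimately show ?thesis
    using E F i jk by (intro bexI[of _ "E * swap_mat n i j"] bexI[of _ "swap_mat n i k * F"] exI[of _
        "a(i := v)"])
      (auto intro!: GL_mult swap_mat_GL)
qed

lemma smith_exists:
  fixes X :: "'p::prime_card padic_int mat"
  assumes X: "X \<in> carrier_mat n n" and det: "det X \<noteq> 0"
  shows "\<exists>U\<in>GL n. \<exists>V\<in>GL n. \<exists>b. (\<forall>r s. r \<le> s \<longrightarrow> s < n \<longrightarrow> b r \<le> b s) \<and> U * X * V = pi_diag n b"
proof -
  have "\<exists>U\<in>GL n. \<exists>V\<in>GL n. \<exists>a. smith_upto n i (U * X * V) a" if "i \<le> n" for i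
    using that
  proof (induction i)
    case 0 show ?case by (intro bexI[of _ "1\<^sub>m n"]) (auto simp: smith_upto_def)
  next
    case (Suc i)
    then obtain U V a where UV: "U \<in> GL n" "V \<in> GL n" "smith_upto n i (U * X * V) a" by auto
    have c: "U \<in> carrier_mat n n" "V \<in> carrier_mat n n" using UV by auto
    have "det (U * X * V) = det U * det X * det V"
      using c X by (simp add: det_mult[of _ n])
    also have "\<dots> \<noteq> 0" using det GL_det_dvd[OF UV(1)] GL_det_dvd[OF UV(2)] by auto
    finally obtain U' V' a' where UV': "U' \<in> GL n" "V' \<in> GL n" "smith_upto n (Suc i) (U' * (U * X * V) * V') a'"
      using smith_step[of "U * X * V" n i a] UV(3) c X Suc.prems by auto
    have c': "U' \<in> carrier_mat n n" "V' \<in> carrier_mat n n" using UV' by auto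
    have "U' * (U * X * V) * V' = (U' * U) * X * (V * V')"
      using c c' X by (simp add: assoc_mult_mat[of _ n n _ n _ n] mult_carrier_mat[of _ n n])
    then show ?case using UV UV'
      by (intro bexI[of _ "U' * U"] bexI[of _ "V * V'"] exI[of _ a']) (auto intro: GL_mult)
  qed
  from this[OF order_refl] obtain U V a
    where UV: "U \<in> GL n" "V \<in> GL n" "smith_upto n n (U * X * V) a" by auto
  have "U * X * V = pi_diag n a"
  proof (rule eq_matI)
    fix r c assume "r < dim_row (pi_diag n a :: 'p padic_int mat)"
        "c < dim_col (pi_diag n a :: 'p padic_int mat)"
    then have "r < n" "c < n" by (auto simp: pi_diag_def)
    then show "(U * X * V) $$ (r, c) = pi_diag n a $$ (r, c)"
      using UV(3) by (auto simp: pi_diag_def smith_upto_def)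
  qed (use UV(1,2) in \<open>auto simp: pi_diag_def dest!: GL_carrier\<close>)
  moreover have "\<forall>r s. r \<le> s \<longrightarrow> s < n \<longrightarrow> a r \<le> a s" using UV(3) by (auto simp: smith_upto_def)
  ultimately show ?thesis using UV(1,2) by blast
qed

lemma dvd_prod_diff:
  fixes f g :: "'b \<Rightarrow> 'a::comm_ring_1"
  assumes "\<And>i. i \<in> S \<Longrightarrow> d dvd f i - g i"
  shows "d dvd prod f S - prod g S"
  using assms
proof (induction S rule: infinite_finite_induct)
  case (insert x S)
  have "prod f (insert x S) - prod g (insert x S) = f x * (prod f S - prod g S) + (f x - g x) * prod g S"
    using insert by (simp add: algebra_simps)
  then show ?case using insert by (simp add: dvd_add)
qed auto

text \<open>Reduction modulo \<open>d\<close> commutes with the determinant.\<close>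

lemma dvd_det_diff:
  fixes A B :: "'a::comm_ring_1 mat"
  assumes A: "A \<in> carrier_mat n n" and B: "B \<in> carrier_mat n n"
    and d: "\<And>i j. i < n \<Longrightarrow> j < n \<Longrightarrow> d dvd A $$ (i, j) - B $$ (i, j)"
  shows "d dvd det A - det B"
  unfolding det_def'[OF A] det_def'[OF B] sum_subtractf[symmetric] right_diff_distrib[symmetric]
proof (intro dvd_sum dvd_mult dvd_prod_diff)
  fix p i assume "p \<in> {p. p permutes {0..<n}}" "i \<in> {0..<n}"
  then show "d dvd A $$ (i, p i) - B $$ (i, p i)"
    using permutes_in_image[of p "{0..<n}" i] by (intro d) auto
qed

text \<open>The comparison principle behind the uniqueness of singular numbers. Suppose that all \<open>a s\<close> with
  \<open>i \<le> s\<close> exceed \<open>b i\<close>. Modulo \<open>p\<^bsup>b i + 1\<^esup>\<close> the sum then has only \<open>i\<close> terms, so that the square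
  matrix of size \<open>i + 1\<close> on the left has rank at most \<open>i\<close>. After multiplying row \<open>r\<close> by \<open>p\<^bsup>b i - b r\<^esup>\<close>,
  the right-hand side is \<open>p\<^bsup>b i\<^esup>\<close> times the identity. Dividing by \<open>p\<^bsup>b i\<^esup>\<close> shows that a matrix which
  is the identity modulo \<open>p\<close> is singular, and this is absurd.\<close>

lemma factor_through_diag_le:
  fixes X Y :: "nat \<Rightarrow> nat \<Rightarrow> 'p::prime_card padic_int"
  assumes eq: "\<And>r c. r \<le> i \<Longrightarrow> c \<le> i \<Longrightarrow>
      (\<Sum>s<n. X r s * \<pi> ^ a s * Y s c) = (if r = c then \<pi> ^ b r else 0)"
    and b: "\<And>r. r \<le> i \<Longrightarrow> b r \<le> b i"
    and i: "i < n"
  shows "\<exists>s. i \<le> s \<and> s < n \<and> a s \<le> b i"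
proof (rule ccontr)
  assume "\<not> ?thesis"
  then have as: "a s = b i + Suc (a s - Suc (b i))" if "i \<le> s" "s < n" for s
    using that by force
  define E where "E r c = \<pi> ^ (b i - b r) * (\<Sum>s=i..<n. X r s * \<pi> ^ (a s - Suc (b i)) * Y s c)" for r c
  define F where "F = mat (Suc i) (Suc i) (\<lambda>(r, s). \<pi> ^ (b i - b r) * (X r s * \<pi> ^ a s))"
  \<comment> \<open>The zero row pads the product of an \<open>(i+1) \<times> i\<close> and an \<open>i \<times> (i+1)\<close> matrix to square factors.\<close>
  define G where "G = mat (Suc i) (Suc i) (\<lambda>(s, c). if s = i then 0 else Y s c)"
  define H where "H = mat (Suc i) (Suc i) (\<lambda>(r, c). (if r = c then 1 else 0) - \<pi> * E r c)"
  have FG: "F \<in> carrier_mat (Suc i) (Suc i)" "G \<in> carrier_mat (Suc i) (Suc i)" "H \<in> carrier_mat (Suc i) (Suc i)"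
    by (auto simp: F_def G_def H_def)
  have "F * G = \<pi> ^ b i \<cdot>\<^sub>m H"
  proof (rule eq_matI)
    fix r c assume "r < dim_row (\<pi> ^ b i \<cdot>\<^sub>m H)" "c < dim_col (\<pi> ^ b i \<cdot>\<^sub>m H)"
    then have rc: "r \<le> i" "c \<le> i" by (auto simp: H_def)
    have "(F * G) $$ (r, c) = (\<Sum>s<Suc i. F $$ (r, s) * G $$ (s, c))"
      using rc FG by (intro mult_entry) auto
    also have "\<dots> = (\<Sum>s<i. \<pi> ^ (b i - b r) * (X r s * \<pi> ^ a s * Y s c))"
      using rc by (simp add: F_def G_def mult.assoc)
    also have "\<dots> = \<pi> ^ (b i - b r) * (\<Sum>s<i. X r s * \<pi> ^ a s * Y s c)"
      by (simp add: sum_distrib_left)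
    also have "(\<Sum>s<i. X r s * \<pi> ^ a s * Y s c)
        = (\<Sum>s<n. X r s * \<pi> ^ a s * Y s c) - (\<Sum>s=i..<n. X r s * \<pi> ^ a s * Y s c)"
      using i sum.atLeastLessThan_concat[of 0 i n "\<lambda>s. X r s * \<pi> ^ a s * Y s c"]
      by (simp add: atLeast0LessThan algebra_simps)
    also have "\<pi> ^ (b i - b r) * \<dots> = (if r = c then \<pi> ^ (b i - b r) * \<pi> ^ b r else 0)
       - \<pi> ^ (b i - b r) * (\<Sum>s=i..<n. X r s * \<pi> ^ a s * Y s c)"
      using rc by (simp add: eq right_diff_distrib)
    also have "(\<Sum>s=i..<n. X r s * \<pi> ^ a s * Y s c)
        = \<pi> ^ b i * \<pi> * (\<Sum>s=i..<n. X r s * \<pi> ^ (a s - Suc (b i)) * Y s c)"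
      unfolding sum_distrib_left
    proof (rule sum.cong)
      fix s assume "s \<in> {i..<n}"
      then have "(\<pi> :: 'p padic_int) ^ a s = \<pi> ^ b i * (\<pi> * \<pi> ^ (a s - Suc (b i)))"
        using as[of s] by (metis atLeastLessThan_iff power_Suc power_add)
      then show "X r s * \<pi> ^ a s * Y s c = \<pi> ^ b i * \<pi> * (X r s * \<pi> ^ (a s - Suc (b i)) * Y s c)"
        by (simp add: algebra_simps)
    qed simp
    also have "\<pi> ^ (b i - b r) * \<pi> ^ b r = (\<pi> ^ b i :: 'p padic_int)"
      using b[OF rc(1)] by (simp add: power_add[symmetric] del: of_nat_power)
    finally show "(F * G) $$ (r, c) = (\<pi> ^ b i \<cdot>\<^sub>m H) $$ (r, c)"
      using rc by (simp add: H_def E_def algebra_simps del: of_nat_power)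
  qed (auto simp: F_def G_def H_def)
  then have "det F * det G = (\<pi> ^ b i) ^ dim_col H * det H"
    by (simp only: det_mult[OF FG(1,2), symmetric] det_smult)
  moreover have "det G = 0" by (rule det_zero_row[OF FG(2), of i]) (auto simp: G_def)
  ultimately have "det H = 0" by (simp del: of_nat_power)
  moreover have "\<pi> dvd det H - det (1\<^sub>m (Suc i))"
    by (rule dvd_det_diff[OF FG(3)]) (auto simp: H_def)
  ultimately show False using pi_not_dvd_1[where 'p='p] by simp
qed

text \<open>If the rows of a matrix, in some frame, are divisible by \<open>p\<^bsup>a 0\<^esup>, p\<^bsup>a 1\<^esup>, \<dots>\<close>, then its singular
  numbers in increasing order are bounded below by the sequence \<open>a\<close>.\<close>

lemma smith_le:
  fixes P :: "'p::prime_card padic_int mat"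
  assumes P: "P \<in> carrier_mat n n" and UV: "U \<in> GL n" "V \<in> GL n" "U * P * V = pi_diag n b"
    and W: "W \<in> GL n" "N \<in> carrier_mat n n" "W * P = pi_diag n a * N"
    and a: "\<And>r s. r \<le> s \<Longrightarrow> s < n \<Longrightarrow> a r \<le> a s"
    and b: "\<And>r s. r \<le> s \<Longrightarrow> s < n \<Longrightarrow> b r \<le> b s"
    and i: "i < n"
  shows "a i \<le> b i"
proof -
  obtain W' where W': "W' \<in> GL n" "W' * W = 1\<^sub>m n" using GL_obtain_inverse[OF W(1)] by metis
  define X where "X = U * W'"
  define Y where "Y = N * V"
  have c: "U \<in> carrier_mat n n" "V \<in> carrier_mat n n" "W \<in> carrier_mat n n" "W' \<in> carrier_mat n n"
    using UV W W' by auto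
  then have XY: "X \<in> carrier_mat n n" "Y \<in> carrier_mat n n" using W(2) by (auto simp: X_def Y_def)
  have "pi_diag n b = U * (W' * W) * P * V" using UV(3) c P W' right_mult_one_mat[OF c(1)] by simp
  also have "\<dots> = U * W' * (W * P) * V"
    using c P by (simp add: assoc_mult_mat[of _ n n _ n _ n] mult_carrier_mat[of _ n n])
  also have "\<dots> = X * pi_diag n a * Y"
    unfolding W(3) X_def Y_def using c P W(2)
    by (simp add: assoc_mult_mat[of _ n n _ n _ n] mult_carrier_mat[of _ n n])
  finally have e: "pi_diag n b = X * pi_diag n a * Y" .
  have Xp: "(X * pi_diag n a) $$ (r, s) = X $$ (r, s) * \<pi> ^ a s" if "r < n" "s < n" for r s
  proof -
    have "(X * pi_diag n a) $$ (r, s) = (\<Sum>t<n. X $$ (r, t) * pi_diag n a $$ (t, s))"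
      using XY that by (intro mult_entry) auto
    also have "\<dots> = (\<Sum>t<n. X $$ (r, t) * \<pi> ^ a t * (if t = s then 1 else 0))"
      by (rule sum.cong) (use that in \<open>auto simp: pi_diag_def\<close>)
    finally show ?thesis using that by (simp only: sum_delta_mult')
  qed
  have "\<exists>s. i \<le> s \<and> s < n \<and> a s \<le> b i"
  proof (rule factor_through_diag_le[where X = "\<lambda>r s. X $$ (r, s)" and Y = "\<lambda>r s. Y $$ (r, s)" and n
      = n and b = b])
    fix r c assume rc: "r \<le> i" "c \<le> i"
    have "pi_diag n b $$ (r, c) = (\<Sum>s<n. (X * pi_diag n a) $$ (r, s) * Y $$ (s, c))"
      unfolding e using XY rc i by (intro mult_entry[of _ n n _ n] mult_carrier_mat[of _ n n]) auto
    moreover have "pi_diag n b $$ (r, c) = (if r = c then (\<pi> :: 'p padic_int) ^ b r else 0)"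
      using rc i by (simp add: pi_diag_def)
    ultimately show "(\<Sum>s<n. X $$ (r, s) * \<pi> ^ a s * Y $$ (s, c)) = (if r = c then \<pi> ^ b r else 0)"
      using rc i by (simp add: Xp)
  qed (use b i in auto)
  then obtain s where "i \<le> s" "s < n" "a s \<le> b i" by blast
  with a[of i s] show ?thesis by simp
qed

lemma smith_unique:
  fixes P :: "'p::prime_card padic_int mat"
  assumes P: "P \<in> carrier_mat n n"
    and UV: "U \<in> GL n" "V \<in> GL n" "U * P * V = pi_diag n b"
    and UV': "U' \<in> GL n" "V' \<in> GL n" "U' * P * V' = pi_diag n b'"
    and b: "\<And>r s. r \<le> s \<Longrightarrow> s < n \<Longrightarrow> b r \<le> b s"
    and b': "\<And>r s. r \<le> s \<Longrightarrow> s < n \<Longrightarrow> b' r \<le> b' s"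
    and i: "i < n"
  shows "b i = b' i"
proof -
  have *: "U * P = pi_diag n b * V1" if "U \<in> GL n" "V \<in> GL n" "U * P * V = pi_diag n b" "V1 \<in> GL n"
      "V * V1 = 1\<^sub>m n"
    for U V V1 and b
  proof -
    have c: "U \<in> carrier_mat n n" "V \<in> carrier_mat n n" "V1 \<in> carrier_mat n n" using that by auto
    have "U * P * V * V1 = U * P * (V * V1)" using c P by (intro assoc_mult_mat[of _ n n _ n _ n]) auto
    also have "\<dots> = U * P" using that(5) c P by (simp add: mult_carrier_mat[of _ n n])
    finally show ?thesis using that(3) by simp
  qed
  obtain V1 where V1: "V1 \<in> GL n" "V * V1 = 1\<^sub>m n" using GL_obtain_inverse[OF UV(2)] by metis
  obtain V2 where V2: "V2 \<in> GL n" "V' * V2 = 1\<^sub>m n" using GL_obtain_inverse[OF UV'(2)] by metis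
  have "b i \<le> b' i"
    by (rule smith_le[OF P UV' UV(1) GL_carrier[OF V1(1)] *[OF UV V1] b b' i])
  moreover have "b' i \<le> b i"
    by (rule smith_le[OF P UV UV'(1) GL_carrier[OF V2(1)] *[OF UV' V2] b' b i])
  ultimately show ?thesis by simp
qed

text \<open>The Smith form above lists the exponents in increasing order, \<open>SN\<close> in decreasing order;
  conjugation by the antidiagonal permutation matrix translates between them.\<close>

definition flip_mat :: "nat \<Rightarrow> 'a::comm_ring_1 mat" where
  "flip_mat n = mat n n (\<lambda>(r, c). if r = n - 1 - c then 1 else 0)"

lemma flip_mat_carrier [simp]: "flip_mat n \<in> carrier_mat n n"
  by (simp add: flip_mat_def)

lemma mult_flip_mat_entry:
  assumes "X \<in> carrier_mat n n" "r < n" "c < n"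
  shows "(X * flip_mat n) $$ (r, c) = X $$ (r, n - 1 - c)"
proof -
  have "(X * flip_mat n) $$ (r, c) = (\<Sum>s<n. X $$ (r, s) * (if s = n - 1 - c then 1 else 0))"
    using assms by (subst mult_entry[of _ n n _ n]) (auto simp: flip_mat_def intro!: sum.cong)
  then show ?thesis using assms by (simp only: sum_delta_mult')
qed

lemma flip_mat_mult_entry:
  assumes "X \<in> carrier_mat n n" "r < n" "c < n"
  shows "(flip_mat n * X) $$ (r, c) = X $$ (n - 1 - r, c)"
proof -
  have "(flip_mat n * X) $$ (r, c) = (\<Sum>s<n. (if n - 1 - r = s then 1 else 0) * X $$ (s, c))"
    using assms by (subst mult_entry[of _ n n _ n]) (auto simp: flip_mat_def intro!: sum.cong)
  then show ?thesis using assms by (simp only: sum_delta_mult)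
qed

lemma flip_mat_GL: "flip_mat n \<in> (GL n :: 'a::comm_ring_1 mat set)"
proof -
  have "flip_mat n * flip_mat n = (1\<^sub>m n :: 'a mat)"
  proof (rule eq_matI)
    fix r c assume "r < dim_row (1\<^sub>m n :: 'a mat)" "c < dim_col (1\<^sub>m n :: 'a mat)"
    then show "(flip_mat n * flip_mat n) $$ (r, c) = (1\<^sub>m n :: 'a mat) $$ (r, c)"
      by (subst flip_mat_mult_entry) (auto simp: flip_mat_def)
  qed (auto simp: flip_mat_def)
  then show ?thesis by (intro GL_I[of _ n "flip_mat n"]) auto
qed

lemma to_fract_mat_mult:
  fixes A B :: "'a::idom mat"
  assumes "A \<in> carrier_mat n m" "B \<in> carrier_mat m k"
  shows "map_mat to_fract (A * B) = map_mat to_fract A * map_mat to_fract B"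
proof -
  have hom: "to_fract (sum f S) = (\<Sum>x\<in>S. to_fract (f x :: 'a))" for f :: "nat \<Rightarrow> 'a" and S
    by (induction S rule: infinite_finite_induct) auto
  show ?thesis
    by (rule eq_matI) (use assms in \<open>auto simp: scalar_prod_def hom\<close>)
qed

lemma to_fract_of_nat: "to_fract (of_nat k :: 'a::idom) = of_nat k"
  by (induction k) auto

lemma to_fract_power: "to_fract (x ^ k) = to_fract (x :: 'a::idom) ^ k"
  by (induction k) auto

text \<open>The description by which \<open>SN\<close> is defined has exactly one solution: one exists by the given
  diagonalization, and any other one is a Smith form of the same integral matrix. Its exponents,
  a priori integers, are nonnegative because the diagonal entries are p-adic integers.\<close>

lemma SN_nth:
  fixes P :: "'p::prime_card padic_int mat"
  assumes P: "P \<in> carrier_mat n n" and UV: "U \<in> GL n" "V \<in> GL n" "U * P * V = pi_diag n b"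
    and b: "\<And>r s. r \<le> s \<Longrightarrow> s < n \<Longrightarrow> b r \<le> b s"
    and i: "i < n"
  shows "SN (map_mat to_fract P) ! (n - 1 - i) = int (b i)"
proof -
  let ?q = "of_nat CARD('p) :: 'p padic"
  define Q where "Q ls \<longleftrightarrow> length ls = n \<and> sorted_wrt (\<ge>) ls \<and>
     (\<exists>U \<in> GL n. \<exists>V \<in> GL n. map_mat to_fract U * map_mat to_fract P * map_mat to_fract V
          = mat_diag n (\<lambda>i. ?q powi (ls ! i)))" for ls :: "int list"
  have q: "to_fract \<pi> = ?q" by (rule to_fract_of_nat)
  have q0: "?q \<noteq> 0" unfolding q[symmetric] by (simp only: to_fract_eq_0_iff pi_nonzero not_False_eq_True)
  have mapUV: "map_mat to_fract U * map_mat to_fract P * map_mat to_fract V = map_mat to_fract (U * P * V)"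
    if "U \<in> carrier_mat n n" "V \<in> carrier_mat n n" for U V
    using that P by (simp add: to_fract_mat_mult[of _ n n _ n] mult_carrier_mat[of _ n n])
  have entry: "ls ! (n - 1 - r) = int (b r)" if Q: "Q ls" and r: "r < n" for ls r
  proof -
    from Q obtain U' V' where UV': "U' \<in> GL n" "V' \<in> GL n"
      and "map_mat to_fract U' * map_mat to_fract P * map_mat to_fract V' = mat_diag n (\<lambda>i. ?q powi (ls ! i))"
      unfolding Q_def by blast
    then have eq: "map_mat to_fract (U' * P * V') = mat_diag n (\<lambda>i. ?q powi (ls ! i))"
      by (simp add: mapUV)
    have D: "U' * P * V' \<in> carrier_mat n n" using UV' P by (simp add: mult_carrier_mat[of _ n n])
    have e: "to_fract ((U' * P * V') $$ (r, c)) = (if r = c then ?q powi (ls ! c) else 0)" if "r < n"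
        "c < n" for r c
    proof -
      have "to_fract ((U' * P * V') $$ (r, c)) = map_mat to_fract (U' * P * V') $$ (r, c)"
        using that carrier_matD[OF D] by (intro index_map_mat(1)[symmetric]) (simp_all only:)
      also have "\<dots> = mat_diag n (\<lambda>i. ?q powi (ls ! i)) $$ (r, c)" by (simp only: eq)
      finally show ?thesis using that by (simp add: mat_diag_def)
    qed
    have pos: "(U' * P * V') $$ (r, r) = \<pi> ^ nat (ls ! r) \<and> ls ! r \<ge> 0" if "r < n" for r
    proof (cases "ls ! r \<ge> 0")
      case True
      then have "to_fract ((U' * P * V') $$ (r, r)) = ?q ^ nat (ls ! r)"
        using e[OF that that] by (simp add: power_int_def)
      also have "\<dots> = to_fract (\<pi> ^ nat (ls ! r))" by (simp only: to_fract_power q)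
      finally show ?thesis using True by (simp only: to_fract_eq_iff)
    next
      case False
      define k where "k = nat (- ls ! r)"
      have k: "k > 0" using False by (simp add: k_def)
      have "to_fract ((U' * P * V') $$ (r, r)) = inverse (?q ^ k)"
        using e[OF that that] False by (simp add: power_int_def k_def power_inverse)
      then have "to_fract ((U' * P * V') $$ (r, r)) * ?q ^ k = 1" using q0 by simp
      then have "to_fract ((U' * P * V') $$ (r, r) * \<pi> ^ k) = to_fract 1"
        by (simp only: to_fract_mult to_fract_power q to_fract_1)
      then have "(U' * P * V') $$ (r, r) * \<pi> ^ k = 1" by (simp only: to_fract_eq_iff)
      then have "\<pi> ^ k dvd (1 :: 'p padic_int)" by (metis dvd_triv_right)
      then have "\<pi> dvd (1 :: 'p padic_int)" using k dvd_power dvd_trans by blast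
      then show ?thesis using pi_not_dvd_1 by blast
    qed
    define b' where "b' r = nat (ls ! (n - 1 - r))" for r
    have fl: "flip_mat n * (U' * P * V') * flip_mat n = pi_diag n b'"
    proof (rule eq_matI)
      fix r c assume "r < dim_row (pi_diag n b' :: 'p padic_int mat)"
          "c < dim_col (pi_diag n b' :: 'p padic_int mat)"
      then have rc: "r < n" "c < n" by (auto simp: pi_diag_def)
      have "(flip_mat n * (U' * P * V') * flip_mat n) $$ (r, c) = (U' * P * V') $$ (n - 1 - r, n - 1 - c)"
        using rc D by (subst mult_flip_mat_entry) (auto simp: flip_mat_mult_entry mult_carrier_mat[of _ n n])
      also have "\<dots> = pi_diag n b' $$ (r, c)"
      proof (cases "r = c")
        case True
        then show ?thesis using rc pos[of "n - 1 - r"] by (simp add: pi_diag_def b'_def)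
      next
        case False
        then have "to_fract ((U' * P * V') $$ (n - 1 - r, n - 1 - c)) = 0"
          using rc by (subst e) auto
        then show ?thesis using False rc by (simp add: pi_diag_def)
      qed
      finally show "(flip_mat n * (U' * P * V') * flip_mat n) $$ (r, c) = pi_diag n b' $$ (r, c)" .
    qed (auto simp: flip_mat_def pi_diag_def)
    have "flip_mat n * (U' * P * V') * flip_mat n = (flip_mat n * U') * P * (V' * flip_mat n)"
      using UV' P by (simp add: assoc_mult_mat[of _ n n _ n _ n] mult_carrier_mat[of _ n n])
    then have fl': "(flip_mat n * U') * P * (V' * flip_mat n) = pi_diag n b'" using fl by simp
    have b': "b' r \<le> b' s" if "r \<le> s" "s < n" for r s
    proof -
      have "ls ! (n - 1 - s) \<ge> ls ! (n - 1 - r)" if "r < s"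
        using Q \<open>r < s\<close> \<open>s < n\<close> unfolding Q_def by (auto simp: sorted_wrt_iff_nth_less)
      then show ?thesis using that by (cases "r = s") (auto simp: b'_def)
    qed
    have "b r = b' r"
      by (rule smith_unique[OF P UV GL_mult[OF flip_mat_GL UV'(1)] GL_mult[OF UV'(2) flip_mat_GL] fl' b b' r])
    then show ?thesis using pos[of "n - 1 - r"] r by (simp add: b'_def)
  qed
  define ls where "ls = map (\<lambda>r. int (b (n - 1 - r))) [0..<n]"
  have "Q ls"
  proof -
    have g: "flip_mat n * U \<in> GL n" "V * flip_mat n \<in> GL n" using UV by (auto intro: GL_mult flip_mat_GL)
    have len: "length ls = n" by (simp add: ls_def)
    have sor: "sorted_wrt (\<ge>) ls" unfolding sorted_wrt_iff_nth_less by (auto simp: ls_def intro!: b)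
    have "(flip_mat n * U) * P * (V * flip_mat n) = flip_mat n * (U * P * V) * flip_mat n"
      using UV(1,2) P by (simp add: assoc_mult_mat[of _ n n _ n _ n] mult_carrier_mat[of _ n n])
    also have "\<dots> = flip_mat n * pi_diag n b * flip_mat n" by (simp only: UV(3))
    finally have e: "(flip_mat n * U) * P * (V * flip_mat n) = flip_mat n * pi_diag n b * flip_mat n" .
    have "map_mat to_fract (flip_mat n * pi_diag n b * flip_mat n) = mat_diag n (\<lambda>i. ?q powi (ls ! i))"
    proof (rule eq_matI)
      fix r c assume "r < dim_row (mat_diag n (\<lambda>i. ?q powi (ls ! i)))"
          "c < dim_col (mat_diag n (\<lambda>i. ?q powi (ls ! i)))"
      then have rc: "r < n" "c < n" by (auto simp: mat_diag_def)
      have "(flip_mat n * pi_diag n b * flip_mat n) $$ (r, c)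
          = (pi_diag n b $$ (n - 1 - r, n - 1 - c) :: 'p padic_int)"
        using rc by (subst mult_flip_mat_entry) (auto simp: flip_mat_mult_entry mult_carrier_mat[of _ n n])
      then show "map_mat to_fract (flip_mat n * pi_diag n b * flip_mat n) $$ (r, c)
          = mat_diag n (\<lambda>i. ?q powi (ls ! i)) $$ (r, c)"
        using rc q by (auto simp: pi_diag_def mat_diag_def ls_def flip_mat_def to_fract_power)
    qed (auto simp: flip_mat_def mat_diag_def)
    then have "map_mat to_fract (flip_mat n * U) * map_mat to_fract P * map_mat to_fract (V * flip_mat n)
        = mat_diag n (\<lambda>i. ?q powi (ls ! i))"
      using e g by (subst mapUV) simp_all
    then show ?thesis unfolding Q_def using g len sor by blast
  qed
  moreover have "SN (map_mat to_fract P) = (THE ls. Q ls)"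
    using P by (simp add: SN_def Q_def[abs_def])
  moreover have "ls' = ls" if "Q ls'" for ls'
  proof (rule nth_equalityI)
    show "length ls' = length ls" using that \<open>Q ls\<close> by (simp add: Q_def)
    fix k assume "k < length ls'"
    then have "k < n" using that by (simp add: Q_def)
    then show "ls' ! k = ls ! k" using entry[OF that, of "n - 1 - k"] entry[OF \<open>Q ls\<close>, of "n - 1 - k"] by simp
  qed
  ultimately have "SN (map_mat to_fract P) = ls" by (metis theI_unique the_equality)
  then show ?thesis using entry[OF \<open>Q ls\<close> i] by simp
qed

section \<open>The depth of a column\<close>

text \<open>Column \<open>i\<close> of \<open>X\<close> lies in the saturated span of the columns before it, up to multiples of \<open>p\<^sup>m\<close>:
  \<open>p\<^sup>e\<close> clears the denominators of the coefficients, which may be taken from the integers by density.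
  In a frame in which \<open>X\<close> is upper triangular, with nonzero diagonal entries before place \<open>i\<close>, the
  condition says that \<open>p\<^sup>m\<close> divides the \<open>i\<close>-th diagonal entry. The description chosen here refers to no frame and has countable quantifiers
  only, so that it defines a measurable set of matrices.\<close>

definition depth_ge :: "nat \<Rightarrow> nat \<Rightarrow> nat \<Rightarrow> 'p::prime_card padic_int mat \<Rightarrow> bool" where
  "depth_ge n i m X \<longleftrightarrow> (\<exists>e. \<exists>c::int list. \<forall>r<n.
     \<pi> ^ (m + e) dvd \<pi> ^ e * X $$ (r, i) - (\<Sum>l<i. of_int (c ! l) * X $$ (r, l)))"

text \<open>For a matrix in triangular form: the first \<open>i\<close> diagonal entries do not vanish.\<close>

definition regular_below :: "nat \<Rightarrow> nat \<Rightarrow> 'p::prime_card padic_int mat \<Rightarrow> bool" where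
  "regular_below n i X \<longleftrightarrow> (\<forall>l<i. \<exists>m. \<not> depth_ge n l m X)"

text \<open>For a matrix in triangular form whose diagonal entries up to place \<open>i\<close> do not vanish: the valuation of
  the \<open>i\<close>-th diagonal entry.\<close>

definition depth :: "nat \<Rightarrow> nat \<Rightarrow> 'p::prime_card padic_int mat \<Rightarrow> nat" where
  "depth n i X = (LEAST m. \<not> depth_ge n i (Suc m) X)"

lemma depth_ge_0: "depth_ge n i 0 X"
  unfolding depth_ge_def by (rule exI[of _ 0]) simp

lemma depth_ge_Suc_imp: "depth_ge n i (Suc m) (X :: 'a::prime_card padic_int mat) \<Longrightarrow> depth_ge n i m X"
proof -
  assume "depth_ge n i (Suc m) X"
  then obtain e and c :: "int list" where c: "\<forall>r<n. \<pi> ^ (Suc m + e) dvd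
      \<pi> ^ e * X $$ (r, i) - (\<Sum>l<i. of_int (c ! l) * X $$ (r, l))"
    unfolding depth_ge_def by (elim exE)
  have "(\<pi> :: 'a padic_int) ^ (m + e) dvd \<pi> ^ (Suc m + e)" by (rule le_imp_power_dvd) simp
  then have "\<forall>r<n. \<pi> ^ (m + e) dvd \<pi> ^ e * X $$ (r, i) - (\<Sum>l<i. of_int (c ! l) * X $$ (r, l))"
    using c dvd_trans by (intro allI impI) (erule dvd_trans, simp)
  then show "depth_ge n i m X" unfolding depth_ge_def by (intro exI)
qed

lemma depth_ge_mono: "depth_ge n i m X \<Longrightarrow> k \<le> m \<Longrightarrow> depth_ge n i k X"
  by (induction m) (auto simp: le_Suc_eq dest: depth_ge_Suc_imp)

text \<open>Each pivot is inverted up to a power of \<open>p\<close>; the powers accumulate in \<open>e\<close>.\<close>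

lemma back_substitution:
  fixes T :: "nat \<Rightarrow> nat \<Rightarrow> 'p::prime_card padic_int"
  assumes "\<And>r l. l < r \<Longrightarrow> r < k \<Longrightarrow> T r l = 0" "\<And>l. l < k \<Longrightarrow> T l l \<noteq> 0"
  shows "\<exists>e c. \<forall>r<k. \<pi> ^ e * y r = (\<Sum>l<k. c l * T r l)"
  using assms
proof (induction k arbitrary: y)
  case (Suc k)
  obtain a u where au: "T k k = \<pi> ^ a * u" "u dvd 1" using Suc.prems(2)[of k] padic_decompose[of "T k k"]
      by auto
  from au(2) obtain w where "1 = u * w" by (rule dvdE)
  then have w: "u * w = 1" by (rule sym)
  define y' where "y' r = \<pi> ^ a * y r - (w * y k) * T r k" for r
  have "\<exists>e c. \<forall>r<k. \<pi> ^ e * y' r = (\<Sum>l<k. c l * T r l)"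
    by (rule Suc.IH) (use Suc.prems in auto)
  then obtain e c where ec: "\<And>r. r < k \<Longrightarrow> \<pi> ^ e * y' r = (\<Sum>l<k. c l * T r l)" by blast
  define c' where "c' = c(k := \<pi> ^ e * (w * y k))"
  have s: "(\<Sum>l<Suc k. c' l * T r l) = (\<Sum>l<k. c l * T r l) + \<pi> ^ e * (w * y k) * T r k" for r
    by (simp add: c'_def)
  have "\<pi> ^ (e + a) * y r = (\<Sum>l<Suc k. c' l * T r l)" if "r < Suc k" for r
  proof (cases "r = k")
    case True
    have "(\<Sum>l<k. c l * T k l) = 0" using Suc.prems(1) by (intro sum.neutral) auto
    moreover have "\<pi> ^ e * (w * y k) * T k k = \<pi> ^ e * \<pi> ^ a * y k * (u * w)"
      by (simp only: au(1) mult_ac)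
    ultimately show ?thesis using True w by (simp only: s power_add) simp
  next
    case False
    then have "r < k" using that by simp
    then show ?thesis unfolding s ec[symmetric, OF \<open>r < k\<close>] y'_def power_add
        by (simp only: ring_distribs mult_ac) simp
  qed
  then show ?case by blast
qed auto

text \<open>Left multiplication by \<open>U\<close> preserves linear relations between columns. In the frame \<open>U\<close> the
  first \<open>i\<close> columns have no entries from row \<open>i\<close> on, so a relation forces those entries of
  column \<open>i\<close> to be divisible by \<open>p\<^sup>m\<close>; the entries above can be matched by back substitution.\<close>

lemma depth_ge_iff:
  fixes X :: "'p::prime_card padic_int mat"
  assumes X: "X \<in> carrier_mat n n" and i: "i < n" and U: "U \<in> GL n"
    and tri: "\<And>l r. l < i \<Longrightarrow> l < r \<Longrightarrow> r < n \<Longrightarrow> (U * X) $$ (r, l) = 0"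
    and diag: "\<And>l. l < i \<Longrightarrow> (U * X) $$ (l, l) \<noteq> 0"
  shows "depth_ge n i m X \<longleftrightarrow> (\<forall>r<n. i \<le> r \<longrightarrow> \<pi> ^ m dvd (U * X) $$ (r, i))"
proof -
  \<comment> \<open>The defect of a linear relation. It is equivariant under left multiplication.\<close>
  define comb where "comb Y e c r = \<pi> ^ e * Y $$ (r, i) - (\<Sum>l<i. c l * Y $$ (r, l))"
    for Y :: "'p padic_int mat" and e and c :: "nat \<Rightarrow> 'p padic_int" and r
  have comb: "comb (V * Y) e c r = (\<Sum>s<n. V $$ (r, s) * comb Y e c s)"
    if V: "V \<in> carrier_mat n n" and Y: "Y \<in> carrier_mat n n" and r: "r < n" for V Y e c r
  proof -
    have "(\<Sum>l<i. c l * (V * Y) $$ (r, l)) = (\<Sum>l<i. \<Sum>s<n. V $$ (r, s) * (c l * Y $$ (s, l)))"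
    proof (rule sum.cong)
      fix l assume "l \<in> {..<i}"
      then have "(V * Y) $$ (r, l) = (\<Sum>s<n. V $$ (r, s) * Y $$ (s, l))"
        using V Y r i by (intro mult_entry[of _ n n _ n]) auto
      then show "c l * (V * Y) $$ (r, l) = (\<Sum>s<n. V $$ (r, s) * (c l * Y $$ (s, l)))"
        by (simp add: sum_distrib_left mult_ac)
    qed simp
    also have "\<dots> = (\<Sum>s<n. \<Sum>l<i. V $$ (r, s) * (c l * Y $$ (s, l)))" by (rule sum.swap)
    finally have 1: "(\<Sum>l<i. c l * (V * Y) $$ (r, l)) = (\<Sum>s<n. V $$ (r, s) * (\<Sum>l<i. c l * Y $$ (s, l)))"
      by (simp add: sum_distrib_left)
    have "(V * Y) $$ (r, i) = (\<Sum>s<n. V $$ (r, s) * Y $$ (s, i))"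
      using V Y r i by (intro mult_entry[of _ n n _ n]) auto
    then have 2: "\<pi> ^ e * (V * Y) $$ (r, i) = (\<Sum>s<n. V $$ (r, s) * (\<pi> ^ e * Y $$ (s, i)))"
      by (simp add: sum_distrib_left mult_ac)
    show ?thesis unfolding comb_def 1 2 by (simp add: sum_subtractf right_diff_distrib)
  qed
  obtain U' where U': "U' \<in> GL n" "U' * U = 1\<^sub>m n" using GL_obtain_inverse[OF U] by metis
  have c: "U \<in> carrier_mat n n" "U' \<in> carrier_mat n n" "U * X \<in> carrier_mat n n" using U U' X by auto
  have X': "X = U' * (U * X)"
    using U'(2) X c assoc_mult_mat[OF c(2,1) X] by simp
  have low: "comb (U * X) e d r = \<pi> ^ e * (U * X) $$ (r, i)" if "i \<le> r" "r < n" for e d r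
    unfolding comb_def using that tri by (simp add: sum.neutral)
  show ?thesis
  proof
    assume "depth_ge n i m X"
    then obtain e and d :: "int list" where d: "\<And>r. r < n \<Longrightarrow> \<pi> ^ (m + e) dvd comb X e (\<lambda>l. of_int (d ! l)) r"
      unfolding depth_ge_def comb_def by blast
    show "\<forall>r<n. i \<le> r \<longrightarrow> \<pi> ^ m dvd (U * X) $$ (r, i)"
    proof (intro allI impI)
      fix r assume r: "r < n" "i \<le> r"
      have "\<pi> ^ (m + e) dvd comb (U * X) e (\<lambda>l. of_int (d ! l)) r"
        unfolding comb[OF c(1) X r(1)] by (intro dvd_sum dvd_mult d) auto
      then show "\<pi> ^ m dvd (U * X) $$ (r, i)"
        unfolding low[OF r(2,1)] pi_power_mult_dvd_cancel .
    qed
  next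
    assume dv: "\<forall>r<n. i \<le> r \<longrightarrow> \<pi> ^ m dvd (U * X) $$ (r, i)"
    have "\<exists>e d. \<forall>r<i. \<pi> ^ e * (U * X) $$ (r, i) = (\<Sum>l<i. d l * (U * X) $$ (r, l))"
      by (rule back_substitution) (use tri diag i in auto)
    then obtain e d where ed: "\<And>r. r < i \<Longrightarrow> \<pi> ^ e * (U * X) $$ (r, i) = (\<Sum>l<i. d l * (U * X) $$ (r, l))" by blast
    have "\<pi> ^ (m + e) dvd comb (U * X) e d r" if "r < n" for r
    proof (cases "r < i")
      case True
      then show ?thesis using ed by (simp add: comb_def)
    next
      case False
      then have r: "i \<le> r" and "\<pi> ^ m dvd (U * X) $$ (r, i)" using dv that by auto
      then show ?thesis unfolding low[OF r that] by (simp only: pi_power_mult_dvd_cancel)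
    qed
    then have dX: "\<pi> ^ (m + e) dvd comb X e d r" if "r < n" for r
      by (subst X', subst comb[OF c(2,3) that]) (intro dvd_sum dvd_mult, simp)
    have "\<forall>l. \<exists>z. \<pi> ^ (m + e) dvd d l - of_int z" by (intro allI padic_approx_int)
    then obtain z :: "nat \<Rightarrow> int" where z: "\<And>l. \<pi> ^ (m + e) dvd d l - of_int (z l)"
      unfolding choice_iff by blast
    define f where "f = map z [0..<i]"
    have "\<pi> ^ (m + e) dvd \<pi> ^ e * X $$ (r, i) - (\<Sum>l<i. of_int (f ! l) * X $$ (r, l))" if "r < n" for r
    proof -
      have "\<pi> ^ e * X $$ (r, i) - (\<Sum>l<i. of_int (f ! l) * X $$ (r, l))
          = comb X e d r + (\<Sum>l<i. (d l - of_int (z l)) * X $$ (r, l))"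
        by (simp add: comb_def f_def sum_subtractf left_diff_distrib)
      then show ?thesis using dX[OF that] z by (auto intro!: dvd_add dvd_sum dvd_mult2)
    qed
    then show "depth_ge n i m X" unfolding depth_ge_def by blast
  qed
qed

lemma regular_imp_diag_nonzero:
  fixes X :: "'p::prime_card padic_int mat"
  assumes X: "X \<in> carrier_mat n n" and i: "i \<le> n" and U: "U \<in> GL n"
    and tri: "\<And>l r. l < i \<Longrightarrow> l < r \<Longrightarrow> r < n \<Longrightarrow> (U * X) $$ (r, l) = 0"
    and reg: "regular_below n i X"
    and l: "l < i"
  shows "(U * X) $$ (l, l) \<noteq> 0"
  using l
proof (induction l rule: less_induct)
  case (less l)
  from reg less.prems obtain m where m: "\<not> depth_ge n l m X" unfolding regular_below_def by blast
  have "depth_ge n l m X \<longleftrightarrow> (\<forall>r<n. l \<le> r \<longrightarrow> \<pi> ^ m dvd (U * X) $$ (r, l))"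
    by (rule depth_ge_iff[OF X _ U]) (use less tri i in auto)
  with m obtain r where "r < n" "l \<le> r" "\<not> \<pi> ^ m dvd (U * X) $$ (r, l)" by blast
  then show ?case using tri[of l r] less.prems by (cases "r = l") auto
qed

lemma depth_eq:
  fixes X :: "'p::prime_card padic_int mat"
  assumes X: "X \<in> carrier_mat n n" and i: "i < n" and U: "U \<in> GL n"
    and tri: "\<And>l r. l \<le> i \<Longrightarrow> l < r \<Longrightarrow> r < n \<Longrightarrow> (U * X) $$ (r, l) = 0"
    and diag: "\<And>l. l < i \<Longrightarrow> (U * X) $$ (l, l) \<noteq> 0"
    and v: "(U * X) $$ (i, i) = \<pi> ^ v * u" "u dvd 1"
  shows "depth_ge n i m X \<longleftrightarrow> m \<le> v" "depth n i X = v"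
proof -
  have *: "depth_ge n i m X \<longleftrightarrow> m \<le> v" for m
  proof -
    have "depth_ge n i m X \<longleftrightarrow> (\<forall>r<n. i \<le> r \<longrightarrow> \<pi> ^ m dvd (U * X) $$ (r, i))"
      by (rule depth_ge_iff[OF X i U]) (use tri diag in auto)
    also have "\<dots> \<longleftrightarrow> \<pi> ^ m dvd (U * X) $$ (i, i)"
    proof (intro iffI allI impI)
      fix r assume "\<pi> ^ m dvd (U * X) $$ (i, i)" "r < n" "i \<le> r"
      then show "\<pi> ^ m dvd (U * X) $$ (r, i)" using tri[of i r] by (cases "r = i") auto
    qed (use i in auto)
    also have "\<dots> \<longleftrightarrow> m \<le> v"
      unfolding v(1) using pi_power_dvd_le[OF _ v(2)] by (auto intro: dvd_mult2 le_imp_power_dvd)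
    finally show ?thesis .
  qed
  then show "depth_ge n i m X \<longleftrightarrow> m \<le> v" .
  show "depth n i X = v" unfolding depth_def * by (rule Least_equality) auto
qed

lemma regular_diag_unit:
  fixes X :: "'p::prime_card padic_int mat"
  assumes X: "X \<in> carrier_mat n n" and U: "U \<in> GL n"
    and tri: "\<And>l r. l < r \<Longrightarrow> r < n \<Longrightarrow> (U * X) $$ (r, l) = 0"
    and reg: "regular_below n n X"
    and i: "i < n"
  obtains u where "(U * X) $$ (i, i) = \<pi> ^ depth n i X * u" "u dvd 1"
proof -
  have nz: "(U * X) $$ (l, l) \<noteq> 0" if "l < n" for l
    by (rule regular_imp_diag_nonzero[OF X order_refl U _ reg that]) (use tri in auto)
  then obtain v u where vu: "(U * X) $$ (i, i) = \<pi> ^ v * u" "u dvd 1" using padic_decompose i by blast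
  have "depth n i X = v" by (rule depth_eq(2)[OF X i U _ _ vu]) (use tri nz i in auto)
  then show thesis using that vu by simp
qed

lemma mat_lprod_carrier:
  assumes "\<And>k. A k \<in> carrier_mat n n"
  shows "mat_lprod n A k \<in> carrier_mat n n"
  by (induction k) (auto intro!: mult_carrier_mat[of _ n n] assms)

text \<open>The frames \<open>U k\<close> turn the product into a product of upper triangular matrices: if \<open>U k\<close> is given,
  then \<open>U (Suc k)\<close> is chosen so as to triangularize \<open>A (Suc k)\<close> times the inverse of \<open>U k\<close>.\<close>

lemma triangular_frames:
  fixes A :: "nat \<Rightarrow> 'p::prime_card padic_int mat"
  assumes A: "\<And>k. A k \<in> carrier_mat n n"
  shows "\<exists>U R. (\<forall>k. U k \<in> GL n) \<and> (\<forall>k. R k \<in> carrier_mat n n) \<and>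
    (\<forall>k l r. l < r \<longrightarrow> r < n \<longrightarrow> R k $$ (r, l) = 0) \<and> U 0 = 1\<^sub>m n \<and>
    (\<forall>k. U (Suc k) * mat_lprod n A (Suc k) = R k * (U k * mat_lprod n A k))"
proof -
  have *: "\<exists>W\<in>GL n. \<exists>R\<in>carrier_mat n n. (\<forall>l<n. \<forall>r<n. l < r \<longrightarrow> R $$ (r, l) = 0) \<and> W * A (Suc k) = R * V"
    if V: "V \<in> GL n" for k V
  proof -
    obtain V' where V': "V' \<in> GL n" "V' * V = 1\<^sub>m n" using GL_obtain_inverse[OF V] by metis
    obtain W where W: "W \<in> GL n" "\<forall>l<n. \<forall>r<n. l < r \<longrightarrow> (W * (A (Suc k) * V')) $$ (r, l) = 0"
      using triangularize[of "A (Suc k) * V'" n] A[of "Suc k"] V' by auto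
    have c: "V \<in> carrier_mat n n" "V' \<in> carrier_mat n n" "W \<in> carrier_mat n n" using V V' W by auto
    have "W * (A (Suc k) * V') * V = W * (A (Suc k) * (V' * V))"
      using c A[of "Suc k"] by (simp add: assoc_mult_mat[of _ n n _ n _ n] mult_carrier_mat[of _ n n])
    also have "\<dots> = W * A (Suc k)" using A[of "Suc k"] V'(2) by simp
    finally show ?thesis using W c A[of "Suc k"]
      by (intro bexI[OF _ W(1)] bexI[of _ "W * (A (Suc k) * V')"]) (auto simp: mult_carrier_mat[of _ n n])
  qed
  have ex: "\<exists>WR. fst WR \<in> GL n \<and> snd WR \<in> carrier_mat n n \<and>
      (\<forall>l<n. \<forall>r<n. l < r \<longrightarrow> snd WR $$ (r, l) = 0) \<and> fst WR * A (Suc k) = snd WR * V"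
    if V: "V \<in> GL n" for k V
  proof -
    from *[OF V, of k] obtain W R where "W \<in> GL n" "R \<in> carrier_mat n n"
      "(\<forall>l<n. \<forall>r<n. l < r \<longrightarrow> R $$ (r, l) = 0) \<and> W * A (Suc k) = R * V"
      by (elim bexE)
    then show ?thesis by (intro exI[of _ "(W, R)"]) simp
  qed
  define g where "g k V = (SOME WR. fst WR \<in> GL n \<and> snd WR \<in> carrier_mat n n \<and>
      (\<forall>l<n. \<forall>r<n. l < r \<longrightarrow> snd WR $$ (r, l) = 0) \<and> fst WR * A (Suc k) = snd WR * V)" for k V
  define w where "w k V = fst (g k V)" for k V
  define f where "f k V = snd (g k V)" for k V
  have wf: "w k V \<in> GL n" "f k V \<in> carrier_mat n n"
    "\<And>l r. l < n \<Longrightarrow> r < n \<Longrightarrow> l < r \<Longrightarrow> f k V $$ (r, l) = 0"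
    "w k V * A (Suc k) = f k V * V" if "V \<in> GL n" for k V
    using someI_ex[OF ex[OF that, of k]] unfolding w_def f_def g_def by auto
  define U where "U = rec_nat (1\<^sub>m n) w"
  have U0: "U 0 = 1\<^sub>m n" and US: "U (Suc k) = w k (U k)" for k by (simp_all add: U_def)
  have U: "U k \<in> GL n" for k by (induction k) (auto simp: U0 US wf)
  have P: "mat_lprod n A k \<in> carrier_mat n n" for k by (rule mat_lprod_carrier[OF A])
  have "U (Suc k) * mat_lprod n A (Suc k) = f k (U k) * (U k * mat_lprod n A k)" for k
  proof -
    have "U (Suc k) * mat_lprod n A (Suc k) = w k (U k) * A (Suc k) * mat_lprod n A k"
      using U[of "Suc k"] A[of "Suc k"] P[of k] by (simp add: US assoc_mult_mat[of _ n n _ n _ n])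
    also have "\<dots> = f k (U k) * U k * mat_lprod n A k" by (simp only: wf(4)[OF U])
    also have "\<dots> = f k (U k) * (U k * mat_lprod n A k)"
      using wf(2)[OF U[of k], of k] U[of k] P[of k] by (intro assoc_mult_mat[of _ n n _ n _ n]) auto
    finally show ?thesis .
  qed
  then show ?thesis using U wf U0
    by (intro exI[of _ U] exI[of _ "\<lambda>k. f k (U k)"] conjI allI impI) auto
qed

section \<open>A strong law for variables with geometric tails\<close>

lemma growth_bounds:
  fixes f g :: "nat \<Rightarrow> real"
  assumes "(\<lambda>k. f k / g k) \<longlonglongrightarrow> l" "\<epsilon> > 0" "\<And>k. 0 < k \<Longrightarrow> 0 < g k" "\<And>k. 0 \<le> g k"
  obtains C where "C \<ge> 0" "\<And>k. \<bar>f k - l * g k\<bar> \<le> \<epsilon> * g k + C"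
proof -
  from assms obtain K where K: "\<And>k. k \<ge> K \<Longrightarrow> \<bar>f k / g k - l\<bar> < \<epsilon>"
    unfolding LIMSEQ_iff by (metis real_norm_def)
  define C where "C = (\<Sum>k\<le>K. \<bar>f k - l * g k\<bar>)"
  have "\<bar>f k - l * g k\<bar> \<le> \<epsilon> * g k + C" for k
  proof (cases "k \<le> K")
    case True
    then have "\<bar>f k - l * g k\<bar> \<le> C" unfolding C_def by (intro member_le_sum) auto
    moreover have "0 \<le> \<epsilon> * g k" using assms by simp
    ultimately show ?thesis by linarith
  next
    case False
    then have k: "k \<ge> K" "g k > 0" using assms(3) by auto
    have "\<bar>f k - l * g k\<bar> = \<bar>f k / g k - l\<bar> * g k"
      using k(2) by (simp add: abs_mult[symmetric] field_simps)
    also have "\<dots> \<le> \<epsilon> * g k" using K[OF k(1)] k(2) by (intro mult_right_mono) auto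
    also have "\<dots> \<le> \<epsilon> * g k + C" by (simp add: C_def sum_nonneg)
    finally show ?thesis .
  qed
  moreover have "C \<ge> 0" by (simp add: C_def sum_nonneg)
  ultimately show thesis using that by blast
qed

lemma linear_growth_limit:
  fixes f :: "nat \<Rightarrow> real"
  assumes "\<And>\<epsilon>. \<epsilon> > 0 \<Longrightarrow> \<exists>C. \<forall>k. \<bar>f k - l * real k\<bar> \<le> \<epsilon> * real k + C"
  shows "(\<lambda>k. f k / real k) \<longlonglongrightarrow> l"
  unfolding LIMSEQ_iff
proof (intro allI impI)
  fix \<epsilon> :: real assume e: "\<epsilon> > 0"
  obtain C where C: "\<And>k. \<bar>f k - l * real k\<bar> \<le> (\<epsilon> / 2) * real k + C" using assms[of "\<epsilon>/2"] e by auto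
  obtain K where K: "real K > 2 * \<bar>C\<bar> / \<epsilon>" using reals_Archimedean2 by blast
  have "\<bar>f k / real k - l\<bar> < \<epsilon>" if k: "k \<ge> Suc K" for k
  proof -
    have k0: "real k > 0" using k by simp
    have "2 * \<bar>C\<bar> / \<epsilon> < real k" using K k by linarith
    then have "\<bar>C\<bar> < (\<epsilon> / 2) * real k" using e by (simp add: field_simps)
    then have "\<bar>f k - l * real k\<bar> < \<epsilon> * real k" using C[of k] by linarith
    moreover have "\<bar>f k / real k - l\<bar> = \<bar>f k - l * real k\<bar> / real k"
    proof -
      have "f k / real k - l = (f k - l * real k) / real k" using k0 by (simp add: field_simps)
      then show ?thesis using k0 by (simp add: abs_divide)
    qed
    ultimately show ?thesis using k0 by (simp add: field_simps)
  qed
  then show "\<exists>no. \<forall>n\<ge>no. norm (f n / real n - l) < \<epsilon>" by auto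
qed

text \<open>Between consecutive squares both sequences are monotone, and \<open>e\<close> grows by \<open>O(m)\<close>, which is
  negligible against \<open>m\<^sup>2\<close>.\<close>

lemma square_subsequence_limit:
  fixes s e :: "nat \<Rightarrow> real"
  assumes s: "\<And>j k. j \<le> k \<Longrightarrow> s j \<le> s k" and e: "\<And>j k. j \<le> k \<Longrightarrow> e j \<le> e k"
    and B: "\<And>j k. j \<le> k \<Longrightarrow> e k - e j \<le> B * (real k - real j)" "B \<ge> 0"
    and lim: "(\<lambda>m. (s (m\<^sup>2) - e (m\<^sup>2)) / real (m\<^sup>2)) \<longlonglongrightarrow> 0"
  shows "(\<lambda>k. (s k - e k) / real k) \<longlonglongrightarrow> 0"
proof (rule linear_growth_limit)
  fix \<epsilon> :: real assume "\<epsilon> > 0"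
  define \<delta> where "\<delta> = \<epsilon> / 4"
  have \<delta>: "\<delta> > 0" and \<epsilon>: "\<epsilon> = 4 * \<delta>" using \<open>\<epsilon> > 0\<close> by (simp_all add: \<delta>_def)
  obtain C where C: "C \<ge> 0" "\<And>m. \<bar>s (m\<^sup>2) - e (m\<^sup>2) - 0 * real (m\<^sup>2)\<bar> \<le> \<delta> * real (m\<^sup>2) + C"
    by (rule growth_bounds[OF lim \<delta>]) auto
  show "\<exists>C. \<forall>k. \<bar>s k - e k - 0 * real k\<bar> \<le> \<epsilon> * real k + C"
  proof (intro exI[of _ "2 * C + 2 * \<delta> + B\<^sup>2 / \<delta> + B"] allI)
    fix k
    define m where "m = nat \<lfloor>sqrt (real k)\<rfloor>"
    have m1: "real m \<le> sqrt (real k)" and m2: "sqrt (real k) < real m + 1" unfolding m_def by auto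
    have "(real m)\<^sup>2 \<le> real k" using power_mono[OF m1, of 2] by simp
    then have mk: "real (m\<^sup>2) \<le> real k" "m\<^sup>2 \<le> k" by (simp_all flip: of_nat_power)
    have "real k < (real m + 1)\<^sup>2" using power_strict_mono[OF m2, of 2] by simp
    then have "real k < real ((Suc m)\<^sup>2)" by (simp add: add.commute)
    then have km: "k \<le> (Suc m)\<^sup>2" by (simp flip: of_nat_power)
    let ?D = "\<lambda>m. s (m\<^sup>2) - e (m\<^sup>2)"
    have diff: "e ((Suc m)\<^sup>2) - e (m\<^sup>2) \<le> B * (2 * real m + 1)"
      using B(1)[of "m\<^sup>2" "(Suc m)\<^sup>2"] by (simp add: power2_eq_square algebra_simps)
    have up: "s k - e k \<le> ?D (Suc m) + B * (2 * real m + 1)" using s[OF km] e[OF mk(2)] diff by linarith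
    have low: "s k - e k \<ge> ?D m - B * (2 * real m + 1)" using s[OF mk(2)] e[OF km] diff by linarith
    have c1: "\<bar>?D m\<bar> \<le> \<delta> * real (m\<^sup>2) + C" using C(2)[of m] by simp
    have c2: "\<bar>?D (Suc m)\<bar> \<le> \<delta> * real ((Suc m)\<^sup>2) + C" using C(2)[of "Suc m"] by simp
    have "real ((Suc m)\<^sup>2) \<le> 2 * real (m\<^sup>2) + 2"
      using zero_le_power2[of "real m - 1"] by (simp add: power2_eq_square algebra_simps)
    then have c3: "\<delta> * real ((Suc m)\<^sup>2) \<le> \<delta> * (2 * real (m\<^sup>2) + 2)" using \<delta> by (intro mult_left_mono) auto
    have "0 \<le> (\<delta> * real m - B)\<^sup>2 / \<delta>" using \<delta> by simp
    also have "\<dots> = \<delta> * real (m\<^sup>2) - 2 * (B * real m) + B\<^sup>2 / \<delta>"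
      using \<delta> by (simp add: power2_eq_square field_simps)
    finally have c4: "2 * (B * real m) \<le> \<delta> * real (m\<^sup>2) + B\<^sup>2 / \<delta>" by simp
    have c5: "\<delta> * real (m\<^sup>2) \<le> \<delta> * real k" using mk \<delta> by (intro mult_left_mono) auto
    have c6: "B * (2 * real m + 1) = 2 * (B * real m) + B"
        "\<delta> * (2 * real (m\<^sup>2) + 2) = 2 * (\<delta> * real (m\<^sup>2)) + 2 * \<delta>"
      "\<epsilon> * real k = 4 * (\<delta> * real k)" by (simp_all add: algebra_simps \<epsilon>)
    have c7: "0 \<le> \<delta> * real (m\<^sup>2)" using \<delta> by simp
    have "\<bar>s k - e k\<bar> \<le> 3 * (\<delta> * real (m\<^sup>2)) + (2 * C + 2 * \<delta> + B\<^sup>2 / \<delta> + B) "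
      using up low c1 c2 c3 c4 c6 c7 C(1) \<delta> by linarith
    then show "\<bar>s k - e k - 0 * real k\<bar> \<le> \<epsilon> * real k + (2 * C + 2 * \<delta> + B\<^sup>2 / \<delta> + B)"
      using c5 c6 c7 by linarith
  qed
qed

text \<open>By uncorrelatedness the centred sum of \<open>k\<close> terms has second moment at most \<open>C k\<close>. Along the squares
  the normalized second moments are therefore summable, which gives almost sure convergence there,
  and nonnegativity fills the gaps between the squares.\<close>

lemma (in prob_space) slln_uncorrelated:
  fixes X :: "nat \<Rightarrow> 'a \<Rightarrow> real"
  assumes X: "\<And>j. j \<ge> 1 \<Longrightarrow> X j \<in> borel_measurable M" and nonneg: "\<And>j \<omega>. 0 \<le> X j \<omega>"
    and sq: "\<And>j. j \<ge> 1 \<Longrightarrow> integrable M (\<lambda>\<omega>. (X j \<omega>)\<^sup>2)" "\<And>j. j \<ge> 1 \<Longrightarrow> expectation (\<lambda>\<omega>. (X j \<omega>)\<^sup>2) \<le> C"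
    and uncor: "\<And>j k. 1 \<le> j \<Longrightarrow> j < k \<Longrightarrow> expectation (\<lambda>\<omega>. X j \<omega> * X k \<omega>) = expectation (X j) * expectation (X k)"
  shows "AE \<omega> in M. (\<lambda>k. ((\<Sum>j=1..k. X j \<omega>) - (\<Sum>j=1..k. expectation (X j))) / real k) \<longlonglongrightarrow> 0"
proof -
  have int: "integrable M (X j)" if "j \<ge> 1" for j
    by (rule square_integrable_imp_integrable[OF X sq(1)]) (use that in auto)
  have intp: "integrable M (\<lambda>\<omega>. X j \<omega> * X k \<omega>)" if "j \<ge> 1" "k \<ge> 1" for j k
  proof (rule Bochner_Integration.integrable_bound)
    show "integrable M (\<lambda>\<omega>. (X j \<omega>)\<^sup>2 + (X k \<omega>)\<^sup>2)" using sq(1) that by auto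
    have "\<bar>a * b\<bar> \<le> a\<^sup>2 + b\<^sup>2" for a b :: real
    proof -
      have "2 * (\<bar>a\<bar> * \<bar>b\<bar>) \<le> a\<^sup>2 + b\<^sup>2" using zero_le_power2[of "\<bar>a\<bar> - \<bar>b\<bar>"] by (simp add: power2_diff)
      then show ?thesis using mult_nonneg_nonneg[of "\<bar>a\<bar>" "\<bar>b\<bar>"] unfolding abs_mult by linarith
    qed
    then show "AE \<omega> in M. norm (X j \<omega> * X k \<omega>) \<le> norm ((X j \<omega>)\<^sup>2 + (X k \<omega>)\<^sup>2)" by simp
  qed (use X that in simp)
  define Y where "Y j \<omega> = X j \<omega> - expectation (X j)" for j \<omega>
  have Ym: "Y j \<in> borel_measurable M" if "j \<ge> 1" for j unfolding Y_def using X[OF that] by simp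
  have intY: "integrable M (\<lambda>\<omega>. Y j \<omega> * Y k \<omega>)" if "j \<ge> 1" "k \<ge> 1" for j k
    unfolding Y_def using int intp that by (simp add: algebra_simps)
  have cov: "expectation (\<lambda>\<omega>. Y j \<omega> * Y k \<omega>)
      = expectation (\<lambda>\<omega>. X j \<omega> * X k \<omega>) - expectation (X j) * expectation (X k)"
    if "j \<ge> 1" "k \<ge> 1" for j k
  proof -
    have "(\<lambda>\<omega>. Y j \<omega> * Y k \<omega>) = (\<lambda>\<omega>. X j \<omega> * X k \<omega> - X j \<omega> * expectation (X k) - expectation (X j) * X k \<omega> + expectation (X j) * expectation (X k))"
      by (simp add: Y_def algebra_simps)
    then show ?thesis using int intp that by (simp add: prob_space)
  qed
  have cov0: "expectation (\<lambda>\<omega>. Y j \<omega> * Y k \<omega>) = 0" if "j \<ge> 1" "k \<ge> 1" "j \<noteq> k" for j k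
    using cov[of j k] uncor[of j k] uncor[of k j] that by (cases "j < k") (auto simp: mult.commute)
  have var: "expectation (\<lambda>\<omega>. Y j \<omega> * Y j \<omega>) \<le> C" if "j \<ge> 1" for j
    using cov[OF that that] sq(2)[OF that] zero_le_square[of "expectation (X j)"]
    unfolding power2_eq_square by linarith
  define S where "S k \<omega> = (\<Sum>j=1..k. X j \<omega>) - (\<Sum>j=1..k. expectation (X j))" for k \<omega>
  have SY: "S k \<omega> = (\<Sum>j=1..k. Y j \<omega>)" for k \<omega> by (simp add: S_def Y_def sum_subtractf)
  have Sm: "S k \<in> borel_measurable M" for k unfolding S_def using X
      by (intro borel_measurable_diff borel_measurable_sum) auto
  have Sq: "(S k \<omega>)\<^sup>2 = (\<Sum>i=1..k. \<Sum>j=1..k. Y i \<omega> * Y j \<omega>)" for k \<omega>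
    by (simp add: SY power2_eq_square sum_product)
  have Sint: "integrable M (\<lambda>\<omega>. (S k \<omega>)\<^sup>2)" for k
    unfolding Sq by (intro Bochner_Integration.integrable_sum intY) auto
  have C0: "C \<ge> 0" using sq(2)[of 1] by (rule order_trans[rotated]) auto
  have SE: "expectation (\<lambda>\<omega>. (S k \<omega>)\<^sup>2) \<le> real k * C" for k
  proof -
    have "expectation (\<lambda>\<omega>. (S k \<omega>)\<^sup>2) = (\<Sum>i=1..k. \<Sum>j=1..k. expectation (\<lambda>\<omega>. Y i \<omega> * Y j \<omega>))"
    proof -
      have "expectation (\<lambda>\<omega>. (S k \<omega>)\<^sup>2) = (\<Sum>i=1..k. expectation (\<lambda>\<omega>. \<Sum>j=1..k. Y i \<omega> * Y j \<omega>))"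
        unfolding Sq by (intro Bochner_Integration.integral_sum Bochner_Integration.integrable_sum intY) auto
      also have "\<dots> = (\<Sum>i=1..k. \<Sum>j=1..k. expectation (\<lambda>\<omega>. Y i \<omega> * Y j \<omega>))"
        by (intro sum.cong refl Bochner_Integration.integral_sum intY) auto
      finally show ?thesis .
    qed
    also have "\<dots> = (\<Sum>i=1..k. expectation (\<lambda>\<omega>. Y i \<omega> * Y i \<omega>))"
    proof (rule sum.cong)
      fix i assume i: "i \<in> {1..k}"
      have "(\<Sum>j=1..k. expectation (\<lambda>\<omega>. Y i \<omega> * Y j \<omega>))
          = (\<Sum>j=1..k. if j = i then expectation (\<lambda>\<omega>. Y i \<omega> * Y i \<omega>) else 0)"
        by (rule sum.cong) (use i cov0 in auto)
      then show "(\<Sum>j=1..k. expectation (\<lambda>\<omega>. Y i \<omega> * Y j \<omega>)) = expectation (\<lambda>\<omega>. Y i \<omega> * Y i \<omega>)" using i by simp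
    qed simp
    also have "\<dots> \<le> (\<Sum>i=1..k. C)" using var by (intro sum_mono) auto
    finally show ?thesis by simp
  qed
  \<comment> \<open>\<open>Z m\<close> has mean at most \<open>C / m\<^sup>2\<close>, so that the sum of the \<open>Z m\<close> is almost surely finite.\<close>
  define Z where "Z m \<omega> = (S (m\<^sup>2) \<omega> / real (m\<^sup>2))\<^sup>2" for m \<omega>
  have "(\<integral>\<^sup>+\<omega>. (\<Sum>m. ennreal (Z m \<omega>)) \<partial>M) = (\<Sum>m. \<integral>\<^sup>+\<omega>. ennreal (Z m \<omega>) \<partial>M)"
    unfolding Z_def using Sm by (intro nn_integral_suminf) simp
  also have "\<dots> \<le> (\<Sum>m. ennreal (C * (1 / real m ^ 2)))"
  proof (intro suminf_le summableI)
    fix m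
    have "(\<integral>\<^sup>+\<omega>. ennreal (Z m \<omega>) \<partial>M) = ennreal (expectation (Z m))"
      unfolding Z_def using Sint by (intro nn_integral_eq_integral) (auto simp: power_divide)
    also have "expectation (Z m) = expectation (\<lambda>\<omega>. (S (m\<^sup>2) \<omega>)\<^sup>2) / (real (m\<^sup>2))\<^sup>2"
      unfolding Z_def by (simp add: power_divide)
    also have "\<dots> \<le> (real (m\<^sup>2) * C) / (real (m\<^sup>2))\<^sup>2" by (rule divide_right_mono[OF SE]) simp
    also have "\<dots> = C * (1 / real m ^ 2)" by (cases "m = 0") (simp_all add: power2_eq_square field_simps)
    finally show "(\<integral>\<^sup>+\<omega>. ennreal (Z m \<omega>) \<partial>M) \<le> ennreal (C * (1 / real m ^ 2))" by (simp add: ennreal_leI)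
  qed
  also have "\<dots> = ennreal (\<Sum>m. C * (1 / real m ^ 2))"
  proof (rule suminf_ennreal2)
    have "summable (\<lambda>m. inverse (real m ^ 2))" by (rule inverse_power_summable) simp
    then show "summable (\<lambda>m. C * (1 / real m ^ 2))" by (intro summable_mult) (simp add: inverse_eq_divide)
  qed (use C0 in simp)
  also have "\<dots> < \<infinity>" by simp
  finally have "(\<integral>\<^sup>+\<omega>. (\<Sum>m. ennreal (Z m \<omega>)) \<partial>M) \<noteq> \<infinity>" by simp
  then have "AE \<omega> in M. (\<Sum>m. ennreal (Z m \<omega>)) \<noteq> \<infinity>"
    by (rule nn_integral_PInf_AE[rotated]) (unfold Z_def, use Sm in measurable)
  then show ?thesis
  proof eventually_elim
    case (elim \<omega>)
    have "summable (\<lambda>m. Z m \<omega>)"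
      by (rule summable_suminf_not_top) (use elim in \<open>auto simp: Z_def\<close>)
    then have "(\<lambda>m. Z m \<omega>) \<longlonglongrightarrow> 0" by (rule summable_LIMSEQ_zero)
    then have "(\<lambda>m. sqrt (Z m \<omega>)) \<longlonglongrightarrow> 0" using tendsto_real_sqrt[of "\<lambda>m. Z m \<omega>" 0] by simp
    then have "(\<lambda>m. \<bar>S (m\<^sup>2) \<omega> / real (m\<^sup>2)\<bar>) \<longlonglongrightarrow> 0" by (simp add: Z_def)
    then have lim: "(\<lambda>m. S (m\<^sup>2) \<omega> / real (m\<^sup>2)) \<longlonglongrightarrow> 0" by (rule tendsto_rabs_zero_cancel)
    have EX0: "0 \<le> expectation (X j)" for j using nonneg by simp
    have EXC: "expectation (X j) \<le> C + 1" if "j \<ge> 1" for j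
    proof -
      have "expectation (X j) \<le> expectation (\<lambda>\<omega>. (X j \<omega>)\<^sup>2 + 1)"
      proof (rule integral_mono)
        fix \<omega>
        show "X j \<omega> \<le> (X j \<omega>)\<^sup>2 + 1" using zero_le_power2[of "X j \<omega> - 1/2"]
            by (simp add: power2_eq_square algebra_simps)
      qed (use int sq(1) that in auto)
      then show ?thesis using sq[OF that] by (simp add: prob_space)
    qed
    show ?case
    proof (rule square_subsequence_limit[where B = "C + 1"])
      fix j k :: nat assume jk: "j \<le> k"
      show "(\<Sum>j=1..j. X j \<omega>) \<le> (\<Sum>j=1..k. X j \<omega>)" using jk nonneg by (intro sum_mono2) auto
      show "(\<Sum>j=1..j. expectation (X j)) \<le> (\<Sum>j=1..k. expectation (X j))" using jk EX0 by (intro sum_mono2) auto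
      have "{1..k} = {1..j} \<union> {j+1..k}" using jk by auto
      then have "(\<Sum>j=1..k. expectation (X j)) - (\<Sum>j=1..j. expectation (X j)) = (\<Sum>i=j+1..k. expectation (X i))"
        by (simp add: sum.union_disjoint)
      also have "\<dots> \<le> (\<Sum>i=j+1..k. C + 1)" using EXC by (intro sum_mono) auto
      finally show "(\<Sum>j=1..k. expectation (X j)) - (\<Sum>j=1..j. expectation (X j)) \<le> (C + 1) * (real k - real j)"
        using jk by (simp add: mult.commute)
    qed (use C0 lim in \<open>auto simp: S_def\<close>)
  qed
qed

lemma ennreal_of_nat_layers: "ennreal (real n) = (\<Sum>a. indicator {..<n} a)"
proof -
  have "(\<Sum>a. indicator {..<n} a :: ennreal) = (\<Sum>a\<in>{..<n}. indicator {..<n} a)"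
    by (rule suminf_finite) auto
  then show ?thesis by (simp add: ennreal_of_nat_eq_real_of_nat)
qed

text \<open>A natural number is the number of levels \<open>a \<ge> 1\<close> that it reaches, so mixed moments are sums
  of joint tail probabilities.\<close>

lemma (in prob_space) nn_integral_product_layers:
  fixes X Y :: "'a \<Rightarrow> nat"
  assumes X: "X \<in> measurable M (count_space UNIV)" and Y: "Y \<in> measurable M (count_space UNIV)"
  shows "(\<integral>\<^sup>+\<omega>. ennreal (real (X \<omega>) * real (Y \<omega>)) \<partial>M)
    = (\<Sum>a. \<Sum>b. ennreal (prob {\<omega>\<in>space M. Suc a \<le> X \<omega> \<and> Suc b \<le> Y \<omega>}))"
proof -
  note [measurable] = X Y
  have S: "{\<omega>\<in>space M. Suc a \<le> X \<omega> \<and> Suc b \<le> Y \<omega>} \<in> sets M" for a b by measurable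
  have "ennreal (real (X \<omega>) * real (Y \<omega>)) = (\<Sum>a. \<Sum>b. indicator {\<omega>\<in>space M. Suc a \<le> X \<omega> \<and> Suc b \<le> Y \<omega>} \<omega>)"
    if "\<omega> \<in> space M" for \<omega>
  proof -
    have "ennreal (real (X \<omega>) * real (Y \<omega>)) = ennreal (real (X \<omega>)) * ennreal (real (Y \<omega>))"
      by (rule ennreal_mult) auto
    also have "\<dots> = (\<Sum>a. indicator {..<X \<omega>} a) * ennreal (real (Y \<omega>))" by (simp only: ennreal_of_nat_layers)
    also have "\<dots> = (\<Sum>a. indicator {..<X \<omega>} a * ennreal (real (Y \<omega>)))" by (rule ennreal_suminf_multc[symmetric])
    also have "\<dots> = (\<Sum>a. \<Sum>b. indicator {..<X \<omega>} a * indicator {..<Y \<omega>} b)"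
      unfolding ennreal_of_nat_layers[of "Y \<omega>"] by (simp only: ennreal_suminf_cmult)
    also have "\<dots> = (\<Sum>a. \<Sum>b. indicator {\<omega>\<in>space M. Suc a \<le> X \<omega> \<and> Suc b \<le> Y \<omega>} \<omega>)"
      using that by (intro suminf_cong) (auto simp: indicator_def)
    finally show ?thesis .
  qed
  then have "(\<integral>\<^sup>+\<omega>. ennreal (real (X \<omega>) * real (Y \<omega>)) \<partial>M)
     = (\<integral>\<^sup>+\<omega>. (\<Sum>a. \<Sum>b. indicator {\<omega>\<in>space M. Suc a \<le> X \<omega> \<and> Suc b \<le> Y \<omega>} \<omega>) \<partial>M)"
    by (rule nn_integral_cong)
  also have "\<dots> = (\<Sum>a. \<Sum>b. \<integral>\<^sup>+\<omega>. indicator {\<omega>\<in>space M. Suc a \<le> X \<omega> \<and> Suc b \<le> Y \<omega>} \<omega> \<partial>M)"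
    using S by (simp add: nn_integral_suminf)
  also have "\<dots> = (\<Sum>a. \<Sum>b. ennreal (prob {\<omega>\<in>space M. Suc a \<le> X \<omega> \<and> Suc b \<le> Y \<omega>}))"
    by (simp only: nn_integral_indicator[OF S] emeasure_eq_measure)
  finally show ?thesis .
qed

lemma (in prob_space) nn_integral_layers:
  fixes X :: "'a \<Rightarrow> nat"
  assumes X: "X \<in> measurable M (count_space UNIV)"
  shows "(\<integral>\<^sup>+\<omega>. ennreal (real (X \<omega>)) \<partial>M) = (\<Sum>a. ennreal (prob {\<omega>\<in>space M. Suc a \<le> X \<omega>}))"
proof -
  note [measurable] = X
  have S: "{\<omega>\<in>space M. Suc a \<le> X \<omega>} \<in> sets M" for a by measurable
  have "(\<integral>\<^sup>+\<omega>. ennreal (real (X \<omega>)) \<partial>M) = (\<integral>\<^sup>+\<omega>. (\<Sum>a. indicator {\<omega>\<in>space M. Suc a \<le> X \<omega>} \<omega>) \<partial>M)"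
    by (intro nn_integral_cong) (auto simp: ennreal_of_nat_layers indicator_def intro!: suminf_cong)
  also have "\<dots> = (\<Sum>a. \<integral>\<^sup>+\<omega>. indicator {\<omega>\<in>space M. Suc a \<le> X \<omega>} \<omega> \<partial>M)"
    using S by (intro nn_integral_suminf) auto
  also have "\<dots> = (\<Sum>a. ennreal (prob {\<omega>\<in>space M. Suc a \<le> X \<omega>}))"
    by (simp only: nn_integral_indicator[OF S] emeasure_eq_measure)
  finally show ?thesis .
qed

text \<open>The layer formula turns the hypotheses on tails into uncorrelatedness and a uniform bound on
  the second moments.\<close>

lemma (in prob_space) slln_geometric_tails:
  fixes X :: "nat \<Rightarrow> 'a \<Rightarrow> nat" and q :: "nat \<Rightarrow> real"
  assumes X: "\<And>j. j \<ge> 1 \<Longrightarrow> X j \<in> measurable M (count_space UNIV)"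
    and x: "0 \<le> x" "x < 1" and q: "\<And>j. j \<ge> 1 \<Longrightarrow> 0 \<le> q j" "\<And>j. j \<ge> 1 \<Longrightarrow> q j \<le> 1"
    and tail: "\<And>j m. j \<ge> 1 \<Longrightarrow> m \<ge> 1 \<Longrightarrow> prob {\<omega>\<in>space M. m \<le> X j \<omega>} = q j * x ^ m"
    and pair: "\<And>j k a b. 1 \<le> j \<Longrightarrow> j < k \<Longrightarrow> a \<ge> 1 \<Longrightarrow> b \<ge> 1 \<Longrightarrow>
      prob {\<omega>\<in>space M. a \<le> X j \<omega> \<and> b \<le> X k \<omega>} = prob {\<omega>\<in>space M. a \<le> X j \<omega>} * prob {\<omega>\<in>space M. b \<le> X k \<omega>}"
  shows "AE \<omega> in M. (\<lambda>k. ((\<Sum>j=1..k. real (X j \<omega>)) - (\<Sum>j=1..k. q j * (x / (1 - x)))) / real k) \<longlonglongrightarrow> 0"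
proof -
  have geo: "(\<Sum>a. ennreal (c * x ^ Suc a)) = ennreal (c * (x / (1 - x)))" if "0 \<le> c" "0 \<le> x" "x < 1"
      for c x :: real
  proof -
    have "(\<lambda>a. c * x * x ^ a) sums (c * x * (1 / (1 - x)))" using that by (intro sums_mult geometric_sums) simp
    then have "(\<lambda>a. c * x ^ Suc a) sums (c * (x / (1 - x)))" by (simp add: mult_ac)
    then show ?thesis using that by (intro sums_unique[symmetric] sums_ennreal[THEN iffD2]) auto
  qed
  have m: "(\<lambda>\<omega>. real (X j \<omega>)) \<in> borel_measurable M" if "j \<ge> 1" for j
    by (rule measurable_compose[OF X[OF that]]) simp
  have nn1: "(\<integral>\<^sup>+\<omega>. ennreal (real (X j \<omega>)) \<partial>M) = ennreal (q j * (x / (1 - x)))" if "j \<ge> 1" for j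
    using nn_integral_layers[OF X[OF that]] tail[OF that] geo[OF q(1)[OF that] x] by simp
  have E1: "expectation (\<lambda>\<omega>. real (X j \<omega>)) = q j * (x / (1 - x))" if "j \<ge> 1" for j
    using nn1[OF that] q(1)[OF that] x m[OF that] by (intro integral_eq_nn_integral[THEN trans]) auto
  \<comment> \<open>With \<open>s\<^sup>2 = x\<close> the tail at \<open>max a b\<close> is at most \<open>s\<^bsup>a + b\<^esup>\<close>, which factorizes the double sum.\<close>
  define s where "s = sqrt x"
  have s: "0 \<le> s" "s < 1" using x by (simp_all add: s_def)
  define C where "C = (s / (1 - s)) * (s / (1 - s))"
  have C0: "C \<ge> 0" using s by (simp add: C_def)
  have nn2: "(\<integral>\<^sup>+\<omega>. ennreal ((real (X j \<omega>))\<^sup>2) \<partial>M) \<le> ennreal C" if j: "j \<ge> 1" for j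
  proof -
    have "(\<integral>\<^sup>+\<omega>. ennreal ((real (X j \<omega>))\<^sup>2) \<partial>M)
        = (\<Sum>a. \<Sum>b. ennreal (prob {\<omega>\<in>space M. Suc a \<le> X j \<omega> \<and> Suc b \<le> X j \<omega>}))"
      using nn_integral_product_layers[OF X[OF j] X[OF j]] by (simp add: power2_eq_square)
    also have "\<dots> \<le> (\<Sum>a. \<Sum>b. ennreal (s ^ Suc a * s ^ Suc b))"
    proof (intro suminf_le summableI ennreal_leI)
      fix a b
      have e: "{\<omega>\<in>space M. Suc a \<le> X j \<omega> \<and> Suc b \<le> X j \<omega>} = {\<omega>\<in>space M. max (Suc a) (Suc b) \<le> X j \<omega>}" by auto
      have "prob {\<omega>\<in>space M. Suc a \<le> X j \<omega> \<and> Suc b \<le> X j \<omega>} = q j * x ^ max (Suc a) (Suc b)"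
        unfolding e by (rule tail[OF j]) simp
      also have "\<dots> \<le> x ^ max (Suc a) (Suc b)" using q[OF j] x by (intro mult_left_le_one_le) auto
      also have "\<dots> = s ^ (2 * max (Suc a) (Suc b))" using x by (simp add: s_def power_mult)
      also have "\<dots> \<le> s ^ (Suc a + Suc b)" using s by (intro power_decreasing) auto
      finally show "prob {\<omega>\<in>space M. Suc a \<le> X j \<omega> \<and> Suc b \<le> X j \<omega>} \<le> s ^ Suc a * s ^ Suc b"
          by (simp only: power_add)
    qed
    also have "\<dots> = (\<Sum>a. ennreal (s ^ Suc a * (s / (1 - s))))" using s by (intro suminf_cong geo) auto
    also have "\<dots> = (\<Sum>a. ennreal ((s / (1 - s)) * s ^ Suc a))" by (simp only: mult.commute)
    also have "\<dots> = ennreal C" unfolding C_def using s by (intro geo) auto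
    finally show ?thesis .
  qed
  have "AE \<omega> in M. (\<lambda>k. ((\<Sum>j=1..k. real (X j \<omega>)) - (\<Sum>j=1..k. expectation (\<lambda>\<omega>. real (X j \<omega>)))) / real k) \<longlonglongrightarrow> 0"
  proof (rule slln_uncorrelated[where C = C])
    fix j :: nat assume j: "j \<ge> 1"
    show "(\<lambda>\<omega>. real (X j \<omega>)) \<in> borel_measurable M" by (rule m[OF j])
    show int: "integrable M (\<lambda>\<omega>. (real (X j \<omega>))\<^sup>2)"
      using nn2[OF j] m[OF j] by (intro integrableI_bounded) (auto simp: le_less_trans)
    show "expectation (\<lambda>\<omega>. (real (X j \<omega>))\<^sup>2) \<le> C"
      using nn2[OF j] nn_integral_eq_integral[OF int] C0 by simp
  next
    fix j k :: nat assume jk: "1 \<le> j" "j < k"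
    then have k: "1 \<le> k" by simp
    have "(\<integral>\<^sup>+\<omega>. ennreal (real (X j \<omega>) * real (X k \<omega>)) \<partial>M)
       = (\<Sum>a. \<Sum>b. ennreal ((q j * x ^ Suc a) * (q k * x ^ Suc b)))"
      unfolding nn_integral_product_layers[OF X[OF jk(1)] X[OF k]]
          using pair[OF jk] tail[OF jk(1)] tail[OF k] by simp
    also have "\<dots> = (\<Sum>a. \<Sum>b. ennreal (((q j * x ^ Suc a) * q k) * x ^ Suc b))" by (simp only: mult.assoc)
    also have "\<dots> = (\<Sum>a. ennreal (((q j * x ^ Suc a) * q k) * (x / (1 - x))))"
      using q(1)[OF jk(1)] q(1)[OF k] x by (intro suminf_cong geo) auto
    also have "\<dots> = (\<Sum>a. ennreal ((q j * q k * (x / (1 - x))) * x ^ Suc a))" by (simp only: mult_ac)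
    also have "\<dots> = ennreal ((q j * q k * (x / (1 - x))) * (x / (1 - x)))"
      using q(1)[OF jk(1)] q(1)[OF k] x by (intro geo) auto
    also have "(q j * q k * (x / (1 - x))) * (x / (1 - x))
        = expectation (\<lambda>\<omega>. real (X j \<omega>)) * expectation (\<lambda>\<omega>. real (X k \<omega>))"
      unfolding E1[OF jk(1)] E1[OF k] by (simp only: mult_ac)
    finally have nn: "(\<integral>\<^sup>+\<omega>. ennreal (real (X j \<omega>) * real (X k \<omega>)) \<partial>M)
       = ennreal (expectation (\<lambda>\<omega>. real (X j \<omega>)) * expectation (\<lambda>\<omega>. real (X k \<omega>)))" .
    show "expectation (\<lambda>\<omega>. real (X j \<omega>) * real (X k \<omega>))
        = expectation (\<lambda>\<omega>. real (X j \<omega>)) * expectation (\<lambda>\<omega>. real (X k \<omega>))"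
      using nn m[OF jk(1)] m[OF k] by (subst integral_eq_nn_integral) auto
  qed auto
  moreover have "(\<Sum>j=1..k. expectation (\<lambda>\<omega>. real (X j \<omega>))) = (\<Sum>j=1..k. q j * (x / (1 - x)))" for k
    using E1 by (intro sum.cong) auto
  ultimately show ?thesis by simp
qed

section \<open>Growth of the singular numbers of a product\<close>

text \<open>An entry of row \<open>a\<close> of a product of upper triangular matrices is a sum over paths which, read from
  the last factor to the first, move from row \<open>a\<close> to rows of larger index. As the growth rates
  \<open>\<l>\<close> increase with the index, no path picks up less than the rate of row \<open>a\<close>. The induction on \<open>n - a\<close>
  is on the rows that the path visits before it settles in row \<open>a\<close>.\<close>

lemma triangular_product_rows:
  fixes T R :: "nat \<Rightarrow> 'p::prime_card padic_int mat"
  assumes R: "\<And>k. R k \<in> carrier_mat n n" and T: "\<And>k. T k \<in> carrier_mat n n"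
    and tri: "\<And>k l r. l < r \<Longrightarrow> r < n \<Longrightarrow> R k $$ (r, l) = 0"
    and rec: "\<And>k. T (Suc k) = R k * T k"
    and mono: "\<And>k a. a < n \<Longrightarrow> t k a \<le> t (Suc k) a"
    and diag: "\<And>k a. a < n \<Longrightarrow> \<pi> ^ (t (Suc k) a - t k a) dvd R k $$ (a, a)"
    and lim: "\<And>a. a < n \<Longrightarrow> (\<lambda>k. real (t k a) / real k) \<longlonglongrightarrow> \<l> a"
    and incr: "\<And>a c. a \<le> c \<Longrightarrow> c < n \<Longrightarrow> \<l> a \<le> \<l> c"
    and \<epsilon>: "\<epsilon> > 0" and a: "a < n"
  shows "\<exists>C\<ge>0. \<forall>k b m. b < n \<longrightarrow> real m \<le> (\<l> a - \<epsilon>) * real k - C \<longrightarrow> \<pi> ^ m dvd T k $$ (a, b)"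
proof -
  have "a < n \<Longrightarrow> \<epsilon> > 0 \<Longrightarrow>
     \<exists>C\<ge>0. \<forall>k b m. b < n \<longrightarrow> real m \<le> (\<l> a - \<epsilon>) * real k - C \<longrightarrow> \<pi> ^ m dvd T k $$ (a, b)" for a \<epsilon>
  proof (induction "n - a" arbitrary: a \<epsilon> rule: less_induct)
    case less
    define \<delta> where "\<delta> = \<epsilon> / 3"
    have \<delta>: "\<delta> > 0" using less.prems by (simp add: \<delta>_def)
    have "\<forall>c. \<exists>C. a < c \<longrightarrow> c < n \<longrightarrow> C \<ge> 0 \<and>
       (\<forall>k b m. b < n \<longrightarrow> real m \<le> (\<l> c - \<delta>) * real k - C \<longrightarrow> \<pi> ^ m dvd T k $$ (c, b))"
      using less.hyps \<delta> less.prems by (metis diff_less_mono2)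
    then obtain C where C: "\<And>c. a < c \<Longrightarrow> c < n \<Longrightarrow> C c \<ge> 0"
      "\<And>c k b m. a < c \<Longrightarrow> c < n \<Longrightarrow> b < n \<Longrightarrow> real m \<le> (\<l> c - \<delta>) * real k - C c \<Longrightarrow> \<pi> ^ m dvd T k $$ (c, b)"
      unfolding choice_iff by blast
    define C1 where "C1 = (\<Sum>c\<in>{a<..<n}. C c) + \<bar>\<l> a\<bar>"
    have CC1: "C c + \<bar>\<l> a\<bar> \<le> C1" if "a < c" "c < n" for c
    proof -
      have "C c \<le> (\<Sum>c\<in>{a<..<n}. C c)" using that C(1) by (intro member_le_sum) auto
      then show ?thesis by (simp add: C1_def)
    qed
    have C10: "C1 \<ge> 0" unfolding C1_def using C(1) by (intro add_nonneg_nonneg sum_nonneg) auto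
    obtain C2 where C2: "C2 \<ge> 0" "\<And>k. \<bar>real (t k a) - \<l> a * real k\<bar> \<le> \<delta> * real k + C2"
      by (rule growth_bounds[OF lim[OF less.prems(1)] \<delta>]) auto
    \<comment> \<open>The index \<open>j\<close> is the time after which the path stays in row \<open>a\<close>; up to then the bound for later rows applies.\<close>
    have step: "\<pi> ^ m dvd T k $$ (a, b)"
      if "b < n" "\<forall>j\<le>k. real m \<le> real (t k a) - real (t j a) + (\<l> a - \<delta>) * real j - C1" for k b m
      using that
    proof (induction k arbitrary: m)
      case 0
      then have "m = 0" using C10 by auto
      then show ?case by simp
    next
      case (Suc k)
      define d where "d = t (Suc k) a - t k a"
      have d: "real d = real (t (Suc k) a) - real (t k a)"
        unfolding d_def using mono[OF less.prems(1), of k] by simp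
      have 1: "\<pi> ^ (m - d) dvd T k $$ (a, b)"
      proof (cases "m \<le> d")
        case False
        then have md: "real (m - d) = real m - real d" by simp
        show ?thesis
        proof (rule Suc.IH[OF Suc.prems(1)], intro allI impI)
          fix j assume "j \<le> k"
          then have "real m \<le> real (t (Suc k) a) - real (t j a) + (\<l> a - \<delta>) * real j - C1"
            using Suc.prems(2) by simp
          then show "real (m - d) \<le> real (t k a) - real (t j a) + (\<l> a - \<delta>) * real j - C1"
            using md d by linarith
        qed
      qed simp
      have "(\<pi> :: 'p padic_int) ^ m dvd \<pi> ^ d * \<pi> ^ (m - d)"
        unfolding power_add[symmetric] by (rule le_imp_power_dvd) simp
      also have "\<dots> dvd R k $$ (a, a) * T k $$ (a, b)"
        using 1 diag[OF less.prems(1), of k] unfolding d_def by (rule mult_dvd_mono[rotated])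
      finally have 2: "\<pi> ^ m dvd R k $$ (a, a) * T k $$ (a, b)" .
      have 3: "\<pi> ^ m dvd T k $$ (c, b)" if "a < c" "c < n" for c
      proof (rule C(2)[OF that Suc.prems(1)])
        have "real m \<le> (\<l> a - \<delta>) * real (Suc k) - C1" using Suc.prems(2)[rule_format, of "Suc k"] by simp
        also have "\<dots> \<le> (\<l> a - \<delta>) * real k + \<bar>\<l> a\<bar> - C1" using \<delta> by (simp add: algebra_simps)
        also have "\<dots> \<le> (\<l> c - \<delta>) * real k - C c"
        proof -
          have "(\<l> a - \<delta>) * real k \<le> (\<l> c - \<delta>) * real k"
            using incr[of a c] that by (intro mult_right_mono) auto
          then show ?thesis using CC1[OF that] by linarith
        qed
        finally show "real m \<le> (\<l> c - \<delta>) * real k - C c" .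
      qed
      have "T (Suc k) $$ (a, b) = (\<Sum>s<n. R k $$ (a, s) * T k $$ (s, b))"
        unfolding rec using R[of k] T[of k] less.prems Suc.prems by (intro mult_entry[of _ n n _ n]) auto
      moreover have "\<pi> ^ m dvd R k $$ (a, s) * T k $$ (s, b)" if "s < n" for s
      proof -
        consider "s < a" | "s = a" | "a < s" by linarith
        then show ?thesis
        proof cases
          case 1
          then show ?thesis using tri[of s a k] less.prems by simp
        next
          case 2
          then show ?thesis using \<open>\<pi> ^ m dvd R k $$ (a, a) * T k $$ (a, b)\<close> by simp
        next
          case 3
          then show ?thesis using \<open>\<And>c. a < c \<Longrightarrow> c < n \<Longrightarrow> \<pi> ^ m dvd T k $$ (c, b)\<close> that by (intro dvd_mult) auto
        qed
      qed
      ultimately show ?case by (auto intro!: dvd_sum)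
    qed
    show ?case
    proof (intro exI[of _ "2 * C2 + C1"] conjI allI impI)
      show "0 \<le> 2 * C2 + C1" using C2 C10 by simp
      fix k b m assume bm: "b < n" "real m \<le> (\<l> a - \<epsilon>) * real k - (2 * C2 + C1)"
      show "\<pi> ^ m dvd T k $$ (a, b)"
      proof (rule step[OF bm(1)], intro allI impI)
        fix j assume j: "j \<le> k"
        have "\<delta> * real j \<le> \<delta> * real k" using j \<delta> by (intro mult_left_mono) auto
        moreover have "\<epsilon> * real k = 3 * (\<delta> * real k)" by (simp add: \<delta>_def)
        ultimately show "real m \<le> real (t k a) - real (t j a) + (\<l> a - \<delta>) * real j - C1"
          using bm(2) abs_le_D2[OF C2(2)[of k]] abs_le_D1[OF C2(2)[of j]]
            left_diff_distrib[of "\<l> a" \<epsilon> "real k"] left_diff_distrib[of "\<l> a" \<delta> "real j"]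
          by linarith
      qed
    qed
  qed
  then show ?thesis using a \<epsilon> by blast
qed

lemma det_pi_diag: "det (pi_diag n b) = \<pi> ^ (\<Sum>i<n. b i)"
proof -
  have "det (pi_diag n b) = prod_list (diag_mat (pi_diag n b :: 'a padic_int mat))"
    by (rule det_upper_triangular[of _ n]) (auto simp: pi_diag_def)
  also have "\<dots> = (\<Prod>i<n. \<pi> ^ b i)"
    by (simp add: prod_list_diag_prod pi_diag_def atLeast0LessThan del: of_nat_power)
  finally show ?thesis by (simp only: power_sum)
qed

lemma sum_smith_eq_sum_depth:
  fixes P :: "'p::prime_card padic_int mat"
  assumes P: "P \<in> carrier_mat n n" and UV: "U \<in> GL n" "V \<in> GL n" "U * P * V = pi_diag n b"
    and W: "W \<in> GL n" and tri: "\<And>l r. l < r \<Longrightarrow> r < n \<Longrightarrow> (W * P) $$ (r, l) = 0"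
    and t: "\<And>i. i < n \<Longrightarrow> \<exists>u. (W * P) $$ (i, i) = \<pi> ^ t i * u \<and> u dvd 1"
  shows "(\<Sum>i<n. b i) = (\<Sum>i<n. t i)"
proof -
  have c: "U \<in> carrier_mat n n" "V \<in> carrier_mat n n" "W \<in> carrier_mat n n" using UV W by auto
  obtain u where u: "\<And>i. i < n \<Longrightarrow> (W * P) $$ (i, i) = \<pi> ^ t i * u i" "\<And>i. i < n \<Longrightarrow> u i dvd 1"
    using t by metis
  have WP: "W * P \<in> carrier_mat n n" using c P by auto
  have "det (W * P) = prod_list (diag_mat (W * P))"
    by (rule det_upper_triangular[OF _ WP]) (use tri WP in auto)
  also have "\<dots> = (\<Prod>i<n. \<pi> ^ t i * u i)"
    using WP u(1) c by (simp add: prod_list_diag_prod atLeast0LessThan del: of_nat_power)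
  also have "\<dots> = \<pi> ^ (\<Sum>i<n. t i) * prod u {..<n}" by (simp only: prod.distrib power_sum)
  finally have d1: "det W * det P = \<pi> ^ (\<Sum>i<n. t i) * prod u {..<n}" using c P by (simp add: det_mult[of _ n])
  have pu: "prod u {..<n} dvd 1" using prod_dvd_prod[of "{..<n}" u "\<lambda>_. 1"] u(2) by simp
  have "det (U * P * V) = det U * det P * det V" using c P by (simp add: det_mult[of _ n])
  moreover have "det (pi_diag n b :: 'p padic_int mat) = \<pi> ^ (\<Sum>i<n. b i)" by (rule det_pi_diag)
  ultimately have d2: "det U * det P * det V = \<pi> ^ (\<Sum>i<n. b i)" by (simp only: UV(3))
  have units: "det U dvd 1" "det V dvd 1" "det W dvd 1" using UV W GL_det_dvd by auto
  have dv: "\<pi> ^ m dvd det P \<longleftrightarrow> m \<le> (\<Sum>i<n. t i)" for m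
  proof -
    have "\<pi> ^ m dvd det P \<longleftrightarrow> \<pi> ^ m dvd det W * det P" by (rule unit_mult_dvd_iff[OF units(3), symmetric])
    also have "\<dots> \<longleftrightarrow> m \<le> (\<Sum>i<n. t i)"
      unfolding d1 using pi_power_dvd_le[OF _ pu] by (auto intro: dvd_mult2 le_imp_power_dvd)
    finally show ?thesis .
  qed
  moreover have "\<pi> ^ m dvd det P \<longleftrightarrow> m \<le> (\<Sum>i<n. b i)" for m
  proof -
    have "\<pi> ^ m dvd det P \<longleftrightarrow> \<pi> ^ m dvd det V * (det U * det P)"
      by (simp only: unit_mult_dvd_iff[OF units(1)] unit_mult_dvd_iff[OF units(2)])
    also have "det V * (det U * det P) = \<pi> ^ (\<Sum>i<n. b i) * 1" using d2 by (simp add: mult_ac del: of_nat_power)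
    also have "\<pi> ^ m dvd \<dots> \<longleftrightarrow> m \<le> (\<Sum>i<n. b i)"
      using pi_power_dvd_le[of m "\<Sum>i<n. b i" 1] by (auto intro: le_imp_power_dvd)
    finally show ?thesis .
  qed
  ultimately have "m \<le> (\<Sum>i<n. b i) \<longleftrightarrow> m \<le> (\<Sum>i<n. t i)" for m by blast
  then show ?thesis by (meson order_antisym order_refl)
qed

text \<open>In the moving frame the rows of the product are divisible by powers of \<open>p\<close> that grow with the rates
  \<open>\<l>\<close>, up to an error \<open>\<epsilon> k\<close>. By the comparison principle these powers are lower bounds for
  the singular numbers. Since the valuation of the determinant is both the sum of the singular
  numbers and the sum of the depths, no singular number can exceed its lower bound by more than
  another multiple of \<open>\<epsilon> k\<close>.\<close>

lemma singular_numbers_growth: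
  fixes A :: "nat \<Rightarrow> 'p::prime_card padic_int mat"
  assumes A: "\<And>k. A k \<in> carrier_mat n n"
    and reg: "\<And>k. regular_below n n (mat_lprod n A k)"
    and lim: "\<And>i. i < n \<Longrightarrow> (\<lambda>k. real (depth n i (mat_lprod n A k)) / real k) \<longlonglongrightarrow> \<l> i"
    and incr: "\<And>i j. i \<le> j \<Longrightarrow> j < n \<Longrightarrow> \<l> i \<le> \<l> j"
    and i: "i < n"
  shows "(\<lambda>k. real_of_int (SN (map_mat to_fract (mat_lprod n A k)) ! (n - 1 - i)) / real k) \<longlonglongrightarrow> \<l> i"
proof -
  define P where "P = mat_lprod n A"
  define t where "t k i = depth n i (P k)" for k i
  have lim': "(\<lambda>k. real (t k a) / real k) \<longlonglongrightarrow> \<l> a" if "a < n" for a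
    unfolding t_def P_def by (rule lim[OF that])
  have P: "P k \<in> carrier_mat n n" for k unfolding P_def by (rule mat_lprod_carrier[OF A])
  obtain U R where U: "\<And>k. U k \<in> GL n" and R: "\<And>k. R k \<in> carrier_mat n n"
    and Rtri: "\<And>k l r. l < r \<Longrightarrow> r < n \<Longrightarrow> R k $$ (r, l) = 0" and U0: "U 0 = 1\<^sub>m n"
    and URk: "\<And>k. U (Suc k) * mat_lprod n A (Suc k) = R k * (U k * mat_lprod n A k)"
    using triangular_frames[where A = A and n = n, OF A] by blast
  define T where "T k = U k * P k" for k
  have T: "T k \<in> carrier_mat n n" for k unfolding T_def using U[of k] P[of k] by auto
  have rec: "T (Suc k) = R k * T k" for k unfolding T_def P_def by (rule URk)
  have T0: "T 0 = 1\<^sub>m n" by (simp add: T_def P_def U0)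
  have Ttri: "T k $$ (r, l) = 0" if "l < r" "r < n" for k r l
    using that
  proof (induction k arbitrary: r l)
    case 0 then show ?case by (simp add: T0)
  next
    case (Suc k)
    show ?case unfolding rec by (rule upper_triangular_mult(1)[OF R T Rtri Suc.IH Suc.prems])
  qed
  have Tdiag: "T (Suc k) $$ (r, r) = R k $$ (r, r) * T k $$ (r, r)" if "r < n" for k r
    unfolding rec by (rule upper_triangular_mult(2)[OF R T Rtri Ttri that])
  have tu: "\<exists>u. T k $$ (r, r) = \<pi> ^ t k r * u \<and> u dvd 1" if "r < n" for k r
    using regular_diag_unit[OF P U[of k] _ _ that] Ttri[of _ _ k] reg[of k] unfolding T_def t_def P_def by metis
  have tmono: "t k r \<le> t (Suc k) r" and tR: "\<pi> ^ (t (Suc k) r - t k r) dvd R k $$ (r, r)" if r: "r < n" for k r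
  proof -
    obtain u where u: "T k $$ (r, r) = \<pi> ^ t k r * u" "u dvd 1" using tu[OF r] by blast
    obtain u' where u': "T (Suc k) $$ (r, r) = \<pi> ^ t (Suc k) r * u'" "u' dvd 1" using tu[OF r] by blast
    have e: "\<pi> ^ t (Suc k) r * u' = \<pi> ^ t k r * (u * R k $$ (r, r))"
      using Tdiag[OF r, of k] u(1) u'(1) by (simp only: mult_ac)
    then have "\<pi> ^ t k r dvd \<pi> ^ t (Suc k) r * u'" by simp
    then show le: "t k r \<le> t (Suc k) r" by (rule pi_power_dvd_le[OF _ u'(2)])
    have "\<pi> ^ ((t (Suc k) r - t k r) + t k r) dvd \<pi> ^ t (Suc k) r * u'" using le by (simp del: of_nat_power)
    then have "\<pi> ^ (t (Suc k) r - t k r) dvd u * R k $$ (r, r)" unfolding e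
        by (simp only: pi_power_mult_dvd_cancel)
    then show "\<pi> ^ (t (Suc k) r - t k r) dvd R k $$ (r, r)" by (simp only: unit_mult_dvd_iff[OF u(2)])
  qed
  have detP: "det (P k) \<noteq> 0" for k
  proof
    assume "det (P k) = 0"
    then have "det (T k) = 0" unfolding T_def using U[of k] P[of k] by (simp add: det_mult[of _ n])
    moreover have "det (T k) = prod_list (diag_mat (T k))"
      by (rule det_upper_triangular[OF _ T]) (use Ttri[of _ _ k] T[of k] in auto)
    ultimately have "(\<Prod>r<n. T k $$ (r, r)) = 0"
      using T[of k] by (simp add: prod_list_diag_prod atLeast0LessThan)
    then obtain r where "r < n" "T k $$ (r, r) = 0" by auto
    then show False using tu[of r k] by (auto simp del: of_nat_power)
  qed
  have "\<forall>k. \<exists>b. (\<forall>r s. r \<le> s \<longrightarrow> s < n \<longrightarrow> b r \<le> b s) \<and> (\<exists>V\<in>GL n. \<exists>W\<in>GL n. V * P k * W = pi_diag n b)"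
    using smith_exists[OF P detP] by meson
  then obtain b where bmono: "\<And>k r s. r \<le> s \<Longrightarrow> s < n \<Longrightarrow> b k r \<le> b k s"
    and bex: "\<And>k. \<exists>V\<in>GL n. \<exists>W\<in>GL n. V * P k * W = pi_diag n (b k)"
    unfolding choice_iff by blast
  have SNb: "SN (map_mat to_fract (P k)) ! (n - 1 - r) = int (b k r)" if "r < n" for k r
  proof -
    from bex[of k] obtain V W where VW: "V \<in> GL n" "W \<in> GL n" "V * P k * W = pi_diag n (b k)" by (elim bexE)
    show ?thesis by (rule SN_nth[OF P VW bmono that])
  qed
  have bsum: "(\<Sum>r<n. b k r) = (\<Sum>r<n. t k r)" for k
  proof -
    from bex[of k] obtain V W where VW: "V \<in> GL n" "W \<in> GL n" "V * P k * W = pi_diag n (b k)" by (elim bexE)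
    show ?thesis
      by (rule sum_smith_eq_sum_depth[OF P VW U Ttri[unfolded T_def] tu[unfolded T_def]])
  qed
  have lower: "\<exists>C\<ge>0. \<forall>k. \<forall>r<n. real (b k r) \<ge> (\<l> r - \<epsilon>) * real k - C" if \<epsilon>: "\<epsilon> > 0" for \<epsilon>
  proof -
    have "\<forall>r. \<exists>C. r < n \<longrightarrow> C \<ge> 0 \<and> (\<forall>k b m. b < n \<longrightarrow> real m \<le> (\<l> r - \<epsilon>) * real k - C \<longrightarrow> \<pi> ^ m dvd T k $$ (r, b))"
      using triangular_product_rows[OF R T Rtri rec tmono tR lim' incr \<epsilon>] by blast
    then obtain C where C: "\<And>r. r < n \<Longrightarrow> C r \<ge> 0"
      "\<And>r k b m. r < n \<Longrightarrow> b < n \<Longrightarrow> real m \<le> (\<l> r - \<epsilon>) * real k - C r \<Longrightarrow> \<pi> ^ m dvd T k $$ (r, b)"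
      unfolding choice_iff by blast
    define D where "D = (\<Sum>r<n. C r)"
    have D: "C r \<le> D" if "r < n" for r unfolding D_def using that C(1) by (intro member_le_sum) auto
    have D0: "D \<ge> 0" unfolding D_def using C(1) by (intro sum_nonneg) auto
    \<comment> \<open>The common constant \<open>D\<close> keeps the exponents increasing in \<open>r\<close>.\<close>
    define a where "a k r = nat \<lfloor>(\<l> r - \<epsilon>) * real k - D\<rfloor>" for k r
    have amono: "a k r \<le> a k s" if "r \<le> s" "s < n" for k r s
      unfolding a_def using incr[OF that] by (intro nat_mono floor_mono diff_right_mono mult_right_mono) auto
    have adv: "\<pi> ^ a k r dvd T k $$ (r, c)" if "r < n" "c < n" for k r c
    proof (cases "(\<l> r - \<epsilon>) * real k - D \<ge> 0")
      case True
      then have "real (a k r) \<le> (\<l> r - \<epsilon>) * real k - D" unfolding a_def by simp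
      then show ?thesis using D[OF that(1)] by (intro C(2)[OF that]) linarith
    next
      case False
      then have "a k r = 0" unfolding a_def by simp
      then show ?thesis by simp
    qed
    have ab: "a k r \<le> b k r" if r: "r < n" for k r
    proof -
      have "\<forall>r c. \<exists>z. r < n \<longrightarrow> c < n \<longrightarrow> T k $$ (r, c) = \<pi> ^ a k r * z"
        using adv unfolding dvd_def by blast
      then obtain z where z: "\<And>r c. r < n \<Longrightarrow> c < n \<Longrightarrow> T k $$ (r, c) = \<pi> ^ a k r * z r c"
        unfolding choice_iff by blast
      define N where "N = mat n n (\<lambda>(r, c). z r c)"
      have N: "N \<in> carrier_mat n n" by (simp add: N_def)
      have TN: "U k * P k = pi_diag n (a k) * N"
      proof (rule eq_matI)
        fix r c assume "r < dim_row (pi_diag n (a k) * N)" "c < dim_col (pi_diag n (a k) * N)"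
        then have rc: "r < n" "c < n" by (auto simp: pi_diag_def N_def)
        have "(pi_diag n (a k) * N) $$ (r, c) = (\<Sum>s<n. pi_diag n (a k) $$ (r, s) * N $$ (s, c))"
          using rc N by (intro mult_entry[of _ n n _ n]) auto
        also have "\<dots> = (\<Sum>s<n. (if r = s then 1 else 0) * (\<pi> ^ a k r * N $$ (s, c)))"
          by (rule sum.cong) (use rc in \<open>auto simp: pi_diag_def\<close>)
        also have "\<dots> = \<pi> ^ a k r * N $$ (r, c)" using rc by (simp only: sum_delta_mult)
        also have "\<dots> = (U k * P k) $$ (r, c)" using rc z[of r c] by (simp add: N_def T_def)
        finally show "(U k * P k) $$ (r, c) = (pi_diag n (a k) * N) $$ (r, c)" by simp
      qed (use T[of k] in \<open>auto simp: T_def pi_diag_def N_def\<close>)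
      from bex[of k] obtain V W where VW: "V \<in> GL n" "W \<in> GL n" "V * P k * W = pi_diag n (b k)" by (elim bexE)
      show ?thesis by (rule smith_le[OF P VW U N TN amono bmono r])
    qed
    have "(\<l> r - \<epsilon>) * real k - (D + 1) \<le> real (b k r)" if "r < n" for k r
      using ab[OF that, of k] unfolding a_def by linarith
    then show ?thesis using D0 by (intro exI[of _ "D + 1"]) auto
  qed
  have "(\<lambda>k. real (b k i) / real k) \<longlonglongrightarrow> \<l> i"
  proof (rule linear_growth_limit)
    fix \<epsilon> :: real assume \<epsilon>: "\<epsilon> > 0"
    \<comment> \<open>The upper bound collects \<open>n\<close> errors from the depths and at most \<open>n\<close> from the lower bounds.\<close>
    define \<delta> where "\<delta> = \<epsilon> / (2 * real n + 1)"
    have \<delta>: "\<delta> > 0" using \<epsilon> by (simp add: \<delta>_def)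
    obtain C where C: "C \<ge> 0" "\<And>k r. r < n \<Longrightarrow> real (b k r) \<ge> (\<l> r - \<delta>) * real k - C" using lower[OF \<delta>] by blast
    have "\<forall>r. \<exists>C. r < n \<longrightarrow> (C \<ge> 0 \<and> (\<forall>k. \<bar>real (t k r) - \<l> r * real k\<bar> \<le> \<delta> * real k + C))"
      using growth_bounds[OF lim' \<delta>] by (metis of_nat_0_less_iff of_nat_0_le_iff)
    then obtain E where E: "\<And>r. r < n \<Longrightarrow> E r \<ge> 0"
       "\<And>r k. r < n \<Longrightarrow> \<bar>real (t k r) - \<l> r * real k\<bar> \<le> \<delta> * real k + E r"
      unfolding choice_iff by blast
    show "\<exists>C. \<forall>k. \<bar>real (b k i) - \<l> i * real k\<bar> \<le> \<epsilon> * real k + C"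
    proof (intro exI[of _ "(\<Sum>r<n. E r) + real n * C + C"] allI)
      fix k
      let ?I = "{..<n} - {i}"
      have E0: "(\<Sum>r<n. E r) \<ge> 0" using E(1) by (intro sum_nonneg) auto
      have eps: "\<epsilon> * real k = 2 * real n * (\<delta> * real k) + \<delta> * real k"
      proof -
        have "2 * real n + 1 \<noteq> 0" by linarith
        then have "\<epsilon> = (2 * real n + 1) * \<delta>" unfolding \<delta>_def by simp
        then have "\<epsilon> = 2 * real n * \<delta> + \<delta>" by (simp only: distrib_right mult_1)
        then have "\<epsilon> * real k = (2 * real n * \<delta> + \<delta>) * real k" by (rule arg_cong)
        then show ?thesis by (simp add: algebra_simps)
      qed
      have dk: "0 \<le> \<delta> * real k" "0 \<le> real n * (\<delta> * real k)" using \<delta> by auto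
      have "real (b k i) = (\<Sum>r<n. real (b k r)) - (\<Sum>r\<in>?I. real (b k r))"
        using i by (subst sum.remove[of "{..<n}" i]) auto
      also have "(\<Sum>r<n. real (b k r)) = (\<Sum>r<n. real (t k r))" using bsum[of k] by (metis of_nat_sum)
      also have "\<dots> \<le> (\<Sum>r<n. \<l> r * real k + \<delta> * real k + E r)"
        using E(2) by (intro sum_mono) (auto simp: abs_le_iff algebra_simps)
      also have "\<dots> = (\<Sum>r<n. \<l> r * real k) + real n * (\<delta> * real k) + (\<Sum>r<n. E r)"
        by (simp add: sum.distrib)
      also have "(\<Sum>r<n. \<l> r * real k) = \<l> i * real k + (\<Sum>r\<in>?I. \<l> r * real k)"
        using i by (subst sum.remove[of "{..<n}" i]) auto
      finally have 1: "real (b k i) \<le> \<l> i * real k + (\<Sum>r\<in>?I. \<l> r * real k) + real n * (\<delta> * real k) + (\<Sum>r<n. E r) - (\<Sum>r\<in>?I. real (b k r))"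
        by simp
      have "(\<Sum>r\<in>?I. \<l> r * real k - real (b k r)) \<le> (\<Sum>r\<in>?I. \<delta> * real k + C)"
        using C(2)[of _ k] by (intro sum_mono) (auto simp: left_diff_distrib algebra_simps)
      also have "\<dots> \<le> (\<Sum>r<n. \<delta> * real k + C)" using dk C(1) by (intro sum_mono2) auto
      also have "\<dots> = real n * (\<delta> * real k) + real n * C" by (simp add: distrib_left)
      finally have 2: "(\<Sum>r\<in>?I. \<l> r * real k) - (\<Sum>r\<in>?I. real (b k r)) \<le> real n * (\<delta> * real k) + real n * C"
        by (simp add: sum_subtractf)
      have 3: "real (b k i) \<ge> \<l> i * real k - \<delta> * real k - C" using C(2)[OF i, of k]
          by (simp add: left_diff_distrib)
      have "real n * C \<ge> 0" using C by simp
      then show "\<bar>real (b k i) - \<l> i * real k\<bar> \<le> \<epsilon> * real k + ((\<Sum>r<n. E r) + real n * C + C)"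
        using 1 2 3 eps dk E0 C(1) mult.assoc[of 2 "real n" "\<delta> * real k"] by linarith
    qed
  qed
  then show ?thesis using SNb[OF i] by (simp add: P_def)
qed

section \<open>Measurability\<close>

lemma measurable_binop_int:
  fixes F G :: "'w \<Rightarrow> int"
  assumes F: "F \<in> measurable M (count_space UNIV)" and G: "G \<in> measurable M (count_space UNIV)"
  shows "(\<lambda>x. h (F x) (G x) :: int) \<in> measurable M (count_space UNIV)"
proof (rule measurable_compose_countable[OF _ F])
  fix i show "(\<lambda>x. h i (G x)) \<in> measurable M (count_space UNIV)"
    by (rule measurable_compose[OF G]) simp
qed

lemma padic_ball_open: "open {y :: 'p::prime_card padic_int. padic_res y m = a}"
  unfolding open_padic_int_def by (auto intro!: exI[of _ m])

text \<open>The balls of the p-adic topology are indexed by a level and a residue. There are countably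
  many of them, so that the Borel sets are generated by the residue maps.\<close>

lemma padic_measurable_iff:
  fixes f :: "'w \<Rightarrow> 'p::prime_card padic_int"
  shows "f \<in> borel_measurable M \<longleftrightarrow> (\<forall>m. (\<lambda>x. padic_res (f x) m) \<in> measurable M (count_space UNIV))"
proof
  assume f: "f \<in> borel_measurable M"
  show "\<forall>m. (\<lambda>x. padic_res (f x) m) \<in> measurable M (count_space UNIV)"
  proof
    fix m
    have "(\<lambda>x. padic_res (f x) m) -` {a} \<inter> space M \<in> sets M" for a
    proof -
      have "f -` {y. padic_res y m = a} \<inter> space M \<in> sets M"
        by (rule measurable_sets[OF f]) (intro borel_open padic_ball_open)
      then show ?thesis by (simp add: vimage_def)
    qed
    then show "(\<lambda>x. padic_res (f x) m) \<in> measurable M (count_space UNIV)"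
      by (simp add: measurable_count_space_eq2_countable)
  qed
next
  assume f: "\<forall>m. (\<lambda>x. padic_res (f x) m) \<in> measurable M (count_space UNIV)"
  show "f \<in> borel_measurable M"
  proof (rule borel_measurableI)
    fix S :: "'p padic_int set" assume S: "open S"
    define J where "J = {(m, a). {y :: 'p padic_int. padic_res y m = a} \<subseteq> S}"
    have "f -` S \<inter> space M = (\<Union>(m, a)\<in>J. (\<lambda>x. padic_res (f x) m) -` {a} \<inter> space M)"
      using S unfolding J_def open_padic_int_def by fastforce
    also have "\<dots> \<in> sets M"
      by (rule sets.countable_UN'') (use f in \<open>auto intro: measurable_sets\<close>)
    finally show "f -` S \<inter> space M \<in> sets M" .
  qed
qed

lemma padic_measurable_mult:
  fixes f g :: "'w \<Rightarrow> 'p::prime_card padic_int"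
  assumes "f \<in> borel_measurable M" "g \<in> borel_measurable M"
  shows "(\<lambda>x. f x * g x) \<in> borel_measurable M"
  using assms unfolding padic_measurable_iff padic_rep
      by (intro allI measurable_binop_int[where h = "\<lambda>a b. (a * b) mod _"]) auto

lemma padic_measurable_add:
  fixes f g :: "'w \<Rightarrow> 'p::prime_card padic_int"
  assumes "f \<in> borel_measurable M" "g \<in> borel_measurable M"
  shows "(\<lambda>x. f x + g x) \<in> borel_measurable M"
  using assms unfolding padic_measurable_iff padic_rep
      by (intro allI measurable_binop_int[where h = "\<lambda>a b. (a + b) mod _"]) auto

lemma padic_measurable_diff:
  fixes f g :: "'w \<Rightarrow> 'p::prime_card padic_int"
  assumes "f \<in> borel_measurable M" "g \<in> borel_measurable M"
  shows "(\<lambda>x. f x - g x) \<in> borel_measurable M"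
  using assms unfolding padic_measurable_iff padic_res_diff
      by (intro allI measurable_binop_int[where h = "\<lambda>a b. (a - b) mod _"]) auto

lemma padic_measurable_sum:
  fixes f :: "'i \<Rightarrow> 'w \<Rightarrow> 'p::prime_card padic_int"
  assumes "\<And>i. i \<in> I \<Longrightarrow> f i \<in> borel_measurable M"
  shows "(\<lambda>x. \<Sum>i\<in>I. f i x) \<in> borel_measurable M"
  using assms by (induction I rule: infinite_finite_induct) (auto intro: padic_measurable_add)

lemma space_mat_borel [simp]: "space (mat_borel n) = carrier_mat n n"
  unfolding mat_borel_def by (rule space_measure_of) auto

lemma mat_borel_measurable_iff:
  fixes f :: "'w \<Rightarrow> 'a::topological_space mat"
  shows "f \<in> measurable M (mat_borel n) \<longleftrightarrow>
    (\<forall>x\<in>space M. f x \<in> carrier_mat n n) \<and> (\<forall>i<n. \<forall>j<n. (\<lambda>x. f x $$ (i, j)) \<in> borel_measurable M)"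
proof safe
  fix x assume "f \<in> measurable M (mat_borel n)" "x \<in> space M"
  then show "f x \<in> carrier_mat n n" by (auto dest: measurable_space)
next
  fix i j assume f: "f \<in> measurable M (mat_borel n)" and ij: "i < n" "j < n"
  show "(\<lambda>x. f x $$ (i, j)) \<in> borel_measurable M"
  proof (rule measurableI)
    fix S :: "'a set" assume S: "S \<in> sets borel"
    have "{A \<in> carrier_mat n n. A $$ (i, j) \<in> S} \<in> sets (mat_borel n)"
      unfolding mat_borel_def using ij S by (intro in_measure_of) blast+
    then have "f -` {A \<in> carrier_mat n n. A $$ (i, j) \<in> S} \<inter> space M \<in> sets M"
      by (rule measurable_sets[OF f])
    moreover have "f -` {A \<in> carrier_mat n n. A $$ (i, j) \<in> S} \<inter> space M = (\<lambda>x. f x $$ (i, j)) -` S \<inter> space M"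
      using measurable_space[OF f] by auto
    ultimately show "(\<lambda>x. f x $$ (i, j)) -` S \<inter> space M \<in> sets M" by simp
  qed simp
next
  assume c: "\<forall>x\<in>space M. f x \<in> carrier_mat n n" and e: "\<forall>i<n. \<forall>j<n. (\<lambda>x. f x $$ (i, j)) \<in> borel_measurable M"
  show "f \<in> measurable M (mat_borel n)"
    unfolding mat_borel_def
  proof (rule measurable_measure_of)
    fix Y :: "'a mat set" assume "Y \<in> {{A \<in> carrier_mat n n. A $$ (i, j) \<in> S} |i j S. i < n \<and> j < n
        \<and> S \<in> sets borel}"
    then obtain i j and S :: "'a set" where Y: "Y = {A \<in> carrier_mat n n. A $$ (i, j) \<in> S}" "i < n"
        "j < n" "S \<in> sets borel" by blast
    have "f -` Y \<inter> space M = (\<lambda>x. f x $$ (i, j)) -` S \<inter> space M" using c Y by auto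
    also have "\<dots> \<in> sets M" using e Y by (auto intro: measurable_sets)
    finally show "f -` Y \<inter> space M \<in> sets M" .
  qed (use c in auto)
qed

lemma mat_borel_entry:
  assumes "f \<in> measurable M (mat_borel n)" "i < n" "j < n"
  shows "(\<lambda>x. f x $$ (i, j)) \<in> borel_measurable M"
  using assms by (simp add: mat_borel_measurable_iff)

lemma mat_borel_mult:
  fixes f g :: "'w \<Rightarrow> 'p::prime_card padic_int mat"
  assumes f: "f \<in> measurable M (mat_borel n)" and g: "g \<in> measurable M (mat_borel n)"
  shows "(\<lambda>x. f x * g x) \<in> measurable M (mat_borel n)"
  unfolding mat_borel_measurable_iff
proof (intro conjI ballI allI impI)
  fix x assume "x \<in> space M"
  then show "f x * g x \<in> carrier_mat n n"
    using measurable_space[OF f] measurable_space[OF g] by (intro mult_carrier_mat[of _ n n]) auto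
next
  fix i j assume ij: "i < n" "j < n"
  have "(\<lambda>x. \<Sum>s<n. f x $$ (i, s) * g x $$ (s, j)) \<in> borel_measurable M"
    using ij by (intro padic_measurable_sum padic_measurable_mult mat_borel_entry[OF f] mat_borel_entry[OF g]) auto
  then show "(\<lambda>x. (f x * g x) $$ (i, j)) \<in> borel_measurable M"
    using measurable_space[OF f] measurable_space[OF g] ij
    by (subst measurable_cong[where g = "\<lambda>x. \<Sum>s<n. f x $$ (i, s) * g x $$ (s, j)"]) (auto intro!: mult_entry)
qed

lemma depth_ge_sets:
  fixes f :: "'w \<Rightarrow> 'p::prime_card padic_int mat"
  assumes f: "f \<in> measurable M (mat_borel n)" and i: "i < n"
  shows "{x \<in> space M. depth_ge n i m (f x)} \<in> sets M"
proof -
  have 1: "{x \<in> space M. (\<pi> :: 'p padic_int) ^ k dvd h x} \<in> sets M" if "h \<in> borel_measurable M"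
      for k and h :: "'w \<Rightarrow> 'p padic_int"
  proof -
    have "{x \<in> space M. \<pi> ^ k dvd h x} = h -` {y. padic_res y k = 0} \<inter> space M"
      by (auto simp: pi_power_dvd_iff)
    also have "\<dots> \<in> sets M" by (rule measurable_sets[OF that]) (intro borel_open padic_ball_open)
    finally show ?thesis .
  qed
  have h: "(\<lambda>x. \<pi> ^ e * f x $$ (r, i) - (\<Sum>l<i. of_int (c ! l) * f x $$ (r, l))) \<in> borel_measurable M"
    if "r < n" for e r and c :: "int list"
    using i that by (intro padic_measurable_diff padic_measurable_sum padic_measurable_mult mat_borel_entry[OF f] borel_measurable_const) auto
  have "{x \<in> space M. depth_ge n i m (f x)} = (\<Union>e. \<Union>c. {x \<in> space M. \<forall>r\<in>{..<n}.
      \<pi> ^ (m + e) dvd \<pi> ^ e * f x $$ (r, i) - (\<Sum>l<i. of_int (c ! l) * f x $$ (r, l))})"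
    unfolding depth_ge_def by auto
  also have "\<dots> \<in> sets M"
    by (intro sets.countable_UN'' sets.sets_Collect_finite_All 1 h) auto
  finally show ?thesis .
qed

lemma depth_measurable:
  fixes f :: "'w \<Rightarrow> 'p::prime_card padic_int mat"
  assumes f: "f \<in> measurable M (mat_borel n)" and i: "i < n"
  shows "(\<lambda>x. depth n i (f x)) \<in> measurable M (count_space UNIV)"
  unfolding depth_def
proof (rule measurable_Least)
  fix m
  have "{x \<in> space M. \<not> depth_ge n i (Suc m) (f x)} \<in> sets M"
    by (rule sets.sets_Collect_neg[OF depth_ge_sets[OF f i]])
  then show "Measurable.pred M (\<lambda>x. \<not> depth_ge n i (Suc m) (f x))" by (simp add: pred_def)
qed

lemma regular_below_sets:
  fixes f :: "'w \<Rightarrow> 'p::prime_card padic_int mat"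
  assumes f: "f \<in> measurable M (mat_borel n)" and i: "i \<le> n"
  shows "{x \<in> space M. regular_below n i (f x)} \<in> sets M"
proof -
  have "{x \<in> space M. regular_below n i (f x)} = {x \<in> space M. \<forall>l\<in>{..<i}. \<exists>m. \<not> depth_ge n l m (f x)}"
    by (auto simp: regular_below_def)
  also have "\<dots> \<in> sets M"
    using f i by (intro sets.sets_Collect_finite_All sets.sets_Collect_countable_Ex sets.sets_Collect_neg depth_ge_sets) auto
  finally show ?thesis .
qed

section \<open>Counting modulo p and averaging\<close>

text \<open>Vectors of residues modulo \<open>p\<close>, used to average over translations.\<close>

definition digits :: "'p::prime_card itself \<Rightarrow> nat \<Rightarrow> (nat \<Rightarrow> nat) set" where
  "digits _ N = {..<N} \<rightarrow>\<^sub>E {..<CARD('p)}"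

lemma finite_digits: "finite (digits TYPE('p::prime_card) N)"
  unfolding digits_def by (intro finite_PiE) auto

lemma card_digits: "card (digits TYPE('p::prime_card) N) = CARD('p) ^ N"
  unfolding digits_def by (simp add: card_PiE)

text \<open>Modulo \<open>p\<close> the matrix \<open>H\<close> permutes the vectors of residues. The conditions fix the coordinates in \<open>R\<close> of
  the image and leave the other ones free.\<close>

lemma count_solutions_mod_p:
  fixes H :: "'p::prime_card padic_int mat" and y :: "nat \<Rightarrow> 'p padic_int"
  assumes H: "H \<in> GL N" and R: "R \<subseteq> {..<N}"
  shows "card {u \<in> digits TYPE('p) N. \<forall>r\<in>R. \<pi> dvd y r + (\<Sum>s<N. H $$ (r, s) * of_nat (u s))}
      = CARD('p) ^ (N - card R)"
proof -
  define D where "D = digits TYPE('p) N"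
  have Dlt: "u s < CARD('p)" if "u \<in> D" "s < N" for u s
    using that unfolding D_def digits_def by auto
  define img where "img u r = (\<Sum>s<N. H $$ (r, s) * of_nat (u s))" for u r
  define \<phi> where "\<phi> u = (\<lambda>r\<in>{..<N}. nat (padic_res (img u r) 1))" for u
  have res: "0 \<le> padic_res x 1 \<and> padic_res x 1 < int CARD('p)" for x :: "'p padic_int"
    using padic_res_range[of x 1] by simp
  have resdvd: "padic_res x 1 = padic_res x' 1 \<longleftrightarrow> \<pi> dvd x - x'" for x x' :: "'p padic_int"
  proof -
    have "\<pi> dvd x - x' \<longleftrightarrow> int CARD('p) dvd padic_res x 1 - padic_res x' 1"
      by (simp add: pi_dvd_iff padic_res_diff dvd_eq_mod_eq_0)
    also have "\<dots> \<longleftrightarrow> padic_res x 1 mod int CARD('p) = padic_res x' 1 mod int CARD('p)"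
      by (rule mod_eq_dvd_iff[symmetric])
    also have "\<dots> \<longleftrightarrow> padic_res x 1 = padic_res x' 1"
      using res[of x] res[of x'] by (simp only: mod_pos_pos_trivial)
    finally show ?thesis by simp
  qed
  have \<phi>D: "\<phi> u \<in> D" for u
    unfolding D_def digits_def \<phi>_def using res by (auto simp: nat_less_iff)
  have fin: "finite D" unfolding D_def by (rule finite_digits)
  obtain H' where H': "H' \<in> GL N" "H' * H = 1\<^sub>m N" using GL_obtain_inverse[OF H] by metis
  have inv: "(\<Sum>r<N. H' $$ (t, r) * img u r) = of_nat (u t)" if t: "t < N" for u t
  proof -
    have "(\<Sum>r<N. H' $$ (t, r) * img u r) = (\<Sum>r<N. \<Sum>s<N. H' $$ (t, r) * H $$ (r, s) * of_nat (u s))"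
      by (simp add: img_def sum_distrib_left mult.assoc)
    also have "\<dots> = (\<Sum>s<N. \<Sum>r<N. H' $$ (t, r) * H $$ (r, s) * of_nat (u s))" by (rule sum.swap)
    also have "\<dots> = (\<Sum>s<N. (H' * H) $$ (t, s) * of_nat (u s))"
    proof (rule sum.cong)
      fix s assume "s \<in> {..<N}"
      then have "(H' * H) $$ (t, s) = (\<Sum>r<N. H' $$ (t, r) * H $$ (r, s))"
        using H H' t by (intro mult_entry[of _ N N _ N]) auto
      then show "(\<Sum>r<N. H' $$ (t, r) * H $$ (r, s) * of_nat (u s)) = (H' * H) $$ (t, s) * of_nat (u s)"
        by (simp add: sum_distrib_right)
    qed simp
    also have "\<dots> = (\<Sum>s<N. (if t = s then 1 else 0) * of_nat (u s))"
      by (rule sum.cong) (use t in \<open>simp_all add: H'(2)\<close>)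
    also have "\<dots> = of_nat (u t)" using t by (simp only: sum_delta_mult)
    finally show ?thesis .
  qed
  have inj: "inj_on \<phi> D"
  proof (rule inj_onI)
    fix u v assume u: "u \<in> D" and v: "v \<in> D" and e: "\<phi> u = \<phi> v"
    have "\<pi> dvd img u r - img v r" if "r < N" for r
    proof -
      have "nat (padic_res (img u r) 1) = nat (padic_res (img v r) 1)"
        using fun_cong[OF e, of r] that by (simp add: \<phi>_def)
      then show ?thesis using res by (simp add: resdvd[symmetric] nat_eq_iff)
    qed
    then have dvs: "\<pi> dvd (\<Sum>r<N. H' $$ (t, r) * (img u r - img v r))" for t by (auto intro!: dvd_sum)
    have "\<pi> dvd (of_nat (u t) - of_nat (v t) :: 'p padic_int)" if "t < N" for t
      using dvs[of t] inv[OF that, of u] inv[OF that, of v] by (simp add: right_diff_distrib sum_subtractf)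
    then have "u t = v t" if "t < N" for t
      using pi_dvd_of_nat_diff[where 'p='p] Dlt[OF u that] Dlt[OF v that] that by blast
    then show "u = v" using u v unfolding D_def digits_def
      by (intro PiE_ext) auto
  qed
  then have bij: "bij_betw \<phi> D D"
    unfolding bij_betw_def using endo_inj_surj[OF fin, of \<phi>] \<phi>D by auto
  \<comment> \<open>The residue which condition \<open>r\<close> prescribes for coordinate \<open>r\<close> of the image.\<close>
  define tg where "tg r = nat (padic_res (- y r) 1)" for r
  define Z where "Z = {z \<in> D. \<forall>r\<in>R. z r = tg r}"
  have "{u \<in> D. \<forall>r\<in>R. \<pi> dvd y r + img u r} = {u \<in> D. \<phi> u \<in> Z}"
  proof -
    have "\<pi> dvd y r + img u r \<longleftrightarrow> \<phi> u r = tg r" if "r \<in> R" for u r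
    proof -
      have "\<phi> u r = tg r \<longleftrightarrow> padic_res (img u r) 1 = padic_res (- y r) 1"
        using that R res by (auto simp: \<phi>_def tg_def nat_eq_iff)
      also have "\<dots> \<longleftrightarrow> \<pi> dvd y r + img u r"
        unfolding resdvd by (simp add: add.commute)
      finally show ?thesis by simp
    qed
    then show ?thesis using \<phi>D by (auto simp: Z_def)
  qed
  moreover have "bij_betw \<phi> {u \<in> D. \<phi> u \<in> Z} Z"
    using bij unfolding bij_betw_def Z_def by (auto simp: inj_on_def)
  ultimately have "card {u \<in> D. \<forall>r\<in>R. \<pi> dvd y r + img u r} = card Z" by (simp add: bij_betw_same_card)
  also have "Z = (\<Pi>\<^sub>E r\<in>{..<N}. if r \<in> R then {tg r} else {..<CARD('p)})"
  proof -
    have "tg r < CARD('p)" for r unfolding tg_def using res by (auto simp: nat_less_iff)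
    then have "z \<in> Z \<longleftrightarrow> z \<in> (\<Pi>\<^sub>E r\<in>{..<N}. if r \<in> R then {tg r} else {..<CARD('p)})" for z
    proof -
      assume tg: "\<And>r. tg r < CARD('p)"
      have "(\<forall>i\<in>{..<N}. z i \<in> {..<CARD('p)}) \<and> (\<forall>r\<in>R. z r = tg r) \<longleftrightarrow>
          (\<forall>i\<in>{..<N}. z i \<in> (if i \<in> R then {tg i} else {..<CARD('p)}))"
        using R tg by auto
      then show ?thesis unfolding Z_def D_def digits_def PiE_iff mem_Collect_eq by blast
    qed
    then show ?thesis by blast
  qed
  also have "card \<dots> = (\<Prod>r<N. if r \<in> R then 1 else CARD('p))"
    by (subst card_PiE) (auto intro!: prod.cong)
  also have "\<dots> = CARD('p) ^ card ({..<N} - R)"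
    by (subst prod.If_cases) (auto simp: Diff_eq)
  also have "card ({..<N} - R) = N - card R" using R by (simp add: card_Diff_subset finite_subset)
  finally show ?thesis by (simp add: D_def img_def)
qed

text \<open>Fubini for counting measure: each \<open>\<tau> c\<close> preserves \<open>\<mu>\<close>, so that the average over \<open>c\<close> of the
  probability that \<open>\<tau> c x\<close> lies in \<open>E\<close> is the probability of \<open>E\<close>. This replaces conditioning
  on the columns which \<open>\<tau> c\<close> leaves unchanged.\<close>

lemma averaging_count:
  assumes "prob_space \<mu>" and C: "finite C" and E: "E \<in> sets \<mu>" "E' \<in> sets \<mu>"
    and inv: "\<And>c. c \<in> C \<Longrightarrow> \<tau> c \<in> measurable \<mu> \<mu>" "\<And>c. c \<in> C \<Longrightarrow> distr \<mu> \<mu> (\<tau> c) = \<mu>"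
    and count: "AE x in \<mu>. card {c \<in> C. \<tau> c x \<in> E} = (if x \<in> E' then \<kappa> else 0)"
  shows "real (card C) * measure \<mu> E = real \<kappa> * measure \<mu> E'"
proof -
  interpret prob_space \<mu> by fact
  have m: "measure \<mu> E = (\<integral>x. indicator E (\<tau> c x) \<partial>\<mu>)" if "c \<in> C" for c
  proof -
    have "measure \<mu> E = (\<integral>x. indicator E x \<partial>\<mu>)" using E sets.sets_into_space[OF E(1)] by (simp add: Int_absorb2)
    also have "\<dots> = (\<integral>x. indicator E x \<partial>(distr \<mu> \<mu> (\<tau> c)))" by (simp only: inv(2)[OF that])
    also have "\<dots> = (\<integral>x. indicator E (\<tau> c x) \<partial>\<mu>)"
      by (rule integral_distr[OF inv(1)[OF that]]) (use E in simp)
    finally show ?thesis .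
  qed
  have int: "integrable \<mu> (\<lambda>x. indicator E (\<tau> c x) :: real)" if "c \<in> C" for c
    using measurable_compose[OF inv(1)[OF that] borel_measurable_indicator[OF E(1), where 'b = real]]
    by (intro integrable_const_bound[where B=1]) (auto simp: indicator_def)
  have "real (card C) * measure \<mu> E = (\<Sum>c\<in>C. (\<integral>x. indicator E (\<tau> c x) \<partial>\<mu>))"
    using m by (simp flip: sum_constant)
  also have "\<dots> = (\<integral>x. (\<Sum>c\<in>C. indicator E (\<tau> c x)) \<partial>\<mu>)"
    by (rule Bochner_Integration.integral_sum[symmetric]) (use int in auto)
  also have "\<dots> = (\<integral>x. real \<kappa> * indicator E' x \<partial>\<mu>)"
  proof (rule integral_cong_AE)
    show "AE x in \<mu>. (\<Sum>c\<in>C. indicator E (\<tau> c x)) = real \<kappa> * indicator E' x"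
      using count
    proof eventually_elim
      case (elim x)
      have "(\<Sum>c\<in>C. indicator E (\<tau> c x) :: real) = real (card {c \<in> C. \<tau> c x \<in> E})"
        using C by (simp add: indicator_def sum.If_cases Int_def conj_commute)
      then show ?case using elim by (simp add: indicator_def)
    qed
  qed (use E int in \<open>auto intro: borel_measurable_integrable\<close>)
  also have "\<dots> = real \<kappa> * measure \<mu> E'" using E(2) sets.sets_into_space[OF E(2)] by (simp add: Int_absorb2)
  finally show ?thesis .
qed

section \<open>The law of a depth under translation invariance\<close>

text \<open>When a column already satisfies conditions modulo \<open>p\<^sup>m\<close>, adding \<open>p\<^sup>m H u\<close> gives conditions on
  the residue vector \<open>u\<close> modulo \<open>p\<close>; otherwise no such change can help.\<close>

lemma count_lifts:
  fixes H :: "'p::prime_card padic_int mat" and z :: "nat \<Rightarrow> 'p padic_int"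
  assumes H: "H \<in> GL N" and R: "R \<subseteq> {..<N}"
  shows "card {u \<in> digits TYPE('p) N. \<forall>r\<in>R. \<pi> ^ Suc m dvd z r + \<pi> ^ m * (\<Sum>s<N. H $$ (r, s) * of_nat (u s))}
    = (if \<forall>r\<in>R. \<pi> ^ m dvd z r then CARD('p) ^ (N - card R) else 0)"
proof (cases "\<forall>r\<in>R. \<pi> ^ m dvd z r")
  case True
  then have "\<forall>r. \<exists>y. r \<in> R \<longrightarrow> z r = \<pi> ^ m * y" by (auto simp: dvd_def)
  then obtain y where y: "\<And>r. r \<in> R \<Longrightarrow> z r = \<pi> ^ m * y r" unfolding choice_iff by blast
  have "\<pi> ^ Suc m dvd z r + \<pi> ^ m * t \<longleftrightarrow> \<pi> dvd y r + t" if "r \<in> R" for r t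
  proof -
    have "z r + \<pi> ^ m * t = \<pi> ^ m * (y r + t)" by (simp only: y[OF that] distrib_left)
    moreover have "\<pi> ^ (1 + m) dvd \<pi> ^ m * (y r + t) \<longleftrightarrow> \<pi> ^ 1 dvd y r + t" by (rule pi_power_mult_dvd_cancel)
    ultimately show ?thesis by simp
  qed
  then have "{u \<in> digits TYPE('p) N. \<forall>r\<in>R. \<pi> ^ Suc m dvd z r + \<pi> ^ m * (\<Sum>s<N. H $$ (r, s) * of_nat (u s))}
    = {u \<in> digits TYPE('p) N. \<forall>r\<in>R. \<pi> dvd y r + (\<Sum>s<N. H $$ (r, s) * of_nat (u s))}" by auto
  then show ?thesis using True count_solutions_mod_p[OF H R, of y] by simp
next
  case False
  then obtain r where r: "r \<in> R" "\<not> \<pi> ^ m dvd z r" by blast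
  have "\<not> \<pi> ^ Suc m dvd z r + \<pi> ^ m * t" for t
  proof
    assume "\<pi> ^ Suc m dvd z r + \<pi> ^ m * t"
    moreover have "(\<pi> :: 'p padic_int) ^ m dvd \<pi> ^ Suc m" by (rule le_imp_power_dvd) simp
    ultimately have "\<pi> ^ m dvd z r + \<pi> ^ m * t" by (rule dvd_trans[rotated])
    then have "\<pi> ^ m dvd z r" using dvd_add_left_iff[of "\<pi> ^ m" "\<pi> ^ m * t" "z r"] by simp
    then show False using r by simp
  qed
  then have "{u \<in> digits TYPE('p) N. \<forall>r\<in>R. \<pi> ^ Suc m dvd z r + \<pi> ^ m * (\<Sum>s<N. H $$ (r, s) * of_nat (u s))} = {}"
    using r(1) by blast
  then show ?thesis by (simp only: if_not_P[OF False] card.empty)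
qed

text \<open>A frame for the columns before \<open>i\<close> serves equally well after column \<open>i\<close> has been replaced.\<close>

lemma depth_ge_new_column:
  fixes X X' :: "'p::prime_card padic_int mat"
  assumes X: "X \<in> carrier_mat n n" "X' \<in> carrier_mat n n" and i: "i < n" and U: "U \<in> GL n"
    and tri: "\<And>l r. l < i \<Longrightarrow> l < r \<Longrightarrow> r < n \<Longrightarrow> (U * X) $$ (r, l) = 0"
    and diag: "\<And>l. l < i \<Longrightarrow> (U * X) $$ (l, l) \<noteq> 0"
    and same: "\<And>l r. l < i \<Longrightarrow> r < n \<Longrightarrow> X' $$ (r, l) = X $$ (r, l)"
    and col: "\<And>r. r < n \<Longrightarrow> X' $$ (r, i) = w r"
  shows "depth_ge n i m X' \<longleftrightarrow> (\<forall>r\<in>{i..<n}. \<pi> ^ m dvd (\<Sum>s<n. U $$ (r, s) * w s))"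
proof -
  have Uc: "U \<in> carrier_mat n n" using U by simp
  have e: "(U * X') $$ (r, l) = (U * X) $$ (r, l)" if "l < i" "r < n" for r l
    using that i same Uc X by (simp add: mult_entry[of _ n n _ n] del: index_mult_mat)
  have "depth_ge n i m X' \<longleftrightarrow> (\<forall>r<n. i \<le> r \<longrightarrow> \<pi> ^ m dvd (U * X') $$ (r, i))"
    by (rule depth_ge_iff[OF X(2) i U]) (use tri diag e i in auto)
  also have "\<dots> \<longleftrightarrow> (\<forall>r\<in>{i..<n}. \<pi> ^ m dvd (\<Sum>s<n. U $$ (r, s) * w s))"
    using i Uc X col by (auto simp: mult_entry[of _ n n _ n] simp del: index_mult_mat)
  finally show ?thesis .
qed

lemma regular_frame:
  fixes X :: "'p::prime_card padic_int mat"
  assumes X: "X \<in> carrier_mat n n" and i: "i \<le> n" and reg: "regular_below n i X"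
  obtains U where "U \<in> GL n" "\<And>l r. l < r \<Longrightarrow> r < n \<Longrightarrow> (U * X) $$ (r, l) = 0"
    "\<And>l. l < i \<Longrightarrow> (U * X) $$ (l, l) \<noteq> 0"
proof -
  obtain U where U: "U \<in> GL n" "\<forall>l<n. \<forall>r<n. l < r \<longrightarrow> (U * X) $$ (r, l) = 0"
    using triangularize[OF X] by blast
  then have t: "\<And>l r. l < r \<Longrightarrow> r < n \<Longrightarrow> (U * X) $$ (r, l) = 0" by auto
  have "(U * X) $$ (l, l) \<noteq> 0" if "l < i" for l
    by (rule regular_imp_diag_nonzero[OF X i U(1) t reg that])
  then show thesis using that[OF U(1) t] by blast
qed

text \<open>The probability that the depth of column \<open>i\<close> reaches \<open>m\<close> tends to \<open>0\<close>, so that almost surely it is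
  finite.\<close>

lemma AE_regular_Suc:
  fixes f :: "'w \<Rightarrow> 'p::prime_card padic_int mat"
  assumes "prob_space M" and f: "f \<in> measurable M (mat_borel n)" and i: "i < n"
    and reg: "AE x in M. regular_below n i (f x)"
    and meas: "\<And>m. m \<ge> 1 \<Longrightarrow> measure M {x \<in> space M. depth_ge n i m (f x)} \<le> x ^ m" and x: "0 \<le> x" "x < 1"
  shows "AE x in M. regular_below n (Suc i) (f x)"
proof -
  interpret prob_space M by fact
  define Z where "Z = {x \<in> space M. \<forall>m. depth_ge n i m (f x)}"
  have Z: "Z \<in> sets M" unfolding Z_def
    by (intro sets.sets_Collect_countable_All depth_ge_sets[OF f i])
  have le: "measure M Z \<le> x ^ m" if "m \<ge> 1" for m
  proof -
    have "measure M Z \<le> measure M {x \<in> space M. depth_ge n i m (f x)}"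
      by (rule finite_measure_mono[OF _ depth_ge_sets[OF f i]]) (auto simp: Z_def)
    then show ?thesis using meas[OF that] by simp
  qed
  have "measure M Z \<le> 0"
  proof (rule LIMSEQ_le_const)
    show "(\<lambda>m. x ^ m) \<longlonglongrightarrow> 0" using x by (rule LIMSEQ_realpow_zero)
    show "\<exists>N. \<forall>n\<ge>N. measure M Z \<le> x ^ n" using le by blast
  qed
  then have "prob Z = 0" using measure_nonneg[of M Z] by linarith
  then have "Z \<in> null_sets M" using Z by (simp add: null_sets_def emeasure_eq_measure)
  then have "AE x in M. x \<notin> Z" by (rule AE_not_in)
  then show ?thesis using reg AE_space
  proof eventually_elim
    case (elim x)
    then show ?case unfolding regular_below_def Z_def by (auto simp: less_Suc_eq)
  qed
qed

text \<open>The law of the depth of column \<open>i\<close> is computed for matrices whose earlier columns are independent.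
  This condition and the laws are therefore established together, column by column.\<close>

lemma AE_regular_below:
  fixes f :: "'w \<Rightarrow> 'p::prime_card padic_int mat"
  assumes prob: "prob_space M" and f: "f \<in> measurable M (mat_borel n)"
    and law: "\<And>i m. i < n \<Longrightarrow> AE x in M. regular_below n i (f x) \<Longrightarrow> m \<ge> 1 \<Longrightarrow>
      measure M {x \<in> space M. depth_ge n i m (f x)} \<le> ((1 / real CARD('p)) ^ (n - i)) ^ m"
    and i: "i \<le> n"
  shows "AE x in M. regular_below n i (f x)"
  using i
proof (induction i)
  case 0 show ?case by (simp add: regular_below_def)
next
  case (Suc i)
  then have i: "i < n" and reg: "AE x in M. regular_below n i (f x)" by auto
  show ?case
  proof (rule AE_regular_Suc[OF prob f i reg])
    show "(1 / real CARD('p)) ^ (n - i) < 1"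
      using prime_card_gt_1[where 'p='p] i by (intro power_less_one_iff[THEN iffD2]) auto
  qed (use law[OF i reg] in auto)
qed

text \<open>Translations by \<open>p\<^sup>m u w\<^sup>T\<close>, where \<open>w\<^sup>T\<close> is row \<open>i\<close> of the inverse of \<open>V\<close>, add \<open>p\<^sup>m u\<close> to column \<open>i\<close> of
  \<open>B V\<close> and leave the other columns alone. For given earlier columns, a fraction \<open>p\<^bsup>-(n-i)\<^esup>\<close> of
  the vectors \<open>u\<close> modulo \<open>p\<close> raises the depth from \<open>m\<close> to \<open>m + 1\<close>.\<close>

lemma depth_law_translation_invariant:
  fixes V :: "'p::prime_card padic_int mat"
  assumes prob: "prob_space \<nu>" and sets: "sets \<nu> = sets (mat_borel n)"
    and inv: "\<And>C. C \<in> carrier_mat n n \<Longrightarrow> distr \<nu> (mat_borel n) (\<lambda>B. B + C) = \<nu>"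
    and V: "V \<in> GL n" and i: "i < n"
  shows "measure \<nu> {B \<in> space \<nu>. depth_ge n i m (B * V)} = ((1 / real CARD('p)) ^ (n - i)) ^ m"
proof -
  interpret prob_space \<nu> by fact
  have space: "space \<nu> = carrier_mat n n" using sets_eq_imp_space_eq[OF sets] by simp
  have Vc: "V \<in> carrier_mat n n" using V by simp
  obtain W where W: "W \<in> GL n" "W * V = 1\<^sub>m n" using GL_obtain_inverse[OF V] by metis
  have Wc: "W \<in> carrier_mat n n" using W by simp
  have idm: "(\<lambda>B. B) \<in> measurable \<nu> (mat_borel n)" using sets by (simp add: measurable_ident_sets)
  have fm: "(\<lambda>B. B * V) \<in> measurable \<nu> (mat_borel n)"
    by (rule mat_borel_mult[OF idm]) (simp add: Vc)
  have p1: "real CARD('p) > 1" using prime_card_int[where 'a='p] prime_gt_1_int[of "int CARD('p)"] by simp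
  have rec: "measure \<nu> {B \<in> space \<nu>. depth_ge n i (Suc m) (B * V)}
      = (1 / real CARD('p)) ^ (n - i) * measure \<nu> {B \<in> space \<nu>. depth_ge n i m (B * V)}"
    if i: "i < n" and reg: "AE B in \<nu>. regular_below n i (B * V)" for i m
  proof -
    \<comment> \<open>The translation that adds \<open>p\<^sup>m u\<close> to column \<open>i\<close> of \<open>B V\<close>.\<close>
    define Cu where "Cu u = mat n n (\<lambda>(r, c). \<pi> ^ m * of_nat (u r) * W $$ (i, c))" for u :: "nat \<Rightarrow> nat"
    have Cu: "Cu u \<in> carrier_mat n n" for u by (simp add: Cu_def)
    have CuV: "(Cu u * V) $$ (r, c) = \<pi> ^ m * of_nat (u r) * (if i = c then 1 else 0)" if "r < n" "c < n"
        for u r c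
    proof -
      have "(Cu u * V) $$ (r, c) = (\<Sum>s<n. \<pi> ^ m * of_nat (u r) * (W $$ (i, s) * V $$ (s, c)))"
        using that Vc by (subst mult_entry[OF Cu Vc that]) (simp add: Cu_def mult.assoc)
      also have "\<dots> = \<pi> ^ m * of_nat (u r) * (W * V) $$ (i, c)"
        using that i Wc Vc by (simp add: mult_entry[of _ n n _ n] sum_distrib_left del: index_mult_mat)
      finally show ?thesis using that i by (simp add: W(2))
    qed
    have "real (card (digits TYPE('p) n)) * measure \<nu> {B \<in> space \<nu>. depth_ge n i (Suc m) (B * V)}
       = real (CARD('p) ^ (n - card {i..<n})) * measure \<nu> {B \<in> space \<nu>. depth_ge n i m (B * V)}"
    proof (rule averaging_count[OF prob finite_digits depth_ge_sets[OF fm i] depth_ge_sets[OF fm i], where \<tau> = "\<lambda>u B. B + Cu u"])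
      fix u :: "nat \<Rightarrow> nat"
      have "(\<lambda>B. B + Cu u) \<in> measurable \<nu> (mat_borel n)"
        unfolding mat_borel_measurable_iff
      proof (intro conjI ballI allI impI)
        fix r c assume rc: "r < n" "c < n"
        have "(\<lambda>B. B $$ (r, c) + Cu u $$ (r, c)) \<in> borel_measurable \<nu>"
          by (intro padic_measurable_add mat_borel_entry[OF idm] rc) simp
        then show "(\<lambda>B. (B + Cu u) $$ (r, c)) \<in> borel_measurable \<nu>"
          using rc carrier_matD[OF Cu[of u]] by (subst measurable_cong[where g =
              "\<lambda>B. B $$ (r, c) + Cu u $$ (r, c)"]) (auto simp: space)
      qed (use Cu space in auto)
      then show "(\<lambda>B. B + Cu u) \<in> measurable \<nu> \<nu>" using sets by (simp cong: measurable_cong_sets)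
      have "distr \<nu> \<nu> (\<lambda>B. B + Cu u) = distr \<nu> (mat_borel n) (\<lambda>B. B + Cu u)"
          by (rule distr_cong) (use sets in auto)
      then show "distr \<nu> \<nu> (\<lambda>B. B + Cu u) = \<nu>" using inv[OF Cu] by simp
    next
      show "AE B in \<nu>. card {u \<in> digits TYPE('p) n. B + Cu u \<in> {B \<in> space \<nu>. depth_ge n i (Suc m) (B * V)}}
         = (if B \<in> {B \<in> space \<nu>. depth_ge n i m (B * V)} then CARD('p) ^ (n - card {i..<n}) else 0)"
        using reg AE_space
      proof eventually_elim
        case (elim B)
        then have B: "B \<in> carrier_mat n n" by (simp add: space)
        define X where "X = B * V"
        have X: "X \<in> carrier_mat n n" unfolding X_def using B Vc by (rule mult_carrier_mat)
        obtain U where U: "U \<in> GL n" "\<And>l r. l < r \<Longrightarrow> r < n \<Longrightarrow> (U * X) $$ (r, l) = 0"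
            "\<And>l. l < i \<Longrightarrow> (U * X) $$ (l, l) \<noteq> 0"
          using regular_frame[OF X less_imp_le[OF i]] elim(1) unfolding X_def by blast
        have Uc: "U \<in> carrier_mat n n" using U(1) by simp
        define z where "z r = (U * X) $$ (r, i)" for r
        have z: "z r = (\<Sum>s<n. U $$ (r, s) * X $$ (s, i))" if "r < n" for r
          unfolding z_def by (rule mult_entry[OF Uc X that i])
        have d0: "depth_ge n i m X \<longleftrightarrow> (\<forall>r\<in>{i..<n}. \<pi> ^ m dvd z r)"
        proof -
          have "depth_ge n i m X \<longleftrightarrow> (\<forall>r\<in>{i..<n}. \<pi> ^ m dvd (\<Sum>s<n. U $$ (r, s) * X $$ (s, i)))"
            by (rule depth_ge_new_column[OF X X i U(1)]) (use U i in auto)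
          then show ?thesis using z by auto
        qed
        have d1: "depth_ge n i (Suc m) ((B + Cu u) * V) \<longleftrightarrow>
           (\<forall>r\<in>{i..<n}. \<pi> ^ Suc m dvd z r + \<pi> ^ m * (\<Sum>s<n. U $$ (r, s) * of_nat (u s)))" for u
        proof -
          have e: "(B + Cu u) * V = X + Cu u * V" unfolding X_def by (rule add_mult_distrib_mat[OF B Cu Vc])
          have CV: "Cu u * V \<in> carrier_mat n n" by (rule mult_carrier_mat[OF Cu Vc])
          have ent: "(X + Cu u * V) $$ (r, c)
              = X $$ (r, c) + \<pi> ^ m * of_nat (u r) * (if i = c then 1 else 0)" if "r < n" "c < n" for r c
            using that carrier_matD[OF CV] CuV[OF that] by (simp only: index_add_mat(1))
          have "depth_ge n i (Suc m) (X + Cu u * V) \<longleftrightarrow>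
            (\<forall>r\<in>{i..<n}. \<pi> ^ Suc m dvd (\<Sum>s<n. U $$ (r, s) * (X $$ (s, i) + \<pi> ^ m * of_nat (u s))))"
            by (rule depth_ge_new_column[OF X _ i U(1)]) (use U i X CV ent in auto)
          also have "\<dots> \<longleftrightarrow> (\<forall>r\<in>{i..<n}. \<pi> ^ Suc m dvd z r + \<pi> ^ m * (\<Sum>s<n. U $$ (r, s) * of_nat (u s)))"
          proof -
            have "(\<Sum>s<n. U $$ (r, s) * (X $$ (s, i) + \<pi> ^ m * of_nat (u s)))
                = z r + \<pi> ^ m * (\<Sum>s<n. U $$ (r, s) * of_nat (u s))"
              if "r < n" for r
              unfolding z[OF that] by (simp add: distrib_left sum.distrib sum_distrib_left mult_ac del: of_nat_power)
            then show ?thesis by auto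
          qed
          finally show ?thesis by (simp only: e)
        qed
        have sp: "B + Cu u \<in> space \<nu>" "B \<in> space \<nu>" for u using B Cu by (auto simp: space)
        have "{i..<n} \<subseteq> {..<n}" by auto
        from count_lifts[OF U(1) this, of m z] show ?case
          using sp d1 d0 unfolding X_def by simp
      qed
    qed
    then have "real CARD('p) ^ n * measure \<nu> {B \<in> space \<nu>. depth_ge n i (Suc m) (B * V)}
       = real CARD('p) ^ i * measure \<nu> {B \<in> space \<nu>. depth_ge n i m (B * V)}" using i by (simp add: card_digits)
    moreover have "real CARD('p) ^ n = real CARD('p) ^ i * real CARD('p) ^ (n - i)" using i
        by (simp flip: power_add)
    ultimately show ?thesis using p1 by (simp add: field_simps)
  qed
  have pow: "measure \<nu> {B \<in> space \<nu>. depth_ge n i m (B * V)} = ((1 / real CARD('p)) ^ (n - i)) ^ m"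
    if i: "i < n" and reg: "AE B in \<nu>. regular_below n i (B * V)" for i m
  proof (induction m)
    case 0 show ?case by (simp add: depth_ge_0 prob_space)
  next
    case (Suc m) then show ?case using rec[OF that, of m] by simp
  qed
  have "AE B in \<nu>. regular_below n i (B * V)" if "i \<le> n" for i
    by (rule AE_regular_below[OF prob fm _ that]) (simp add: pow)
  with i show ?thesis by (intro pow) auto
qed

section \<open>The law of a depth for corners of Haar matrices\<close>

text \<open>The block diagonal matrix with blocks \<open>U\<close> and the identity. It transports operations on the corner to
  the ambient matrix.\<close>

definition ext_mat :: "nat \<Rightarrow> nat \<Rightarrow> 'a::comm_ring_1 mat \<Rightarrow> 'a mat" where
  "ext_mat n N U = mat N N (\<lambda>(r, c). if r < n \<and> c < n then U $$ (r, c) else if r = c then 1 else 0)"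

lemma ext_mat_carrier [simp]: "ext_mat n N U \<in> carrier_mat N N"
  by (simp add: ext_mat_def)

lemma sum_split_ext:
  fixes f :: "nat \<Rightarrow> 'a::comm_monoid_add"
  assumes "n \<le> N" "\<And>s. n \<le> s \<Longrightarrow> s < N \<Longrightarrow> f s = 0"
  shows "(\<Sum>s<N. f s) = (\<Sum>s<n. f s)"
  using assms by (intro sum.mono_neutral_right) auto

lemma ext_mat_mult_entry:
  fixes U :: "'a::comm_ring_1 mat"
  assumes "n \<le> N" "G \<in> carrier_mat N m" "r < n" "c < m"
  shows "(ext_mat n N U * G) $$ (r, c) = (\<Sum>s<n. U $$ (r, s) * G $$ (s, c))"
proof -
  have "(ext_mat n N U * G) $$ (r, c) = (\<Sum>s<N. ext_mat n N U $$ (r, s) * G $$ (s, c))"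
    using assms by (intro mult_entry[of _ N N _ m]) auto
  also have "\<dots> = (\<Sum>s<n. ext_mat n N U $$ (r, s) * G $$ (s, c))"
    using assms by (intro sum_split_ext) (auto simp: ext_mat_def)
  also have "\<dots> = (\<Sum>s<n. U $$ (r, s) * G $$ (s, c))"
    by (rule sum.cong) (use assms in \<open>auto simp: ext_mat_def\<close>)
  finally show ?thesis .
qed

lemma mult_ext_mat_entry:
  fixes V :: "'a::comm_ring_1 mat"
  assumes "n \<le> N" "G \<in> carrier_mat m N" "r < m" "c < n"
  shows "(G * ext_mat n N V) $$ (r, c) = (\<Sum>s<n. G $$ (r, s) * V $$ (s, c))"
proof -
  have "(G * ext_mat n N V) $$ (r, c) = (\<Sum>s<N. G $$ (r, s) * ext_mat n N V $$ (s, c))"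
    using assms by (intro mult_entry[of _ m N _ N]) auto
  also have "\<dots> = (\<Sum>s<n. G $$ (r, s) * ext_mat n N V $$ (s, c))"
    using assms by (intro sum_split_ext) (auto simp: ext_mat_def)
  also have "\<dots> = (\<Sum>s<n. G $$ (r, s) * V $$ (s, c))"
    by (rule sum.cong) (use assms in \<open>auto simp: ext_mat_def\<close>)
  finally show ?thesis .
qed

lemma ext_mat_GL:
  fixes U :: "'a::comm_ring_1 mat"
  assumes "n \<le> N" "U \<in> GL n" shows "ext_mat n N U \<in> GL N"
proof -
  have *: "ext_mat n N A * ext_mat n N B = 1\<^sub>m N" if A: "A \<in> carrier_mat n n" and B:
      "B \<in> carrier_mat n n" and AB: "A * B = 1\<^sub>m n"
    for A B :: "'a mat"
  proof (rule eq_matI)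
    fix r c assume "r < dim_row (1\<^sub>m N :: 'a mat)" "c < dim_col (1\<^sub>m N :: 'a mat)"
    then have rc: "r < N" "c < N" by auto
    show "(ext_mat n N A * ext_mat n N B) $$ (r, c) = (1\<^sub>m N :: 'a mat) $$ (r, c)"
    proof (cases "r < n")
      case True
      have e: "(ext_mat n N A * ext_mat n N B) $$ (r, c) = (\<Sum>s<n. A $$ (r, s) * ext_mat n N B $$ (s, c))"
        using assms(1) True rc by (intro ext_mat_mult_entry) auto
      show ?thesis
      proof (cases "c < n")
        case c: True
        have "(\<Sum>s<n. A $$ (r, s) * ext_mat n N B $$ (s, c)) = (\<Sum>s<n. A $$ (r, s) * B $$ (s, c))"
          by (rule sum.cong) (use c assms rc in \<open>auto simp: ext_mat_def\<close>)
        also have "\<dots> = (A * B) $$ (r, c)" using A B True c by (intro mult_entry[symmetric]) auto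
        finally show ?thesis using e AB True c rc by simp
      next
        case False
        have "(\<Sum>s<n. A $$ (r, s) * ext_mat n N B $$ (s, c)) = 0"
          by (rule sum.neutral) (use False assms rc in \<open>auto simp: ext_mat_def\<close>)
        then show ?thesis using e True False rc by simp
      qed
    next
      case False
      have "(ext_mat n N A * ext_mat n N B) $$ (r, c)
          = (\<Sum>s<N. ext_mat n N A $$ (r, s) * ext_mat n N B $$ (s, c))"
        using rc by (intro mult_entry[of _ N N _ N]) auto
      also have "\<dots> = (\<Sum>s<N. (if r = s then 1 else 0) * ext_mat n N B $$ (s, c))"
        by (rule sum.cong) (use False rc in \<open>auto simp: ext_mat_def\<close>)
      also have "\<dots> = ext_mat n N B $$ (r, c)" using rc(1) by (simp only: sum_delta_mult)
      finally show ?thesis using False rc by (simp add: ext_mat_def)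
    qed
  qed (auto simp: ext_mat_def)
  obtain U' where U': "U' \<in> GL n" "U * U' = 1\<^sub>m n" "U' * U = 1\<^sub>m n" using GL_obtain_inverse[OF assms(2)]
      by metis
  have c: "U \<in> carrier_mat n n" "U' \<in> carrier_mat n n" using assms(2) U'(1) by auto
  show ?thesis by (rule GL_I[OF _ _ *[OF c U'(2)] *[OF c(2,1) U'(3)]]) auto
qed

lemma corner_carrier [simp]: "corner n G \<in> carrier_mat n n"
  by (simp add: corner_def)

lemma corner_mult:
  fixes V :: "'a::comm_ring_1 mat"
  assumes "n \<le> N" "G \<in> carrier_mat N N" "V \<in> carrier_mat n n"
  shows "corner n G * V = corner n (G * ext_mat n N V)"
proof (rule eq_matI)
  fix r c assume "r < dim_row (corner n (G * ext_mat n N V))" "c < dim_col (corner n (G * ext_mat n N V))"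
  then have rc: "r < n" "c < n" by (auto simp: corner_def)
  have "(corner n G * V) $$ (r, c) = (\<Sum>s<n. corner n G $$ (r, s) * V $$ (s, c))"
    using rc assms by (intro mult_entry[of _ n n _ n]) auto
  also have "\<dots> = (\<Sum>s<n. G $$ (r, s) * V $$ (s, c))" using rc by (simp add: corner_def)
  also have "\<dots> = (G * ext_mat n N V) $$ (r, c)"
    using rc assms by (intro mult_ext_mat_entry[symmetric, of n N _ N]) auto
  finally show "(corner n G * V) $$ (r, c) = corner n (G * ext_mat n N V) $$ (r, c)"
    using rc by (simp add: corner_def)
qed (use assms in \<open>auto simp: corner_def\<close>)

text \<open>A vector with a unit entry outside the first \<open>i\<close> places extends the first \<open>i\<close> unit vectors to a
  basis. Up to a transposition the unit is in place \<open>i\<close>, where the identity with one column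
  replaced does the job.\<close>

lemma GL_with_column:
  fixes c :: "nat \<Rightarrow> 'a::comm_ring_1"
  assumes s: "i \<le> s" "s < N" and u: "c s dvd 1"
  shows "\<exists>h\<in>GL N. (\<forall>l<i. \<forall>r<N. h $$ (r, l) = (if r = l then 1 else 0)) \<and> (\<forall>r<N. h $$ (r, i) = c r)"
proof -
  have i: "i < N" using s by simp
  define E where "E = rank1 N (\<lambda>r. c (Transposition.transpose i s r) - (if r = i then 1 else 0)) (\<lambda>r. if i
      = r then 1 else 0)"
  have "1 + (\<Sum>r<N. (if i = r then 1 else 0) * (c (Transposition.transpose i s r) - (if r
      = i then 1 else 0))) = c s"
    using i by (subst sum_delta_mult) auto
  then have E: "E \<in> GL N" unfolding E_def using u by (intro rank1_GL) simp
  have e: "(swap_mat N i s * E) $$ (r, l) = E $$ (Transposition.transpose i s r, l)" if "r < N" "l < N" for r l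
    using that s i E by (intro swap_mat_mult_entry[of _ N N]) auto
  have t: "Transposition.transpose i s r < N" if "r < N" for r
    using that s i by (auto simp: Transposition.transpose_def)
  show ?thesis
  proof (intro bexI[of _ "swap_mat N i s * E"] conjI allI impI)
    show "swap_mat N i s * E \<in> GL N" using E swap_mat_GL[OF i s(2)] by (rule GL_mult[rotated])
    fix r assume r: "r < N"
    show "(swap_mat N i s * E) $$ (r, i) = c r"
      using e[OF r i] t[OF r] i by (auto simp: E_def rank1_def)
  next
    fix l r assume l: "l < i" and r: "r < N"
    have "Transposition.transpose i s r = l \<longleftrightarrow> r = l" using l s by (auto simp: Transposition.transpose_def)
    then show "(swap_mat N i s * E) $$ (r, l) = (if r = l then 1 else 0)"
      using e[OF r, of l] t[OF r] l i by (auto simp: E_def rank1_def)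
  qed
qed

lemma space_GL_borel [simp]: "space (GL_borel N) = GL N"
  unfolding GL_borel_def by (auto simp: space_restrict_space)

lemma GL_borel_entry:
  assumes "r < N" "c < N"
  shows "(\<lambda>G :: 'p::prime_card padic_int mat. G $$ (r, c)) \<in> borel_measurable (GL_borel N)"
  unfolding GL_borel_def
  by (intro measurable_restrict_space1 mat_borel_entry[OF measurable_ident_sets assms]) simp

context
  fixes N n :: nat and \<mu> :: "'p::prime_card padic_int mat measure"
  assumes haar: "haar_GL N \<mu>" and nN: "n < N"
begin

lemma haar_prob: "prob_space \<mu>" and haar_sets: "sets \<mu> = sets (GL_borel N)"
  using haar by (auto simp: haar_GL_def is_haar_prob_def)

lemma haar_space: "space \<mu> = GL N"
  using sets_eq_imp_space_eq[OF haar_sets] by simp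

lemma haar_entry: "r < N \<Longrightarrow> c < N \<Longrightarrow> (\<lambda>G. G $$ (r, c)) \<in> borel_measurable \<mu>"
  using GL_borel_entry haar_sets by (simp cong: measurable_cong_sets)

lemma haar_corner_measurable: "corner n \<in> measurable \<mu> (mat_borel n)"
  unfolding mat_borel_measurable_iff using nN haar_entry by (auto simp: corner_def)

lemma haar_ident_measurable: "(\<lambda>G. G) \<in> measurable \<mu> (mat_borel N)"
  unfolding mat_borel_measurable_iff using haar_entry by (auto simp: haar_space)

lemma haar_right_mult:
  assumes h: "h \<in> GL N"
  shows "(\<lambda>G. G * h) \<in> measurable \<mu> \<mu>" "distr \<mu> \<mu> (\<lambda>G. G * h) = \<mu>"
proof -
  have "(\<lambda>G. G * h) \<in> measurable \<mu> (mat_borel N)"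
    by (rule mat_borel_mult[OF haar_ident_measurable]) (use h in simp)
  then have "(\<lambda>G. G * h) \<in> measurable \<mu> (GL_borel N)"
    unfolding GL_borel_def by (intro measurable_restrict_space2) (use h in \<open>auto simp: haar_space intro: GL_mult\<close>)
  then show "(\<lambda>G. G * h) \<in> measurable \<mu> \<mu>" using haar_sets by (simp cong: measurable_cong_sets)
  have "distr \<mu> \<mu> (\<lambda>G. G * h) = distr \<mu> (GL_borel N) (\<lambda>G. G * h)" by (rule distr_cong) (use haar_sets in auto)
  then show "distr \<mu> \<mu> (\<lambda>G. G * h) = \<mu>" using haar h by (auto simp: haar_GL_def is_haar_prob_def)
qed

text \<open>A frame \<open>U\<close> for the corner extends to \<open>H = diag(U, 1) G\<close>, which is again invertible. If a column \<open>G y\<close> is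
  inserted into the corner, its entries in this frame are those of \<open>H y\<close>, and so they can be
  counted with the invertible matrix \<open>H\<close>.\<close>

lemma haar_frame:
  assumes G: "G \<in> GL N" and i: "i < n" and reg: "regular_below n i (corner n G)"
  shows "\<exists>U\<in>GL n. ext_mat n N U * G \<in> GL N \<and>
    (\<forall>l r. l < i \<longrightarrow> l < r \<longrightarrow> r < n \<longrightarrow> (U * corner n G) $$ (r, l) = 0) \<and>
    (\<forall>l<i. (U * corner n G) $$ (l, l) \<noteq> 0) \<and>
    (\<forall>r c. r < n \<longrightarrow> c < N \<longrightarrow> (\<Sum>s<n. U $$ (r, s) * G $$ (s, c)) = (ext_mat n N U * G) $$ (r, c)) \<and>
    (\<forall>r y. r < n \<longrightarrow> (\<Sum>s<n. U $$ (r, s) * (\<Sum>t<N. G $$ (s, t) * y t))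
        = (\<Sum>t<N. (ext_mat n N U * G) $$ (r, t) * y t)) \<and>
    (\<forall>r l. i \<le> r \<longrightarrow> r < n \<longrightarrow> l < i \<longrightarrow> (ext_mat n N U * G) $$ (r, l) = 0)"
proof -
  obtain U where U: "U \<in> GL n" "\<And>l r. l < r \<Longrightarrow> r < n \<Longrightarrow> (U * corner n G) $$ (r, l) = 0"
      "\<And>l. l < i \<Longrightarrow> (U * corner n G) $$ (l, l) \<noteq> 0"
    using regular_frame[OF corner_carrier less_imp_le[OF i] reg] by blast
  have Uc: "U \<in> carrier_mat n n" using U(1) by simp
  have Gc: "G \<in> carrier_mat N N" using G by simp
  have H: "ext_mat n N U * G \<in> GL N" using nN U(1) G by (intro GL_mult ext_mat_GL) auto
  have e: "(\<Sum>s<n. U $$ (r, s) * G $$ (s, c)) = (ext_mat n N U * G) $$ (r, c)" if "r < n" "c < N" for r c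
    using that nN Gc by (intro ext_mat_mult_entry[symmetric]) auto
  have z: "(ext_mat n N U * G) $$ (r, l) = 0" if "i \<le> r" "r < n" "l < i" for r l
  proof -
    have "(U * corner n G) $$ (r, l) = (\<Sum>s<n. U $$ (r, s) * corner n G $$ (s, l))"
      using that i Uc by (intro mult_entry[of _ n n _ n]) auto
    also have "\<dots> = (\<Sum>s<n. U $$ (r, s) * G $$ (s, l))"
      using that i by (intro sum.cong) (auto simp: corner_def)
    finally show ?thesis using e[of r l] U(2)[of l r] that nN i by simp
  qed
  have e2: "(\<Sum>s<n. U $$ (r, s) * (\<Sum>t<N. G $$ (s, t) * y t)) = (\<Sum>t<N. (ext_mat n N U * G) $$ (r, t) * y t)"
    if r: "r < n" for r y
  proof -
    have "(\<Sum>s<n. U $$ (r, s) * (\<Sum>t<N. G $$ (s, t) * y t)) = (\<Sum>s<n. \<Sum>t<N. U $$ (r, s) * G $$ (s, t) * y t)"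
      by (simp add: sum_distrib_left mult.assoc)
    also have "\<dots> = (\<Sum>t<N. \<Sum>s<n. U $$ (r, s) * G $$ (s, t) * y t)" by (rule sum.swap)
    also have "\<dots> = (\<Sum>t<N. (ext_mat n N U * G) $$ (r, t) * y t)"
      by (rule sum.cong) (use e[OF r] in \<open>simp_all flip: sum_distrib_right\<close>)
    finally show ?thesis .
  qed
  show ?thesis using H U(2,3) e e2 z by (intro bexI[OF _ U(1)] conjI allI impI) auto
qed

text \<open>Right multiplication by \<open>I + p\<^sup>m u e\<^sub>i\<^sup>T\<close> adds \<open>p\<^sup>m G u\<close> to column \<open>i\<close>. For \<open>m \<ge> 1\<close> this matrix is
  invertible for every \<open>u\<close>, and the step from \<open>m\<close> to \<open>m + 1\<close> is as for translation invariant laws.\<close>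

lemma haar_depth_rec:
  assumes i: "i < n" and m: "m \<ge> 1" and reg: "AE G in \<mu>. regular_below n i (corner n G)"
  shows "measure \<mu> {G \<in> space \<mu>. depth_ge n i (Suc m) (corner n G)}
    = (1 / real CARD('p)) ^ (n - i) * measure \<mu> {G \<in> space \<mu>. depth_ge n i m (corner n G)}"
proof -
  define R where "R u = rank1 N (\<lambda>s. \<pi> ^ m * of_nat (u s)) (\<lambda>c. if i = c then 1 else 0 :: 'p padic_int)"
      for u :: "nat \<Rightarrow> nat"
  have R: "R u \<in> GL N" for u
  proof -
    have "\<pi> dvd (\<pi> :: 'p padic_int) ^ m" using m by (intro dvd_power) auto
    then have "\<pi> dvd (\<pi> :: 'p padic_int) ^ m * of_nat (u i)" by (rule dvd_mult2)
    then have "\<not> \<pi> dvd 1 + (\<pi> :: 'p padic_int) ^ m * of_nat (u i)"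
      using pi_not_dvd_1[where 'p='p] dvd_add_left_iff by blast
    then have "1 + (\<pi> :: 'p padic_int) ^ m * of_nat (u i) dvd 1" by (simp only: padic_unit_iff simp_thms)
    then show ?thesis unfolding R_def using i nN by (intro rank1_GL) (subst sum_delta_mult, auto)
  qed
  have "real (card (digits TYPE('p) N)) * measure \<mu> {G \<in> space \<mu>. depth_ge n i (Suc m) (corner n G)}
     = real (CARD('p) ^ (N - card {i..<n})) * measure \<mu> {G \<in> space \<mu>. depth_ge n i m (corner n G)}"
  proof (rule averaging_count[OF haar_prob finite_digits, where \<tau> = "\<lambda>u G. G * R u"])
    show "{G \<in> space \<mu>. depth_ge n i (Suc m) (corner n G)} \<in> sets \<mu>"
        "{G \<in> space \<mu>. depth_ge n i m (corner n G)} \<in> sets \<mu>"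
      by (intro depth_ge_sets haar_corner_measurable i)+
    fix u show "(\<lambda>G. G * R u) \<in> measurable \<mu> \<mu>" "distr \<mu> \<mu> (\<lambda>G. G * R u) = \<mu>"
      using haar_right_mult[OF R] by auto
  next
    show "AE G in \<mu>. card {u \<in> digits TYPE('p) N. G * R u \<in> {G \<in> space \<mu>. depth_ge n i (Suc m) (corner n G)}}
         = (if G \<in> {G \<in> space \<mu>. depth_ge n i m (corner n G)} then CARD('p) ^ (N - card {i..<n}) else 0)"
      using reg AE_space
    proof eventually_elim
      case (elim G)
      then have G: "G \<in> GL N" by (simp add: haar_space)
      have Gc: "G \<in> carrier_mat N N" using G by simp
      obtain U where U: "U \<in> GL n" "ext_mat n N U * G \<in> GL N"
        "\<And>l r. l < i \<Longrightarrow> l < r \<Longrightarrow> r < n \<Longrightarrow> (U * corner n G) $$ (r, l) = 0"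
        "\<And>l. l < i \<Longrightarrow> (U * corner n G) $$ (l, l) \<noteq> 0"
        "\<And>r c. r < n \<Longrightarrow> c < N \<Longrightarrow> (\<Sum>s<n. U $$ (r, s) * G $$ (s, c)) = (ext_mat n N U * G) $$ (r, c)"
        "\<And>r y. r < n \<Longrightarrow> (\<Sum>s<n. U $$ (r, s) * (\<Sum>t<N. G $$ (s, t) * y t))
            = (\<Sum>t<N. (ext_mat n N U * G) $$ (r, t) * y t)"
        "\<And>r l. i \<le> r \<Longrightarrow> r < n \<Longrightarrow> l < i \<Longrightarrow> (ext_mat n N U * G) $$ (r, l) = 0"
        using haar_frame[OF G i elim(1)] by blast
      define H where "H = ext_mat n N U * G"
      define z where "z r = H $$ (r, i)" for r
      have d0: "depth_ge n i m (corner n G) \<longleftrightarrow> (\<forall>r\<in>{i..<n}. \<pi> ^ m dvd z r)"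
      proof -
        have "depth_ge n i m (corner n G) \<longleftrightarrow> (\<forall>r\<in>{i..<n}. \<pi> ^ m dvd (\<Sum>s<n. U $$ (r, s) * G $$ (s, i)))"
          by (rule depth_ge_new_column[OF corner_carrier corner_carrier i U(1,3,4)]) (use i in \<open>auto simp: corner_def\<close>)
        then show ?thesis using U(5)[of _ i] nN i by (simp add: z_def H_def)
      qed
      have d1: "depth_ge n i (Suc m) (corner n (G * R u)) \<longleftrightarrow>
         (\<forall>r\<in>{i..<n}. \<pi> ^ Suc m dvd z r + \<pi> ^ m * (\<Sum>t<N. H $$ (r, t) * of_nat (u t)))" for u
      proof -
        have ent: "corner n (G * R u) $$ (r, c)
            = G $$ (r, c) + (\<Sum>t<N. G $$ (r, t) * (\<pi> ^ m * of_nat (u t))) * (if i = c then 1 else 0)"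
          if "r < n" "c < n" for r c
        proof -
          have "corner n (G * R u) $$ (r, c) = (G * R u) $$ (r, c)" using that by (simp add: corner_def)
          then show ?thesis unfolding R_def using that nN Gc by (subst (asm) mult_rank1_entry[of _ N N]) auto
        qed
        have "depth_ge n i (Suc m) (corner n (G * R u)) \<longleftrightarrow>
          (\<forall>r\<in>{i..<n}. \<pi> ^ Suc m dvd (\<Sum>s<n. U $$ (r, s) * (G $$ (s, i) + (\<Sum>t<N. G $$ (s, t) * (\<pi> ^ m * of_nat (u t))))))"
        proof (rule depth_ge_new_column[OF corner_carrier corner_carrier i U(1,3,4)])
          fix l r assume "l < i" "r < n"
          then show "corner n (G * R u) $$ (r, l) = corner n G $$ (r, l)" using ent[of r l] i
              by (simp add: corner_def)
        next
          fix r assume "r < n"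
          then show "corner n (G * R u) $$ (r, i) = G $$ (r, i) + (\<Sum>t<N. G $$ (r, t) * (\<pi> ^ m * of_nat (u t)))"
            using ent[of r i] i by simp
        qed
        also have "\<dots> \<longleftrightarrow> (\<forall>r\<in>{i..<n}. \<pi> ^ Suc m dvd z r + \<pi> ^ m * (\<Sum>t<N. H $$ (r, t) * of_nat (u t)))"
        proof -
          have "(\<Sum>s<n. U $$ (r, s) * (G $$ (s, i) + (\<Sum>t<N. G $$ (s, t) * (\<pi> ^ m * of_nat (u t)))))
             = z r + \<pi> ^ m * (\<Sum>t<N. H $$ (r, t) * of_nat (u t))" if r: "r < n" for r
          proof -
            have "(\<Sum>s<n. U $$ (r, s) * (\<Sum>t<N. G $$ (s, t) * (\<pi> ^ m * of_nat (u t))))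
                = (\<Sum>t<N. H $$ (r, t) * (\<pi> ^ m * of_nat (u t)))" unfolding H_def by (rule U(6)[OF r])
            also have "\<dots> = \<pi> ^ m * (\<Sum>t<N. H $$ (r, t) * of_nat (u t))"
              by (simp add: sum_distrib_left mult_ac del: of_nat_power)
            finally have "(\<Sum>s<n. U $$ (r, s) * (\<Sum>t<N. G $$ (s, t) * (\<pi> ^ m * of_nat (u t))))
                = \<pi> ^ m * (\<Sum>t<N. H $$ (r, t) * of_nat (u t))" .
            moreover have "(\<Sum>s<n. U $$ (r, s) * G $$ (s, i)) = z r" using U(5)[OF r, of i] i nN
                by (simp add: z_def H_def)
            ultimately show ?thesis by (simp only: distrib_left sum.distrib)
          qed
          then show ?thesis by auto
        qed
        finally show ?thesis .
      qed
      have sp: "G * R u \<in> space \<mu>" "G \<in> space \<mu>" for u using G R by (auto simp: haar_space intro: GL_mult)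
      have "{i..<n} \<subseteq> {..<N}" using nN by auto
      from count_lifts[OF U(2)[folded H_def] this, of m z] show ?case
        using sp d1 d0 by simp
    qed
  qed
  then have e: "real CARD('p) ^ N * measure \<mu> {G \<in> space \<mu>. depth_ge n i (Suc m) (corner n G)}
     = real CARD('p) ^ (N - (n - i)) * measure \<mu> {G \<in> space \<mu>. depth_ge n i m (corner n G)}"
         by (simp add: card_digits)
  have "real CARD('p) ^ N = real CARD('p) ^ (N - (n - i)) * real CARD('p) ^ (n - i)" using nN
      by (simp flip: power_add)
  moreover have "real CARD('p) > 0" by simp
  ultimately show ?thesis using e by (simp add: field_simps)
qed

text \<open>The first step differs, because the first \<open>i + 1\<close> columns of \<open>G\<close> are independent modulo \<open>p\<close>. Column \<open>i\<close> is
  replaced by \<open>G u\<close>, where \<open>u\<close> runs through the residue vectors outside the span \<open>B\<close> of the first \<open>i\<close>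
  unit vectors; there are \<open>p\<^sup>N - p\<^sup>i\<close> of them. Of all residue vectors, \<open>p\<^bsup>N-(n-i)\<^esup>\<close> give a
  column of positive depth, and these include the \<open>p\<^sup>i\<close> vectors of \<open>B\<close>.\<close>

lemma haar_depth_1:
  assumes i: "i < n" and reg: "AE G in \<mu>. regular_below n i (corner n G)"
  shows "(real CARD('p) ^ N - real CARD('p) ^ i) * measure \<mu> {G \<in> space \<mu>. depth_ge n i 1 (corner n G)}
    = real CARD('p) ^ (N - (n - i)) - real CARD('p) ^ i"
proof -
  interpret prob_space \<mu> by (rule haar_prob)
  define D where "D = digits TYPE('p) N"
  \<comment> \<open>The excluded vectors; they are counted as the solutions of a system with the identity matrix.\<close>
  define B where "B = {u \<in> D. \<forall>s\<in>{i..<N}. u s = 0}"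
  have lt: "u s < CARD('p)" if "u \<in> D" "s < N" for u s using that by (auto simp: D_def digits_def)
  have fin: "finite D" unfolding D_def by (rule finite_digits)
  have BD: "B \<subseteq> D" by (auto simp: B_def)
  have cardB: "card B = CARD('p) ^ i"
  proof -
    have "{i..<N} \<subseteq> {..<N}" by auto
    from count_solutions_mod_p[OF GL_one this, where y = "\<lambda>_. 0 :: 'p padic_int"]
    have "card {u \<in> D. \<forall>r\<in>{i..<N}. \<pi> dvd 0 + (\<Sum>s<N. (1\<^sub>m N :: 'p padic_int mat) $$ (r, s) * of_nat (u s))}
        = CARD('p) ^ (N - card {i..<N})"
      unfolding D_def .
    also have "{u \<in> D. \<forall>r\<in>{i..<N}. \<pi> dvd 0 + (\<Sum>s<N. (1\<^sub>m N :: 'p padic_int mat) $$ (r, s) * of_nat (u s))} = B"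
    proof -
      have "\<pi> dvd 0 + (\<Sum>s<N. (1\<^sub>m N :: 'p padic_int mat) $$ (r, s) * of_nat (u s)) \<longleftrightarrow> u r = 0" if "r < N"
          "u \<in> D" for r u
      proof -
        have "(\<Sum>s<N. (1\<^sub>m N :: 'p padic_int mat) $$ (r, s) * of_nat (u s))
            = (\<Sum>s<N. (if r = s then 1 else 0) * of_nat (u s))"
          by (rule sum.cong) (use that in auto)
        also have "\<dots> = of_nat (u r)" using that(1) by (simp only: sum_delta_mult)
        finally show ?thesis using pi_dvd_of_nat_diff[where 'p='p, OF lt[OF that(2,1)], of 0] by auto
      qed
      then show ?thesis unfolding B_def by auto
    qed
    finally show ?thesis using i nN by simp
  qed
  have "\<forall>u. \<exists>h. u \<in> D - B \<longrightarrow> h \<in> GL N \<and> (\<forall>l<i. \<forall>r<N. h $$ (r, l)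
      = (if r = l then 1 else 0 :: 'p padic_int)) \<and> (\<forall>r<N. h $$ (r, i) = of_nat (u r))"
  proof (intro allI)
    fix u
    show "\<exists>h. u \<in> D - B \<longrightarrow> h \<in> GL N \<and> (\<forall>l<i. \<forall>r<N. h $$ (r, l) = (if r = l then 1 else 0 :: 'p padic_int))
        \<and> (\<forall>r<N. h $$ (r, i) = of_nat (u r))"
    proof (cases "u \<in> D - B")
      case True
      then obtain s where s: "i \<le> s" "s < N" "u s \<noteq> 0" and uD: "u \<in> D" by (auto simp: B_def)
      have "\<not> \<pi> dvd (of_nat (u s) :: 'p padic_int)"
        using pi_dvd_of_nat_diff[where 'p='p, OF lt[OF uD s(2)], of 0] s(3) by auto
      then have "(of_nat (u s) :: 'p padic_int) dvd 1" by (simp only: padic_unit_iff simp_thms)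
      from GL_with_column[where c = "\<lambda>r. of_nat (u r) :: 'p padic_int", OF s(1,2) this] show ?thesis by blast
    next
      case False
      then show ?thesis by (intro exI impI) (rule notE)
    qed
  qed
  then obtain h where h: "\<And>u. u \<in> D - B \<Longrightarrow> h u \<in> GL N"
    "\<And>u l r. u \<in> D - B \<Longrightarrow> l < i \<Longrightarrow> r < N \<Longrightarrow> h u $$ (r, l) = (if r = l then 1 else 0 :: 'p padic_int)"
    "\<And>u r. u \<in> D - B \<Longrightarrow> r < N \<Longrightarrow> h u $$ (r, i) = of_nat (u r)"
    unfolding choice_iff by blast
  have "real (card (D - B)) * measure \<mu> {G \<in> space \<mu>. depth_ge n i 1 (corner n G)}
     = real (CARD('p) ^ (N - (n - i)) - CARD('p) ^ i) * measure \<mu> (space \<mu>)"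
  proof (rule averaging_count[OF haar_prob, where \<tau> = "\<lambda>u G. G * h u"])
    show "finite (D - B)" using fin by simp
    show "{G \<in> space \<mu>. depth_ge n i 1 (corner n G)} \<in> sets \<mu>"
      by (intro depth_ge_sets haar_corner_measurable i)
    show "space \<mu> \<in> sets \<mu>" by simp
    fix u assume "u \<in> D - B"
    then show "(\<lambda>G. G * h u) \<in> measurable \<mu> \<mu>" "distr \<mu> \<mu> (\<lambda>G. G * h u) = \<mu>"
      using haar_right_mult[OF h(1)] by auto
  next
    show "AE G in \<mu>. card {u \<in> D - B. G * h u \<in> {G \<in> space \<mu>. depth_ge n i 1 (corner n G)}}
         = (if G \<in> space \<mu> then CARD('p) ^ (N - (n - i)) - CARD('p) ^ i else 0)"
      using reg AE_space
    proof eventually_elim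
      case (elim G)
      then have G: "G \<in> GL N" by (simp add: haar_space)
      have Gc: "G \<in> carrier_mat N N" using G by simp
      obtain U where U: "U \<in> GL n" "ext_mat n N U * G \<in> GL N"
        "\<And>l r. l < i \<Longrightarrow> l < r \<Longrightarrow> r < n \<Longrightarrow> (U * corner n G) $$ (r, l) = 0"
        "\<And>l. l < i \<Longrightarrow> (U * corner n G) $$ (l, l) \<noteq> 0"
        "\<And>r c. r < n \<Longrightarrow> c < N \<Longrightarrow> (\<Sum>s<n. U $$ (r, s) * G $$ (s, c)) = (ext_mat n N U * G) $$ (r, c)"
        "\<And>r y. r < n \<Longrightarrow> (\<Sum>s<n. U $$ (r, s) * (\<Sum>t<N. G $$ (s, t) * y t))
            = (\<Sum>t<N. (ext_mat n N U * G) $$ (r, t) * y t)"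
        "\<And>r l. i \<le> r \<Longrightarrow> r < n \<Longrightarrow> l < i \<Longrightarrow> (ext_mat n N U * G) $$ (r, l) = 0"
        using haar_frame[OF G i elim(1)] by blast
      define H where "H = ext_mat n N U * G"
      have d: "depth_ge n i 1 (corner n (G * h u)) \<longleftrightarrow>
         (\<forall>r\<in>{i..<n}. \<pi> dvd (\<Sum>t<N. H $$ (r, t) * of_nat (u t)))" if u: "u \<in> D - B" for u
      proof -
        have ent: "corner n (G * h u) $$ (r, c) = (\<Sum>t<N. G $$ (r, t) * h u $$ (t, c))" if "r < n" "c < n"
            for r c
        proof -
          have "corner n (G * h u) $$ (r, c) = (G * h u) $$ (r, c)" using that by (simp add: corner_def)
          then show ?thesis using that nN Gc h(1)[OF u]
              by (simp add: mult_entry[of _ N N _ N] del: index_mult_mat)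
        qed
        have "depth_ge n i 1 (corner n (G * h u)) \<longleftrightarrow>
          (\<forall>r\<in>{i..<n}. \<pi> ^ 1 dvd (\<Sum>s<n. U $$ (r, s) * (\<Sum>t<N. G $$ (s, t) * of_nat (u t))))"
        proof (rule depth_ge_new_column[OF corner_carrier corner_carrier i U(1,3,4)])
          fix l r assume l: "l < i" and r: "r < n"
          then have lr: "l < n" "r < N" "l < N" using i nN by auto
          have "corner n (G * h u) $$ (r, l) = (\<Sum>t<N. G $$ (r, t) * (if t = l then 1 else 0))"
            unfolding ent[OF r lr(1)] by (rule sum.cong) (use h(2)[OF u l] in auto)
          also have "\<dots> = G $$ (r, l)" using lr(3) by (simp only: sum_delta_mult')
          finally show "corner n (G * h u) $$ (r, l) = corner n G $$ (r, l)" using r lr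
              by (simp add: corner_def)
        next
          fix r assume r: "r < n"
          show "corner n (G * h u) $$ (r, i) = (\<Sum>t<N. G $$ (r, t) * of_nat (u t))"
            unfolding ent[OF r i] by (rule sum.cong) (use h(3)[OF u] in auto)
        qed
        also have "\<dots> \<longleftrightarrow> (\<forall>r\<in>{i..<n}. \<pi> dvd (\<Sum>t<N. H $$ (r, t) * of_nat (u t)))"
        proof -
          have "(\<Sum>s<n. U $$ (r, s) * (\<Sum>t<N. G $$ (s, t) * of_nat (u t))) = (\<Sum>t<N. H $$ (r, t) * of_nat (u t))"
            if r: "r < n" for r
            unfolding H_def by (rule U(6)[OF r])
          then show ?thesis by auto
        qed
        finally show ?thesis .
      qed
      define S where "S = {u \<in> D. \<forall>r\<in>{i..<n}. \<pi> dvd (\<Sum>t<N. H $$ (r, t) * of_nat (u t))}"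
      have sub: "{i..<n} \<subseteq> {..<N}" using nN by auto
      have cardS: "card S = CARD('p) ^ (N - (n - i))"
        using count_solutions_mod_p[OF U(2)[folded H_def] sub, where y = "\<lambda>_. 0"] unfolding S_def D_def by simp
      have "B \<subseteq> S"
      proof
        fix u assume u: "u \<in> B"
        have "H $$ (r, t) * of_nat (u t) = 0" if "r \<in> {i..<n}" "t < N" for r t
          using u that U(7)[of r t] by (cases "t < i") (auto simp: B_def H_def)
        then have "(\<Sum>t<N. H $$ (r, t) * of_nat (u t)) = 0" if "r \<in> {i..<n}" for r
          using that by (intro sum.neutral) auto
        then show "u \<in> S" using u BD by (auto simp: S_def)
      qed
      have "{u \<in> D - B. G * h u \<in> {G \<in> space \<mu>. depth_ge n i 1 (corner n G)}} = S - B"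
        using d G h(1) by (auto simp: S_def haar_space intro: GL_mult)
      also have "card (S - B) = card S - card B"
        using \<open>B \<subseteq> S\<close> finite_subset[OF BD fin] by (intro card_Diff_subset)
      finally show ?case using cardS cardB elim(2) by simp
    qed
  qed
  moreover have "card (D - B) = CARD('p) ^ N - CARD('p) ^ i"
    using BD fin cardB card_digits[where 'p='p, of N] by (simp add: card_Diff_subset finite_subset D_def)
  moreover have "CARD('p) ^ i \<le> CARD('p) ^ N" "CARD('p) ^ i \<le> CARD('p) ^ (N - (n - i))"
    using i nN by (auto intro!: power_increasing)
  ultimately show ?thesis by (simp add: prob_space of_nat_diff)
qed

end

text \<open>The factor by which the tail probabilities of a depth for a corner of a Haar matrix in \<open>GL\<^sub>N(\<int>\<^sub>p)\<close>
  are smaller than those for independent Haar entries, to which the value \<open>N = \<infinity>\<close> refers.\<close>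

definition corner_factor :: "nat \<Rightarrow> nat \<Rightarrow> nat \<Rightarrow> enat \<Rightarrow> real" where
  "corner_factor p n i N = (case N of enat N' \<Rightarrow> (1 - (1 / real p) ^ (N' - n)) / (1 - (1 / real p) ^ (N' - i)) | \<infinity> \<Rightarrow> 1)"

text \<open>The two recursions give the case \<open>V = 1\<close>, to which right invariance reduces the general one because \<open>V\<close>
  extends to \<open>GL\<^sub>N(\<int>\<^sub>p)\<close>.\<close>

lemma depth_law_haar_GL:
  fixes V :: "'p::prime_card padic_int mat"
  assumes haar: "haar_GL N \<mu>" and nN: "n < N" and V: "V \<in> GL n" and i: "i < n" and m: "m \<ge> 1"
  shows "measure \<mu> {G \<in> space \<mu>. depth_ge n i m (corner n G * V)}
    = corner_factor CARD('p) n i (enat N) * ((1 / real CARD('p)) ^ (n - i)) ^ m"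
proof -
  have p1: "real CARD('p) > 1" using prime_card_int[where 'a='p] prime_gt_1_int[of "int CARD('p)"] by simp
  define x where "x i = (1 / real CARD('p)) ^ (n - i)" for i
  define q where "q i = corner_factor CARD('p) n i (enat N)" for i
  have x01: "0 < x i" if "i < n" for i unfolding x_def using p1 that by simp
  have q01: "q i \<le> 1" if "i < n" for i
  proof -
    have "(1 / real CARD('p)) ^ (N - i) \<le> (1 / real CARD('p)) ^ (N - n)"
      using p1 that nN by (intro power_decreasing) auto
    moreover have "(1 / real CARD('p)) ^ (N - i) < 1" using p1 that nN
        by (intro power_less_one_iff[THEN iffD2]) auto
    ultimately show ?thesis unfolding q_def corner_factor_def by (simp add: divide_le_eq)
  qed
  define a where "a i m = measure \<mu> {G \<in> space \<mu>. depth_ge n i m (corner n G)}" for i m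
  have a1: "a i 1 = q i * x i" if i: "i < n" and reg: "AE G in \<mu>. regular_below n i (corner n G)" for i
  proof -
    let ?p = "real CARD('p)"
    have 1: "?p ^ (N - (n - i)) - ?p ^ i = ?p ^ N * x i * (1 - (1 / ?p) ^ (N - n))"
    proof -
      have "?p ^ (N - (n - i)) = ?p ^ N * x i"
      proof -
        have "?p ^ N = ?p ^ (N - (n - i)) * ?p ^ (n - i)" using i nN by (simp flip: power_add)
        then show ?thesis unfolding x_def using p1 by (simp add: power_one_over)
      qed
      moreover have "?p ^ i = ?p ^ N * x i * (1 / ?p) ^ (N - n)"
      proof -
        have "?p ^ N = ?p ^ i * (?p ^ (n - i) * ?p ^ (N - n))" using i nN by (simp flip: power_add)
        then show ?thesis unfolding x_def using p1 by (simp add: power_one_over)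
      qed
      ultimately show ?thesis by (simp add: right_diff_distrib)
    qed
    have 2: "?p ^ N - ?p ^ i = ?p ^ N * (1 - (1 / ?p) ^ (N - i))"
    proof -
      have "?p ^ N = ?p ^ i * ?p ^ (N - i)" using i nN by (simp flip: power_add)
      then have "?p ^ N * (1 / ?p) ^ (N - i) = ?p ^ i" using p1 by (simp add: power_one_over)
      then show ?thesis by (simp add: right_diff_distrib)
    qed
    have 3: "1 - (1 / ?p) ^ (N - i) > 0" using p1 i nN by (simp, intro power_less_one_iff[THEN iffD2]) auto
    have "?p ^ N * ((1 - (1 / ?p) ^ (N - i)) * a i 1) = ?p ^ N * (x i * (1 - (1 / ?p) ^ (N - n)))"
      using haar_depth_1[OF haar nN i reg] unfolding 1 2 a_def by (simp only: mult.assoc)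
    then have "(1 - (1 / ?p) ^ (N - i)) * a i 1 = x i * (1 - (1 / ?p) ^ (N - n))" using p1 by simp
    then show ?thesis using 3 unfolding q_def corner_factor_def by (simp add: field_simps)
  qed
  have am: "a i m = q i * x i ^ m" if i: "i < n" and reg: "AE G in \<mu>. regular_below n i (corner n G)" and
      "m \<ge> 1" for i m
    using that(3)
  proof (induction m rule: dec_induct)
    case base show ?case using a1[OF i reg] by simp
  next
    case (step m) then show ?case using haar_depth_rec[OF haar nN i _ reg, of m] by (simp add: a_def x_def)
  qed
  have "AE G in \<mu>. regular_below n i (corner n G)" if "i \<le> n" for i
  proof (rule AE_regular_below[OF haar_prob[OF haar nN] haar_corner_measurable[OF haar nN] _ that])
    fix i m :: nat assume i: "i < n" and reg: "AE G in \<mu>. regular_below n i (corner n G)" and m: "m \<ge> 1"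
    show "measure \<mu> {G \<in> space \<mu>. depth_ge n i m (corner n G)} \<le> ((1 / real CARD('p)) ^ (n - i)) ^ m"
      using am[OF i reg m] q01[OF i] x01[OF i] unfolding a_def x_def[symmetric]
          by (simp add: mult_le_cancel_right1)
  qed
  with i have "a i m = q i * x i ^ m" by (intro am m) auto
  moreover have "measure \<mu> {G \<in> space \<mu>. depth_ge n i m (corner n G * V)} = a i m"
  proof -
    have E: "ext_mat n N V \<in> GL N" using nN V by (intro ext_mat_GL) auto
    have S: "{G \<in> space \<mu>. depth_ge n i m (corner n G)} \<in> sets \<mu>"
      by (intro depth_ge_sets haar_corner_measurable[OF haar nN] i)
    have "a i m = measure (distr \<mu> \<mu> (\<lambda>G. G * ext_mat n N V)) {G \<in> space \<mu>. depth_ge n i m (corner n G)}"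
      unfolding a_def haar_right_mult(2)[OF haar nN E] ..
    also have "\<dots> = measure \<mu> ((\<lambda>G. G * ext_mat n N V) -` {G \<in> space \<mu>. depth_ge n i m (corner n G)} \<inter> space \<mu>)"
      by (rule measure_distr[OF haar_right_mult(1)[OF haar nN E] S])
    also have "(\<lambda>G. G * ext_mat n N V) -` {G \<in> space \<mu>. depth_ge n i m (corner n G)} \<inter> space \<mu>
        = {G \<in> space \<mu>. depth_ge n i m (corner n G * V)}"
    proof -
      have "G * ext_mat n N V \<in> GL N" "corner n G * V = corner n (G * ext_mat n N V)" if "G \<in> GL N" for G
        using that E nN V by (auto intro!: GL_mult corner_mult)
      then show ?thesis by (auto simp: haar_space[OF haar nN])
    qed
    finally show ?thesis by simp
  qed
  ultimately show ?thesis by (simp add: q_def x_def)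
qed

section \<open>One step of the random product\<close>

lemma corner_factor_bounds:
  assumes p: "p > 1" and i: "i < n" and N: "enat n < N"
  shows "0 \<le> corner_factor p n i N" "corner_factor p n i N \<le> 1"
proof -
  have "0 \<le> corner_factor p n i N \<and> corner_factor p n i N \<le> 1"
  proof (cases N)
    case (enat N')
    then have nN: "n < N'" using N by simp
    have a: "(1 / real p) ^ (N' - i) \<le> (1 / real p) ^ (N' - n)"
      using p i nN by (intro power_decreasing) auto
    have b: "(1 / real p) ^ (N' - i) < 1" using p i nN by (intro power_less_one_iff[THEN iffD2]) auto
    have c: "(1 / real p) ^ (N' - n) \<le> 1" using p by (intro power_le_one) auto
    show ?thesis using a b c unfolding enat corner_factor_def by (simp add: divide_le_eq)
  next
    case infinity then show ?thesis by (simp add: corner_factor_def)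
  qed
  then show "0 \<le> corner_factor p n i N" "corner_factor p n i N \<le> 1" by auto
qed

text \<open>By independence the law of the matrix is the product of the laws of its entries, each of which
  is invariant under translation.\<close>

lemma iid_haar_translation_invariant:
  fixes X :: "'w \<Rightarrow> 'p::prime_card padic_int mat"
  assumes "prob_space M" and n: "n > 0" and X: "X \<in> measurable M (mat_borel n)"
    and ind: "prob_space.indep_vars M (\<lambda>_. borel) (\<lambda>ij \<omega>. X \<omega> $$ ij) ({..<n} \<times> {..<n})"
    and haar: "\<And>ij. ij \<in> {..<n} \<times> {..<n} \<Longrightarrow> haar_Zp (distr M borel (\<lambda>\<omega>. X \<omega> $$ ij))"
    and C: "C \<in> carrier_mat n n"
  shows "distr (distr M (mat_borel n) X) (mat_borel n) (\<lambda>B. B + C) = distr M (mat_borel n) X"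
proof -
  interpret prob_space M by fact
  define I where "I = {..<n} \<times> {..<n}"
  have I: "I \<noteq> {}" using n by (auto simp: I_def)
  have Xe: "(\<lambda>\<omega>. X \<omega> $$ ij) \<in> borel_measurable M" if "ij \<in> I" for ij
    using that mat_borel_entry[OF X] by (auto simp: I_def)
  have Ye: "(\<lambda>\<omega>. C $$ ij + X \<omega> $$ ij) \<in> borel_measurable M" if "ij \<in> I" for ij
    by (intro padic_measurable_add Xe[OF that]) simp
  have "indep_vars (\<lambda>_. borel) (\<lambda>ij. (\<lambda>x. C $$ ij + x) \<circ> (\<lambda>\<omega>. X \<omega> $$ ij)) I"
    by (rule indep_vars_compose[OF ind[folded I_def]]) (intro padic_measurable_add, auto)
  then have indY: "indep_vars (\<lambda>_. borel) (\<lambda>ij \<omega>. C $$ ij + X \<omega> $$ ij) I" by (simp add: comp_def)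
  have "distr M borel (\<lambda>\<omega>. C $$ ij + X \<omega> $$ ij) = distr M borel (\<lambda>\<omega>. X \<omega> $$ ij)" if "ij \<in> I" for ij
  proof -
    have "distr M borel (\<lambda>\<omega>. C $$ ij + X \<omega> $$ ij)
        = distr (distr M borel (\<lambda>\<omega>. X \<omega> $$ ij)) borel (\<lambda>x. C $$ ij + x)"
      by (subst distr_distr) (use Xe[OF that] in \<open>auto simp: comp_def intro!: padic_measurable_add\<close>)
    also have "\<dots> = distr M borel (\<lambda>\<omega>. X \<omega> $$ ij)"
      using haar[of ij] that by (simp add: I_def haar_Zp_def is_haar_prob_def)
    finally show ?thesis .
  qed
  then have eq: "distr M (\<Pi>\<^sub>M ij\<in>I. borel) (\<lambda>\<omega>. \<lambda>ij\<in>I. C $$ ij + X \<omega> $$ ij)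
      = distr M (\<Pi>\<^sub>M ij\<in>I. borel) (\<lambda>\<omega>. \<lambda>ij\<in>I. X \<omega> $$ ij)"
    using indY ind[folded I_def] I Xe Ye by (simp add: indep_vars_iff_distr_eq_PiM' cong: PiM_cong)
  define \<Phi> where "\<Phi> f = mat n n f" for f :: "nat \<times> nat \<Rightarrow> 'p padic_int"
  have \<Phi>: "\<Phi> \<in> measurable (\<Pi>\<^sub>M ij\<in>I. borel) (mat_borel n)"
    unfolding mat_borel_measurable_iff
  proof (intro conjI ballI allI impI)
    fix i j assume ij: "i < n" "j < n"
    then have "(\<lambda>f. f (i, j)) \<in> borel_measurable (\<Pi>\<^sub>M ij\<in>I. borel :: 'p padic_int measure)"
      by (intro measurable_component_singleton) (auto simp: I_def)
    then show "(\<lambda>f. \<Phi> f $$ (i, j)) \<in> borel_measurable (\<Pi>\<^sub>M ij\<in>I. borel)" using ij by (simp add: \<Phi>_def)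
  qed (simp add: \<Phi>_def)
  have mX: "(\<lambda>\<omega>. \<lambda>ij\<in>I. X \<omega> $$ ij) \<in> measurable M (\<Pi>\<^sub>M ij\<in>I. borel)" using Xe by (intro measurable_restrict)
  have mY: "(\<lambda>\<omega>. \<lambda>ij\<in>I. C $$ ij + X \<omega> $$ ij) \<in> measurable M (\<Pi>\<^sub>M ij\<in>I. borel)" using Ye
      by (intro measurable_restrict)
  have X\<Phi>: "X \<omega> = \<Phi> (\<lambda>ij\<in>I. X \<omega> $$ ij)" and Y\<Phi>: "X \<omega> + C = \<Phi> (\<lambda>ij\<in>I. C $$ ij + X \<omega> $$ ij)" if
      "\<omega> \<in> space M" for \<omega>
    using measurable_space[OF X that] C by (auto simp: \<Phi>_def I_def add.commute)
  have add: "(\<lambda>B. B + C) \<in> measurable (mat_borel n) (mat_borel n)"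
    unfolding mat_borel_measurable_iff
  proof (intro conjI ballI allI impI)
    fix i j assume ij: "i < n" "j < n"
    have "(\<lambda>B. B $$ (i, j) + C $$ (i, j)) \<in> borel_measurable (mat_borel n)"
      by (intro padic_measurable_add mat_borel_entry[OF measurable_ident_sets ij]) auto
    then show "(\<lambda>B. (B + C) $$ (i, j)) \<in> borel_measurable (mat_borel n)"
      using ij carrier_matD[OF C] by (subst measurable_cong[where g = "\<lambda>B. B $$ (i, j) + C $$ (i, j)"]) auto
  qed (use C in auto)
  have "distr (distr M (mat_borel n) X) (mat_borel n) (\<lambda>B. B + C) = distr M (mat_borel n) (\<lambda>\<omega>. X \<omega> + C)"
    by (subst distr_distr[OF add X]) (simp add: comp_def)
  also have "\<dots> = distr M (mat_borel n) (\<Phi> \<circ> (\<lambda>\<omega>. \<lambda>ij\<in>I. C $$ ij + X \<omega> $$ ij))"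
    by (rule distr_cong) (auto simp: Y\<Phi>)
  also have "\<dots> = distr (distr M (\<Pi>\<^sub>M ij\<in>I. borel) (\<lambda>\<omega>. \<lambda>ij\<in>I. C $$ ij + X \<omega> $$ ij)) (mat_borel n) \<Phi>"
    by (rule distr_distr[OF \<Phi> mY, symmetric])
  also have "\<dots> = distr (distr M (\<Pi>\<^sub>M ij\<in>I. borel) (\<lambda>\<omega>. \<lambda>ij\<in>I. X \<omega> $$ ij)) (mat_borel n) \<Phi>" by (simp only: eq)
  also have "\<dots> = distr M (mat_borel n) (\<Phi> \<circ> (\<lambda>\<omega>. \<lambda>ij\<in>I. X \<omega> $$ ij))" by (rule distr_distr[OF \<Phi> mX])
  also have "\<dots> = distr M (mat_borel n) X" by (rule distr_cong) (auto simp: X\<Phi>[symmetric])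
  finally show ?thesis .
qed

lemma depth_law:
  fixes X :: "'w \<Rightarrow> 'p::prime_card padic_int mat"
  assumes "prob_space M" and law: "corner_or_iid M n N X" and N: "enat n < N"
    and V: "V \<in> GL n" and i: "i < n" and m: "m \<ge> 1"
  shows "measure M {\<omega> \<in> space M. depth_ge n i m (X \<omega> * V)}
    = corner_factor CARD('p) n i N * ((1 / real CARD('p)) ^ (n - i)) ^ m"
proof -
  interpret prob_space M by fact
  have X: "X \<in> measurable M (mat_borel n)" using law by (simp add: corner_or_iid_def)
  have idm: "(\<lambda>B. B) \<in> measurable (mat_borel n) (mat_borel n :: 'p padic_int mat measure)" by simp
  have "(\<lambda>B. B * V) \<in> measurable (mat_borel n) (mat_borel n)" by (rule mat_borel_mult[OF idm]) (use V in simp)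
  from depth_ge_sets[OF this i, of m]
  have S: "{B \<in> carrier_mat n n. depth_ge n i m (B * V)} \<in> sets (mat_borel n)" by simp
  have 1: "measure M {\<omega> \<in> space M. depth_ge n i m (X \<omega> * V)}
      = measure (distr M (mat_borel n) X) {B \<in> carrier_mat n n. depth_ge n i m (B * V)}"
    using measurable_space[OF X] by (subst measure_distr[OF X S]) (auto intro!: arg_cong[where f = "measure M"])
  show ?thesis
  proof (cases N)
    case (enat N')
    then obtain \<mu> where \<mu>: "haar_GL N' \<mu>" "distr M (mat_borel n) X = distr \<mu> (mat_borel n) (corner n)"
      using law by (auto simp: corner_or_iid_def)
    have nN: "n < N'" using N enat by simp
    have "measure (distr \<mu> (mat_borel n) (corner n)) {B \<in> carrier_mat n n. depth_ge n i m (B * V)}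
       = measure \<mu> {G \<in> space \<mu>. depth_ge n i m (corner n G * V)}"
      by (subst measure_distr[OF haar_corner_measurable[OF \<mu>(1) nN] S]) (auto intro!: arg_cong[where f =
          "measure \<mu>"])
    then show ?thesis using depth_law_haar_GL[OF \<mu>(1) nN V i m] 1 \<mu>(2) enat by simp
  next
    case infinity
    then have ind: "indep_vars (\<lambda>_. borel) (\<lambda>ij \<omega>. X \<omega> $$ ij) ({..<n} \<times> {..<n})"
      and haar: "\<And>ij. ij \<in> {..<n} \<times> {..<n} \<Longrightarrow> haar_Zp (distr M borel (\<lambda>\<omega>. X \<omega> $$ ij))"
      using law by (auto simp: corner_or_iid_def)
    have "measure (distr M (mat_borel n) X) {B \<in> space (distr M (mat_borel n) X). depth_ge n i m (B * V)}
        = ((1 / real CARD('p)) ^ (n - i)) ^ m"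
    proof (rule depth_law_translation_invariant[OF prob_space_distr[OF X] _ _ V i])
      show "distr (distr M (mat_borel n) X) (mat_borel n) (\<lambda>B. B + C) = distr M (mat_borel n) X" if
          "C \<in> carrier_mat n n" for C
        by (rule iid_haar_translation_invariant[OF \<open>prob_space M\<close> _ X ind haar that]) (use i in auto)
    qed simp
    then show ?thesis using 1 infinity by (simp add: corner_factor_def)
  qed
qed

text \<open>In triangular frames diagonal entries multiply and hence valuations add. The inverse \<open>V\<close> of the frame of
  \<open>P\<close> is all that the depth added by \<open>B\<close> remembers of \<open>P\<close>.\<close>

lemma depth_of_product:
  fixes B P :: "'p::prime_card padic_int mat"
  assumes B: "B \<in> carrier_mat n n" and P: "P \<in> carrier_mat n n" and regP: "regular_below n n P"
    and U: "U \<in> GL n" "\<And>l r. l < r \<Longrightarrow> r < n \<Longrightarrow> (U * P) $$ (r, l) = 0" and V: "V \<in> GL n" "V * U = 1\<^sub>m n"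
  shows "regular_below n n (B * V) \<Longrightarrow> regular_below n n (B * P)"
    and "regular_below n n (B * V) \<Longrightarrow> i < n \<Longrightarrow> depth n i (B * P) = depth n i (B * V) + depth n i P"
    and "regular_below n n (B * P) \<Longrightarrow> i < n \<Longrightarrow> depth n i P \<le> depth n i (B * P)"
proof -
  have c: "U \<in> carrier_mat n n" "V \<in> carrier_mat n n" using U V by auto
  have BV: "B * V \<in> carrier_mat n n" and BP: "B * P \<in> carrier_mat n n" and UP: "U * P \<in> carrier_mat n n"
    using B P c by auto
  obtain W where W: "W \<in> GL n" "\<forall>l<n. \<forall>r<n. l < r \<longrightarrow> (W * (B * V)) $$ (r, l) = 0"
      using triangularize[OF BV] by blast
  then have Wtri: "(W * (B * V)) $$ (r, l) = 0" if "l < r" "r < n" for l r using that by simp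
  have Wc: "W \<in> carrier_mat n n" using W(1) by simp
  have WBV: "W * (B * V) \<in> carrier_mat n n" using Wc BV by auto
  have e: "W * (B * P) = (W * (B * V)) * (U * P)"
  proof -
    have "(W * (B * V)) * (U * P) = W * (B * ((V * U) * P))"
      using Wc B c P by (simp add: assoc_mult_mat[of _ n n _ n _ n] mult_carrier_mat[of _ n n])
    then show ?thesis using V(2) P by simp
  qed
  have tri: "(W * (B * P)) $$ (r, l) = 0" if "l < r" "r < n" for l r
    unfolding e by (rule upper_triangular_mult(1)[OF WBV UP Wtri U(2) that])
  have diag: "(W * (B * P)) $$ (r, r) = (W * (B * V)) $$ (r, r) * (U * P) $$ (r, r)" if r: "r < n" for r
    unfolding e by (rule upper_triangular_mult(2)[OF WBV UP Wtri U(2) r])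
  have Pdiag: "\<exists>u. (U * P) $$ (r, r) = \<pi> ^ depth n r P * u \<and> u dvd 1" if "r < n" for r
    by (rule regular_diag_unit[OF P U(1) U(2) regP that]) auto
  {
    assume reg: "regular_below n n (B * V)"
    have Rdiag: "\<exists>u. (W * (B * V)) $$ (r, r) = \<pi> ^ depth n r (B * V) * u \<and> u dvd 1" if "r < n" for r
      by (rule regular_diag_unit[OF BV W(1) Wtri reg that]) auto
    have d: "\<exists>u. (W * (B * P)) $$ (r, r) = \<pi> ^ (depth n r (B * V) + depth n r P) * u \<and> u dvd 1" if r:
        "r < n" for r
    proof -
      obtain u u' where "(W * (B * V)) $$ (r, r) = \<pi> ^ depth n r (B * V) * u" "u dvd 1"
        "(U * P) $$ (r, r) = \<pi> ^ depth n r P * u'" "u' dvd 1" using Rdiag[OF r] Pdiag[OF r] by blast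
      then show ?thesis unfolding diag[OF r] power_add
        by (intro exI[of _ "u * u'"] conjI) (simp_all only: mult_ac is_unit_mult_iff simp_thms)
    qed
    have nz: "(W * (B * P)) $$ (r, r) \<noteq> 0" if r: "r < n" for r
    proof -
      obtain u where "(W * (B * P)) $$ (r, r) = \<pi> ^ (depth n r (B * V) + depth n r P) * u" "u dvd 1"
          using d[OF r] by blast
      moreover have "u \<noteq> 0" using \<open>u dvd 1\<close> by auto
      ultimately show ?thesis by (simp del: of_nat_power)
    qed
    have dd: "depth_ge n r k (B * P) \<longleftrightarrow> k \<le> depth n r (B * V) + depth n r P"
        "depth n r (B * P) = depth n r (B * V) + depth n r P"
      if r: "r < n" for r k
    proof -
      obtain u where u: "(W * (B * P)) $$ (r, r) = \<pi> ^ (depth n r (B * V) + depth n r P) * u" "u dvd 1"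
          using d[OF r] by blast
      show "depth_ge n r k (B * P) \<longleftrightarrow> k \<le> depth n r (B * V) + depth n r P"
        by (rule depth_eq(1)[OF BP r W(1) _ _ u]) (use tri nz r in auto)
      show "depth n r (B * P) = depth n r (B * V) + depth n r P"
        by (rule depth_eq(2)[OF BP r W(1) _ _ u]) (use tri nz r in auto)
    qed
    have "\<exists>k. \<not> depth_ge n r k (B * P)" if "r < n" for r
      using dd(1)[OF that, of "Suc (depth n r (B * V) + depth n r P)"] by auto
    then have "regular_below n n (B * P)" unfolding regular_below_def by blast
    with dd(2) have "regular_below n n (B * P)"
        "\<And>r. r < n \<Longrightarrow> depth n r (B * P) = depth n r (B * V) + depth n r P" by auto
  } note * = this
  show "regular_below n n (B * V) \<Longrightarrow> regular_below n n (B * P)" by (rule *(1))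
  show "regular_below n n (B * V) \<Longrightarrow> i < n \<Longrightarrow> depth n i (B * P) = depth n i (B * V) + depth n i P" by (rule *(2))
  show "depth n i P \<le> depth n i (B * P)" if reg: "regular_below n n (B * P)" and i: "i < n"
  proof -
    obtain u where u: "(W * (B * P)) $$ (i, i) = \<pi> ^ depth n i (B * P) * u" "u dvd 1"
      by (rule regular_diag_unit[OF BP W(1) tri reg i]) auto
    obtain u' where u': "(U * P) $$ (i, i) = \<pi> ^ depth n i P * u'" using Pdiag[OF i] by blast
    have "\<pi> ^ depth n i P dvd (W * (B * P)) $$ (i, i)" unfolding diag[OF i] u' by simp
    then show ?thesis unfolding u(1) by (rule pi_power_dvd_le[OF _ u(2)])
  qed
qed

lemma depth_ge_iff_le_depth:
  assumes "regular_below n n X" "i < n"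
  shows "depth_ge n i m X \<longleftrightarrow> m \<le> depth n i X"
proof -
  from assms obtain k where k: "\<not> depth_ge n i k X" unfolding regular_below_def by blast
  then have "\<not> depth_ge n i (Suc k) X" using depth_ge_Suc_imp by blast
  then have a: "\<not> depth_ge n i (Suc (depth n i X)) X" unfolding depth_def by (rule LeastI)
  have b: "depth_ge n i (depth n i X) X"
  proof (cases "depth n i X")
    case 0 then show ?thesis by (simp add: depth_ge_0)
  next
    case (Suc d)
    then have "d < (LEAST m. \<not> depth_ge n i (Suc m) X)" by (simp add: depth_def)
    then show ?thesis using not_less_Least Suc by auto
  qed
  show ?thesis
  proof
    assume m: "depth_ge n i m X"
    show "m \<le> depth n i X"
    proof (rule ccontr)
      assume "\<not> m \<le> depth n i X"
      then show False using a depth_ge_mono[OF m, of "Suc (depth n i X)"] by simp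
    qed
  qed (use b depth_ge_mono in blast)
qed

text \<open>The increments of the depths have a law that does not depend on \<open>P\<close>, since the law of a depth of \<open>X V\<close>
  is the same for all invertible \<open>V\<close>. This is the source of independence.\<close>

lemma increment_law:
  fixes X :: "'w \<Rightarrow> 'p::prime_card padic_int mat"
  assumes prob: "prob_space M" and law: "corner_or_iid M n N X" and N: "enat n < N"
    and P: "P \<in> carrier_mat n n" and regP: "regular_below n n P"
  shows "AE \<omega> in M. regular_below n n (X \<omega> * P)"
    and "i < n \<Longrightarrow> m \<ge> 1 \<Longrightarrow> measure M {\<omega> \<in> space M. m \<le> depth n i (X \<omega> * P) - depth n i P}
      = corner_factor CARD('p) n i N * ((1 / real CARD('p)) ^ (n - i)) ^ m"
proof -
  interpret prob_space M by fact
  have X: "X \<in> measurable M (mat_borel n)" using law by (simp add: corner_or_iid_def)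
  have Xc: "X \<omega> \<in> carrier_mat n n" if "\<omega> \<in> space M" for \<omega> using measurable_space[OF X that] by simp
  obtain U where U: "U \<in> GL n" "\<forall>l<n. \<forall>r<n. l < r \<longrightarrow> (U * P) $$ (r, l) = 0" using triangularize[OF P] by blast
  then have Ut: "\<And>l r. l < r \<Longrightarrow> r < n \<Longrightarrow> (U * P) $$ (r, l) = 0" by simp
  obtain V where V: "V \<in> GL n" "V * U = 1\<^sub>m n" using GL_obtain_inverse[OF U(1)] by metis
  have XV: "(\<lambda>\<omega>. X \<omega> * V) \<in> measurable M (mat_borel n)" by (rule mat_borel_mult[OF X]) (use V in simp)
  have XP: "(\<lambda>\<omega>. X \<omega> * P) \<in> measurable M (mat_borel n)" by (rule mat_borel_mult[OF X]) (use P in simp)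
  have p1: "CARD('p) > 1" using prime_card_gt_1[where 'p='p] by simp
  have reg: "AE \<omega> in M. regular_below n n (X \<omega> * V)"
  proof (rule AE_regular_below[OF prob XV _ order_refl])
    fix i m :: nat assume i: "i < n" and m: "m \<ge> 1"
    show "measure M {\<omega> \<in> space M. depth_ge n i m (X \<omega> * V)} \<le> ((1 / real CARD('p)) ^ (n - i)) ^ m"
      unfolding depth_law[OF prob law N V(1) i m] using corner_factor_bounds[OF p1 i N]
      by (intro mult_left_le_one_le) auto
  qed
  show "AE \<omega> in M. regular_below n n (X \<omega> * P)"
    using reg AE_space
  proof eventually_elim
    case (elim \<omega>)
    show ?case by (rule depth_of_product(1)[OF Xc[OF elim(2)] P regP U(1) Ut V elim(1)])
  qed
  show "measure M {\<omega> \<in> space M. m \<le> depth n i (X \<omega> * P) - depth n i P}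
      = corner_factor CARD('p) n i N * ((1 / real CARD('p)) ^ (n - i)) ^ m" if i: "i < n" and m: "m \<ge> 1"
  proof -
    have "measure M {\<omega> \<in> space M. m \<le> depth n i (X \<omega> * P) - depth n i P}
        = measure M {\<omega> \<in> space M. depth_ge n i m (X \<omega> * V)}"
    proof (rule measure_eq_AE)
      show "AE \<omega> in M. \<omega> \<in> {\<omega> \<in> space M. m \<le> depth n i (X \<omega> * P) - depth n i P}
          \<longleftrightarrow> \<omega> \<in> {\<omega> \<in> space M. depth_ge n i m (X \<omega> * V)}"
        using reg AE_space
      proof eventually_elim
        case (elim \<omega>)
        have "depth n i (X \<omega> * P) = depth n i (X \<omega> * V) + depth n i P"
          by (rule depth_of_product(2)[OF Xc[OF elim(2)] P regP U(1) Ut V elim(1) i])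
        then show ?case using depth_ge_iff_le_depth[OF elim(1) i] elim(2) by simp
      qed
      have "(\<lambda>\<omega>. depth n i (X \<omega> * P)) \<in> measurable M (count_space UNIV)" by (rule depth_measurable[OF XP i])
      then show "{\<omega> \<in> space M. m \<le> depth n i (X \<omega> * P) - depth n i P} \<in> sets M" by measurable
      show "{\<omega> \<in> space M. depth_ge n i m (X \<omega> * V)} \<in> sets M" by (rule depth_ge_sets[OF XV i])
    qed
    then show ?thesis using depth_law[OF prob law N V(1) i m] by simp
  qed
qed

section \<open>Depths of the random product\<close>

text \<open>An event about independent variables \<open>Y\<close> and \<open>Z\<close> whose conditional probability given \<open>Y\<close> is constant
  is independent of \<open>Y\<close>.\<close>

lemma (in prob_space) indep_var_constant_sections:
  assumes ind: "indep_var S Y T Z" and F: "F \<in> sets S" and Q: "Q \<in> sets (S \<Otimes>\<^sub>M T)"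
    and sec: "AE y in distr M S Y. measure M {\<omega> \<in> space M. (y, Z \<omega>) \<in> Q} = q"
  shows "prob {\<omega> \<in> space M. Y \<omega> \<in> F \<and> (Y \<omega>, Z \<omega>) \<in> Q} = prob {\<omega> \<in> space M. Y \<omega> \<in> F} * q"
proof -
  have Y: "Y \<in> measurable M S" and Z: "Z \<in> measurable M T"
    and eq: "distr M S Y \<Otimes>\<^sub>M distr M T Z = distr M (S \<Otimes>\<^sub>M T) (\<lambda>x. (Y x, Z x))"
    using ind unfolding indep_var_distribution_eq by auto
  interpret DY: prob_space "distr M S Y" by (rule prob_space_distr[OF Y])
  interpret DZ: prob_space "distr M T Z" by (rule prob_space_distr[OF Z])
  define A where "A = Q \<inter> (F \<times> space T)"
  have A: "A \<in> sets (S \<Otimes>\<^sub>M T)" unfolding A_def using Q F by auto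
  have A': "A \<in> sets (distr M S Y \<Otimes>\<^sub>M distr M T Z)" using A by (simp cong: sets_pair_measure_cong)
  have YZ: "(\<lambda>x. (Y x, Z x)) \<in> measurable M (S \<Otimes>\<^sub>M T)" using Y Z by simp
  have "AE y in distr M S Y. q \<ge> 0" using sec by eventually_elim auto
  then have q0: "q \<ge> 0" by (simp only: DY.AE_const)
  have "ennreal (prob {\<omega> \<in> space M. Y \<omega> \<in> F \<and> (Y \<omega>, Z \<omega>) \<in> Q})
      = emeasure (distr M (S \<Otimes>\<^sub>M T) (\<lambda>x. (Y x, Z x))) A"
    using measurable_space[OF Z] unfolding emeasure_distr[OF YZ A] emeasure_eq_measure[symmetric]
    by (auto simp: A_def intro!: arg_cong[where f = "emeasure M"])
  also have "\<dots> = (\<integral>\<^sup>+y. emeasure (distr M T Z) (Pair y -` A) \<partial>distr M S Y)"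
    unfolding eq[symmetric] by (rule DZ.emeasure_pair_measure_alt[OF A'])
  also have "\<dots> = (\<integral>\<^sup>+y. ennreal q * indicator F y \<partial>distr M S Y)"
  proof (rule nn_integral_cong_AE)
    show "AE y in distr M S Y. emeasure (distr M T Z) (Pair y -` A) = ennreal q * indicator F y"
      using sec AE_space
    proof eventually_elim
      case (elim y)
      have "emeasure (distr M T Z) (Pair y -` A) = emeasure M (Z -` (Pair y -` A) \<inter> space M)"
        by (rule emeasure_distr[OF Z sets_Pair1[OF A]])
      also have "Z -` (Pair y -` A) \<inter> space M = (if y \<in> F then {\<omega> \<in> space M. (y, Z \<omega>) \<in> Q} else {})"
        using measurable_space[OF Z] by (auto simp: A_def)
      finally show ?case using elim(1) by (auto simp: emeasure_eq_measure)
    qed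
  qed
  also have "\<dots> = ennreal q * emeasure (distr M S Y) F" using F by (simp add: nn_integral_cmult_indicator)
  also have "\<dots> = ennreal q * ennreal (prob {\<omega> \<in> space M. Y \<omega> \<in> F})"
    by (subst emeasure_distr[OF Y F]) (auto simp: emeasure_eq_measure intro!: arg_cong[where f
        = prob] arg_cong2[where f = "(*)"])
  also have "\<dots> = ennreal (prob {\<omega> \<in> space M. Y \<omega> \<in> F} * q)" using q0 by (simp add: ennreal_mult mult.commute)
  finally show ?thesis using q0 by simp
qed

lemma mat_lprod_cong:
  "(\<And>j. 1 \<le> j \<Longrightarrow> j \<le> k \<Longrightarrow> A j = B j) \<Longrightarrow> mat_lprod n A k = mat_lprod n B k"
  by (induction k) auto

lemma mat_lprod_measurable:
  fixes A :: "nat \<Rightarrow> 'w \<Rightarrow> 'p::prime_card padic_int mat"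
  assumes "\<And>j. 1 \<le> j \<Longrightarrow> j \<le> k \<Longrightarrow> A j \<in> measurable M (mat_borel n)"
  shows "(\<lambda>\<omega>. mat_lprod n (\<lambda>j. A j \<omega>) k) \<in> measurable M (mat_borel n)"
  using assms by (induction k) (auto intro!: mat_borel_mult)

lemma regular_one: "regular_below n n (1\<^sub>m n :: 'p::prime_card padic_int mat)" and depth_one:
    "i < n \<Longrightarrow> depth n i (1\<^sub>m n :: 'p padic_int mat) = 0"
proof -
  have *: "depth_ge n i m (1\<^sub>m n :: 'p padic_int mat) \<longleftrightarrow> m \<le> 0" "depth n i (1\<^sub>m n :: 'p padic_int mat) = 0"
      if "i < n" for i m
    by (rule depth_eq[where u = 1 and U = "1\<^sub>m n"]; use that in auto)+
  show "regular_below n n (1\<^sub>m n :: 'p padic_int mat)" unfolding regular_below_def using *(1)[of _ 1] by auto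
  show "i < n \<Longrightarrow> depth n i (1\<^sub>m n :: 'p padic_int mat) = 0" by (rule *(2))
qed

text \<open>The increment at step \<open>k + 1\<close> depends on the past only through the product \<open>P k\<close>, and its conditional law does
  not depend on \<open>P k\<close> at all. Hence it is independent of the past, and in particular of each earlier
  increment, so that the strong law for geometric tails applies.\<close>

lemma depth_increments_slln:
  fixes A :: "nat \<Rightarrow> 'w \<Rightarrow> 'p::prime_card padic_int mat"
  assumes prob: "prob_space M"
    and indep: "prob_space.indep_vars M (\<lambda>_. mat_borel n) A {1..}"
    and law: "\<And>j. 1 \<le> j \<Longrightarrow> corner_or_iid M n (N j) (A j)"
    and N: "\<And>j. 1 \<le> j \<Longrightarrow> enat n < N j"
  defines "P \<equiv> \<lambda>k \<omega>. mat_lprod n (\<lambda>j. A j \<omega>) k"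
  shows "AE \<omega> in M. \<forall>k. regular_below n n (P k \<omega>)"
    and "i < n \<Longrightarrow> AE \<omega> in M. (\<lambda>k. ((\<Sum>j=1..k. real (depth n i (P j \<omega>) - depth n i (P (j - 1) \<omega>)))
       - (\<Sum>j=1..k. corner_factor CARD('p) n i (N j) * ((1 / real CARD('p)) ^ (n - i) / (1 - (1 / real CARD('p)) ^ (n - i))))) / real k) \<longlonglongrightarrow> 0"
proof -
  interpret prob_space M by fact
  have p1: "CARD('p) > 1" using prime_card_gt_1[where 'p='p] by simp
  have A: "A j \<in> measurable M (mat_borel n)" if "1 \<le> j" for j using law[OF that]
      by (simp add: corner_or_iid_def)
  have P: "P k \<in> measurable M (mat_borel n)" for k
    unfolding P_def by (rule mat_lprod_measurable) (rule A)
  define S where "S k = (\<Pi>\<^sub>M j\<in>{1..k}. mat_borel n :: 'p padic_int mat measure)" for k :: nat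
  define past where "past k \<omega> = (\<lambda>j\<in>{1..k}. A j \<omega>)" for k \<omega>
  \<comment> \<open>The partial products as functions of the past factors, for all times up to \<open>k\<close> at once.\<close>
  define Pf where "Pf l y = mat_lprod n y l" for l and y :: "nat \<Rightarrow> 'p padic_int mat"
  have Pf: "Pf l \<in> measurable (S k) (mat_borel n)" if "l \<le> k" for l k
    unfolding Pf_def S_def by (rule mat_lprod_measurable, rule measurable_component_singleton) (use that in auto)
  have Ppast: "P l \<omega> = Pf l (past k \<omega>)" if "l \<le> k" for l k \<omega>
    unfolding P_def Pf_def past_def by (rule mat_lprod_cong) (use that in auto)
  define T where "T k = (\<Pi>\<^sub>M j\<in>{Suc k}. mat_borel n :: 'p padic_int mat measure)" for k
  define now where "now k \<omega> = (\<lambda>j\<in>{Suc k}. A j \<omega>)" for k \<omega>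
  have now: "now k \<omega> (Suc k) = A (Suc k) \<omega>" for k \<omega> by (simp add: now_def)
  have ind: "indep_var (S k) (past k) (T k) (now k)" for k
    unfolding S_def T_def past_def now_def by (rule indep_var_restrict[OF indep]) auto
  have prodm: "(\<lambda>x. snd x (Suc k) * Pf k (fst x)) \<in> measurable (S k \<Otimes>\<^sub>M T k) (mat_borel n)" for k
    by (intro mat_borel_mult measurable_compose[OF measurable_snd] measurable_compose[OF measurable_fst Pf])
      (simp_all add: T_def)
  have pastm: "past k \<in> measurable M (S k)" for k using ind[of k] by (rule indep_var_rv1)
  have nowm: "now k \<in> measurable M (T k)" for k using ind[of k] by (rule indep_var_rv2)
  have PSuc: "P (Suc k) \<omega> = A (Suc k) \<omega> * Pf k (past k \<omega>)" for k \<omega>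
    using Ppast[of k k \<omega>] by (simp add: P_def)
  have Pfc: "Pf k y \<in> carrier_mat n n" if "y \<in> space (S k)" for k y
    using measurable_space[OF Pf[OF order_refl] that] by simp
  have AEreg: "AE \<omega> in M. regular_below n n (P k \<omega>)" for k
  proof (induction k)
    case 0 show ?case by (simp add: P_def regular_one)
  next
    case (Suc k)
    have regS: "{y \<in> space (S k). regular_below n n (Pf k y)} \<in> sets (S k)"
        by (rule regular_below_sets[OF Pf]) auto
    have AEy: "AE y in distr M (S k) (past k). regular_below n n (Pf k y)"
      by (subst AE_distr_iff[OF pastm regS]) (use Suc in \<open>simp add: Ppast[of k k, symmetric]\<close>)
    define Q where "Q = {x \<in> space (S k \<Otimes>\<^sub>M T k). \<not> regular_below n n (snd x (Suc k) * Pf k (fst x))}"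
    have Q: "Q \<in> sets (S k \<Otimes>\<^sub>M T k)" unfolding Q_def
      by (rule sets.sets_Collect_neg, rule regular_below_sets[OF prodm]) simp
    have "prob {\<omega> \<in> space M. past k \<omega> \<in> space (S k) \<and> (past k \<omega>, now k \<omega>) \<in> Q}
        = prob {\<omega> \<in> space M. past k \<omega> \<in> space (S k)} * 0"
    proof (rule indep_var_constant_sections[OF ind _ Q])
      show "AE y in distr M (S k) (past k). measure M {\<omega> \<in> space M. (y, now k \<omega>) \<in> Q} = 0"
        using AEy AE_space
      proof eventually_elim
        case (elim y)
        then have y: "y \<in> space (S k)" by simp
        have "AE \<omega> in M. regular_below n n (A (Suc k) \<omega> * Pf k y)"
          by (rule increment_law(1)[OF prob law N Pfc[OF y] elim(1)]) auto
        then have "AE \<omega> in M. \<omega> \<notin> {\<omega> \<in> space M. (y, now k \<omega>) \<in> Q}" by eventually_elim (simp add: Q_def now)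
        moreover have "{\<omega> \<in> space M. (y, now k \<omega>) \<in> Q} \<in> sets M"
        proof -
          have "(\<lambda>\<omega>. (y, now k \<omega>)) \<in> measurable M (S k \<Otimes>\<^sub>M T k)" using y nowm[of k] by simp
          from measurable_sets[OF this Q] show ?thesis by (simp add: vimage_def Int_def conj_commute)
        qed
        ultimately show ?case by (simp add: prob_eq_0)
      qed
    qed simp
    then have "prob {\<omega> \<in> space M. (past k \<omega>, now k \<omega>) \<in> Q} = 0"
      using measurable_space[OF pastm[of k]] by (simp cong: conj_cong)
    moreover have "{\<omega> \<in> space M. (past k \<omega>, now k \<omega>) \<in> Q} = {\<omega> \<in> space M. \<not> regular_below n n (P (Suc k) \<omega>)}"
      using measurable_space[OF pastm[of k]] measurable_space[OF nowm[of k]]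
          by (auto simp: Q_def PSuc now space_pair_measure)
    ultimately have "prob {\<omega> \<in> space M. \<not> regular_below n n (P (Suc k) \<omega>)} = 0" by simp
    moreover have "{\<omega> \<in> space M. \<not> regular_below n n (P (Suc k) \<omega>)} \<in> sets M"
      by (rule sets.sets_Collect_neg[OF regular_below_sets[OF P]]) simp
    ultimately have "AE \<omega> in M. \<omega> \<notin> {\<omega> \<in> space M. \<not> regular_below n n (P (Suc k) \<omega>)}" by (simp add: prob_eq_0)
    then show ?case using AE_space by eventually_elim auto
  qed
  then show "AE \<omega> in M. \<forall>k. regular_below n n (P k \<omega>)" by (simp add: AE_all_countable)
  assume i: "i < n"
  define x where "x = (1 / real CARD('p)) ^ (n - i)"
  have x: "0 \<le> x" "x < 1" using p1 i unfolding x_def by (auto intro!: power_less_one_iff[THEN iffD2])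
  define X where "X j \<omega> = depth n i (P j \<omega>) - depth n i (P (j - 1) \<omega>)" for j \<omega>
  have dm: "(\<lambda>\<omega>. depth n i (P k \<omega>)) \<in> measurable M (count_space UNIV)" for k by (rule depth_measurable[OF P i])
  have Xm: "X j \<in> measurable M (count_space UNIV)" for j
    unfolding X_def
    by (rule measurable_compose_countable[OF _ dm[of j]], rule measurable_compose[OF dm[of "j - 1"]]) simp
  \<comment> \<open>The increment at step \<open>k + 1\<close> is independent of every event \<open>F\<close> of the past.\<close>
  have key: "prob {\<omega> \<in> space M. past k \<omega> \<in> F \<and> b \<le> X (Suc k) \<omega>}
      = prob {\<omega> \<in> space M. past k \<omega> \<in> F} * (corner_factor CARD('p) n i (N (Suc k)) * x ^ b)"
    if F: "F \<in> sets (S k)" and b: "b \<ge> 1" for k F b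
  proof -
    define Q where "Q = {z \<in> space (S k \<Otimes>\<^sub>M T k). b
        \<le> depth n i (snd z (Suc k) * Pf k (fst z)) - depth n i (Pf k (fst z))}"
    have "(\<lambda>z. depth n i (snd z (Suc k) * Pf k (fst z))) \<in> measurable (S k \<Otimes>\<^sub>M T k) (count_space UNIV)"
      by (rule depth_measurable[OF prodm i])
    moreover have "(\<lambda>z. depth n i (Pf k (fst z))) \<in> measurable (S k \<Otimes>\<^sub>M T k) (count_space UNIV)"
      by (rule depth_measurable[OF measurable_compose[OF measurable_fst Pf] i]) simp
    ultimately have Q: "Q \<in> sets (S k \<Otimes>\<^sub>M T k)" unfolding Q_def by measurable
    have regS: "{y \<in> space (S k). regular_below n n (Pf k y)} \<in> sets (S k)"
        by (rule regular_below_sets[OF Pf]) auto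
    have AEy: "AE y in distr M (S k) (past k). regular_below n n (Pf k y)"
      by (subst AE_distr_iff[OF pastm regS]) (use AEreg[of k] in \<open>simp add: Ppast[of k k, symmetric]\<close>)
    have "prob {\<omega> \<in> space M. past k \<omega> \<in> F \<and> (past k \<omega>, now k \<omega>) \<in> Q}
        = prob {\<omega> \<in> space M. past k \<omega> \<in> F} * (corner_factor CARD('p) n i (N (Suc k)) * x ^ b)"
    proof (rule indep_var_constant_sections[OF ind F Q])
      show "AE y in distr M (S k) (past k). measure M {\<omega> \<in> space M. (y, now k \<omega>) \<in> Q}
          = corner_factor CARD('p) n i (N (Suc k)) * x ^ b"
        using AEy AE_space
      proof eventually_elim
        case (elim y)
        then have y: "y \<in> space (S k)" by simp
        have "{\<omega> \<in> space M. (y, now k \<omega>) \<in> Q}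
            = {\<omega> \<in> space M. b \<le> depth n i (A (Suc k) \<omega> * Pf k y) - depth n i (Pf k y)}"
          using y measurable_space[OF nowm[of k]] by (auto simp: Q_def now space_pair_measure)
        then show ?case unfolding x_def
          using increment_law(2)[OF prob law N Pfc[OF y] elim(1) i b] by simp
      qed
    qed
    moreover have "{\<omega> \<in> space M. past k \<omega> \<in> F \<and> (past k \<omega>, now k \<omega>) \<in> Q}
        = {\<omega> \<in> space M. past k \<omega> \<in> F \<and> b \<le> X (Suc k) \<omega>}"
      using measurable_space[OF pastm[of k]] measurable_space[OF nowm[of k]]
      by (auto simp: Q_def X_def PSuc now Ppast[of k k] space_pair_measure)
    ultimately show ?thesis by simp
  qed
  have tail: "prob {\<omega> \<in> space M. m \<le> X j \<omega>} = corner_factor CARD('p) n i (N j) * x ^ m" if "j \<ge> 1" "m \<ge> 1"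
      for j m
  proof -
    obtain k where j: "j = Suc k" using \<open>j \<ge> 1\<close> by (cases j) auto
    have "{\<omega> \<in> space M. past k \<omega> \<in> space (S k) \<and> m \<le> X (Suc k) \<omega>} = {\<omega> \<in> space M. m \<le> X j \<omega>}"
      "{\<omega> \<in> space M. past k \<omega> \<in> space (S k)} = space M"
      using measurable_space[OF pastm[of k]] by (auto simp: j)
    then show ?thesis using key[of "space (S k)" k m] that by (simp add: prob_space j)
  qed
  have pair: "prob {\<omega> \<in> space M. a \<le> X j \<omega> \<and> b \<le> X k \<omega>}
      = prob {\<omega> \<in> space M. a \<le> X j \<omega>} * prob {\<omega> \<in> space M. b \<le> X k \<omega>}"
    if "1 \<le> j" "j < k" "a \<ge> 1" "b \<ge> 1" for j k a b
  proof -
    obtain l where k: "k = Suc l" using \<open>j < k\<close> by (cases k) auto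
    have jl: "j \<le> l" "j - 1 \<le> l" using that k by auto
    define F where "F = {y \<in> space (S l). a \<le> depth n i (Pf j y) - depth n i (Pf (j - 1) y)}"
    have "(\<lambda>y. depth n i (Pf j y)) \<in> measurable (S l) (count_space UNIV)"
      "(\<lambda>y. depth n i (Pf (j - 1) y)) \<in> measurable (S l) (count_space UNIV)"
      by (rule depth_measurable[OF Pf[OF jl(1)] i], rule depth_measurable[OF Pf[OF jl(2)] i])
    then have F: "F \<in> sets (S l)" unfolding F_def by measurable
    have e: "past l \<omega> \<in> F \<longleftrightarrow> a \<le> X j \<omega>" if "\<omega> \<in> space M" for \<omega>
      using measurable_space[OF pastm that, of l] unfolding F_def X_def Ppast[OF jl(1)] Ppast[OF jl(2)] by simp
    have "{\<omega> \<in> space M. past l \<omega> \<in> F \<and> b \<le> X (Suc l) \<omega>} = {\<omega> \<in> space M. a \<le> X j \<omega> \<and> b \<le> X k \<omega>}"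
      "{\<omega> \<in> space M. past l \<omega> \<in> F} = {\<omega> \<in> space M. a \<le> X j \<omega>}" using e by (auto simp: k)
    then show ?thesis using key[OF F that(4)] tail[of k b] that by (simp add: k)
  qed
  have "AE \<omega> in M. (\<lambda>k. ((\<Sum>j=1..k. real (X j \<omega>)) - (\<Sum>j=1..k. corner_factor CARD('p) n i (N j) * (x / (1 - x)))) / real k) \<longlonglongrightarrow> 0"
    by (rule slln_geometric_tails[OF Xm x _ _ tail pair]) (use corner_factor_bounds[OF p1 i N] in auto)
  then show "AE \<omega> in M. (\<lambda>k. ((\<Sum>j=1..k. real (depth n i (P j \<omega>) - depth n i (P (j - 1) \<omega>)))
       - (\<Sum>j=1..k. corner_factor CARD('p) n i (N j) * ((1 / real CARD('p)) ^ (n - i) / (1 - (1 / real CARD('p)) ^ (n - i))))) / real k) \<longlonglongrightarrow> 0"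
    unfolding X_def x_def .
qed

text \<open>The depths do not decrease, so that truncated subtraction of natural numbers is harmless.\<close>

lemma depth_telescope:
  fixes A :: "nat \<Rightarrow> 'p::prime_card padic_int mat"
  assumes A: "\<And>j. 1 \<le> j \<Longrightarrow> A j \<in> carrier_mat n n"
    and reg: "\<And>k. regular_below n n (mat_lprod n A k)" and i: "i < n"
  shows "(\<Sum>j=1..k. real (depth n i (mat_lprod n A j) - depth n i (mat_lprod n A (j - 1))))
      = real (depth n i (mat_lprod n A k))"
proof (induction k)
  case 0 show ?case using i by (simp add: depth_one)
next
  case (Suc k)
  have P: "mat_lprod n A k \<in> carrier_mat n n"
  proof -
    have "mat_lprod n A k = mat_lprod n (\<lambda>j. if j = 0 then 1\<^sub>m n else A j) k" by (rule mat_lprod_cong) auto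
    also have "\<dots> \<in> carrier_mat n n" by (rule mat_lprod_carrier) (use A in auto)
    finally show ?thesis .
  qed
  obtain U where U: "U \<in> GL n" "\<forall>l<n. \<forall>r<n. l < r \<longrightarrow> (U * mat_lprod n A k) $$ (r, l) = 0"
      using triangularize[OF P] by blast
  then have Ut: "\<And>l r. l < r \<Longrightarrow> r < n \<Longrightarrow> (U * mat_lprod n A k) $$ (r, l) = 0" by simp
  obtain V where V: "V \<in> GL n" "V * U = 1\<^sub>m n" using GL_obtain_inverse[OF U(1)] by metis
  have "depth n i (mat_lprod n A k) \<le> depth n i (A (Suc k) * mat_lprod n A k)"
    by (rule depth_of_product(3)[OF A P reg U(1) Ut V _ i]) (use reg[of "Suc k"] in auto)
  then show ?case using Suc by simp
qed

section \<open>Frequencies and rates\<close>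

text \<open>Only finitely many values \<open>m\<close> have \<open>g m\<close> larger than a given \<open>\<epsilon>\<close>, and for these the frequencies
  converge. This remains true if the frequencies \<open>\<rho>\<close> add up to less than \<open>1\<close>: the lost mass escapes to
  larger and larger values of \<open>m\<close>, where \<open>g\<close> vanishes in the limit.\<close>

lemma frequency_average:
  fixes N :: "nat \<Rightarrow> enat" and \<rho> :: "enat \<Rightarrow> real" and g :: "enat \<Rightarrow> real"
  assumes N: "\<And>j. 1 \<le> j \<Longrightarrow> enat n < N j"
    and freq: "\<And>m. enat n < m \<Longrightarrow> (\<lambda>k. real (card {j \<in> {1..k}. N j = m}) / real k) \<longlonglongrightarrow> \<rho> m"
    and g: "\<And>m. enat n < m \<Longrightarrow> 0 \<le> g m" "g \<infinity> = 0" "(\<lambda>m. g (enat m)) \<longlonglongrightarrow> 0"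
  shows "(\<lambda>m. \<rho> m * g m) summable_on {m. enat n < m}"
    and "(\<lambda>k. (\<Sum>j=1..k. g (N j)) / real k) \<longlonglongrightarrow> (\<Sum>\<^sub>\<infinity>m\<in>{m. enat n < m}. \<rho> m * g m)"
    and "\<And>b. (\<And>m. enat n < m \<Longrightarrow> g m \<le> b) \<Longrightarrow> 0 \<le> b \<Longrightarrow> (\<Sum>\<^sub>\<infinity>m\<in>{m. enat n < m}. \<rho> m * g m) \<le> b"
proof -
  define T where "T = {m. enat n < m}"
  have \<rho>0: "0 \<le> \<rho> m" if "m \<in> T" for m
    by (rule LIMSEQ_le_const[OF freq]) (use that in \<open>auto simp: T_def\<close>)
  have cardle: "(\<Sum>m\<in>F. real (card {j \<in> {1..k}. N j = m})) \<le> real k" if "finite F" for F k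
  proof -
    have "(\<Sum>m\<in>F. card {j \<in> {1..k}. N j = m}) = card (\<Union>m\<in>F. {j \<in> {1..k}. N j = m})"
      using that by (subst card_UN_disjoint) auto
    also have "\<dots> \<le> card {1..k}" by (rule card_mono) auto
    finally show ?thesis by (simp flip: of_nat_sum)
  qed
  have \<rho>1: "(\<Sum>m\<in>F. \<rho> m) \<le> 1" if "finite F" "F \<subseteq> T" for F
  proof (rule LIMSEQ_le_const2)
    show "(\<lambda>k. \<Sum>m\<in>F. real (card {j \<in> {1..k}. N j = m}) / real k) \<longlonglongrightarrow> (\<Sum>m\<in>F. \<rho> m)"
      using that by (intro tendsto_sum freq) (auto simp: T_def)
    have "(\<Sum>m\<in>F. real (card {j \<in> {1..k}. N j = m}) / real k) \<le> 1" for k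
      using cardle[OF that(1), of k] by (cases "k = 0") (simp_all flip: sum_divide_distrib)
    then show "\<exists>K. \<forall>k\<ge>K. (\<Sum>m\<in>F. real (card {j \<in> {1..k}. N j = m}) / real k) \<le> 1" by blast
  qed
  have bound: "(\<Sum>m\<in>F. \<rho> m * g m) \<le> b" if "finite F" "F \<subseteq> T" "\<And>m. m \<in> F \<Longrightarrow> g m \<le> b" "0 \<le> b" for F b
  proof -
    have "(\<Sum>m\<in>F. \<rho> m * g m) \<le> (\<Sum>m\<in>F. \<rho> m * b)"
      using that \<rho>0 by (intro sum_mono mult_left_mono) auto
    also have "\<dots> = (\<Sum>m\<in>F. \<rho> m) * b" by (simp add: sum_distrib_right)
    also have "\<dots> \<le> 1 * b" using \<rho>1[OF that(1,2)] that(4) by (intro mult_right_mono) auto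
    finally show ?thesis by simp
  qed
  obtain B where B: "\<And>m. \<bar>g (enat m)\<bar> \<le> B" using g(3)
      by (metis Bseq_def convergentI convergent_imp_Bseq real_norm_def)
  have gB: "g m \<le> max B 0" for m using B g(2) by (cases m) (auto simp: abs_le_iff le_max_iff_disj)
  have nn: "0 \<le> \<rho> m * g m" if "m \<in> T" for m using \<rho>0[OF that] g(1) that by (auto simp: T_def)
  have summ: "(\<lambda>m. \<rho> m * g m) summable_on T"
    by (rule nonneg_bdd_above_summable_on[OF nn]) (auto intro!: bdd_aboveI2[where M = "max B 0"] bound gB)
  then show "(\<lambda>m. \<rho> m * g m) summable_on {m. enat n < m}" by (simp add: T_def)
  show "(\<Sum>\<^sub>\<infinity>m\<in>{m. enat n < m}. \<rho> m * g m) \<le> b" if "\<And>m. enat n < m \<Longrightarrow> g m \<le> b" "0 \<le> b" for b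
    unfolding T_def[symmetric] by (rule infsum_le_finite_sums[OF summ bound]) (use that in \<open>auto simp: T_def\<close>)
  show "(\<lambda>k. (\<Sum>j=1..k. g (N j)) / real k) \<longlonglongrightarrow> (\<Sum>\<^sub>\<infinity>m\<in>{m. enat n < m}. \<rho> m * g m)"
    unfolding T_def[symmetric] LIMSEQ_iff
  proof (intro allI impI)
    fix r :: real assume r: "r > 0"
    define \<epsilon> where "\<epsilon> = r / 4"
    have \<epsilon>: "\<epsilon> > 0" using r by (simp add: \<epsilon>_def)
    obtain K where K: "\<And>m. m \<ge> K \<Longrightarrow> \<bar>g (enat m)\<bar> < \<epsilon>" using g(3) \<epsilon> unfolding LIMSEQ_iff by force
    \<comment> \<open>Outside the finite set \<open>F\<close> the function \<open>g\<close> is at most \<open>\<epsilon>\<close>.\<close>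
    define F where "F = enat ` {n<..<K}"
    have F: "finite F" "F \<subseteq> T" by (auto simp: F_def T_def)
    have small: "g m \<le> \<epsilon>" if m: "m \<in> T - F" for m
    proof (cases m)
      case (enat m')
      then have "m' \<ge> K" using m by (auto simp: F_def T_def)
      then show ?thesis using K[of m'] enat by simp
    qed (use g(2) \<epsilon> in simp)
    have s1: "\<bar>(\<Sum>\<^sub>\<infinity>m\<in>T. \<rho> m * g m) - (\<Sum>m\<in>F. \<rho> m * g m)\<bar> \<le> \<epsilon>"
    proof -
      have sT: "(\<lambda>m. \<rho> m * g m) summable_on (T - F)" by (rule summable_on_subset_banach[OF summ]) auto
      have "(\<Sum>\<^sub>\<infinity>m\<in>T. \<rho> m * g m) = (\<Sum>\<^sub>\<infinity>m\<in>F \<union> (T - F). \<rho> m * g m)" using F(2)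
          by (intro arg_cong2[where f = infsum]) auto
      also have "\<dots> = (\<Sum>\<^sub>\<infinity>m\<in>F. \<rho> m * g m) + (\<Sum>\<^sub>\<infinity>m\<in>T - F. \<rho> m * g m)"
        by (rule infsum_Un_disjoint) (use F sT in auto)
      also have "(\<Sum>\<^sub>\<infinity>m\<in>F. \<rho> m * g m) = (\<Sum>m\<in>F. \<rho> m * g m)" using F(1) by simp
      finally have "(\<Sum>\<^sub>\<infinity>m\<in>T. \<rho> m * g m) - (\<Sum>m\<in>F. \<rho> m * g m) = (\<Sum>\<^sub>\<infinity>m\<in>T - F. \<rho> m * g m)" by simp
      moreover have "0 \<le> (\<Sum>\<^sub>\<infinity>m\<in>T - F. \<rho> m * g m)" by (rule infsum_nonneg) (use nn in auto)
      moreover have "(\<Sum>\<^sub>\<infinity>m\<in>T - F. \<rho> m * g m) \<le> \<epsilon>"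
        by (rule infsum_le_finite_sums[OF sT bound]) (use small \<epsilon> in auto)
      ultimately show ?thesis by simp
    qed
    have "(\<lambda>k. \<Sum>m\<in>F. real (card {j \<in> {1..k}. N j = m}) / real k * g m) \<longlonglongrightarrow> (\<Sum>m\<in>F. \<rho> m * g m)"
      using F(2) by (intro tendsto_sum tendsto_mult tendsto_const freq) (auto simp: T_def)
    from LIMSEQ_D[OF this \<epsilon>] obtain k0 where k0: "\<And>k. k \<ge> k0 \<Longrightarrow>
        norm ((\<Sum>m\<in>F. real (card {j \<in> {1..k}. N j = m}) / real k * g m) - (\<Sum>m\<in>F. \<rho> m * g m)) < \<epsilon>"
      by blast
    have s2: "\<bar>(\<Sum>j=1..k. g (N j)) / real k - (\<Sum>m\<in>F. real (card {j \<in> {1..k}. N j = m}) / real k * g m)\<bar>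
        \<le> \<epsilon>" for k
    proof (cases "k = 0")
      case False
      let ?I = "{j \<in> {1..k}. N j \<in> F}"
      have "(\<Sum>j=1..k. g (N j)) = (\<Sum>j\<in>?I. g (N j)) + (\<Sum>j\<in>{1..k} - ?I. g (N j))"
        by (subst add.commute, rule sum.subset_diff) auto
      also have "(\<Sum>j\<in>?I. g (N j)) = (\<Sum>m\<in>F. \<Sum>j\<in>{j \<in> ?I. N j = m}. g (N j))"
        using F(1) by (intro sum.group[symmetric]) auto
      also have "\<dots> = (\<Sum>m\<in>F. real (card {j \<in> {1..k}. N j = m}) * g m)"
      proof (rule sum.cong)
        fix m assume "m \<in> F"
        then have "{j \<in> ?I. N j = m} = {j \<in> {1..k}. N j = m}" by auto
        then show "(\<Sum>j\<in>{j \<in> ?I. N j = m}. g (N j)) = real (card {j \<in> {1..k}. N j = m}) * g m" by simp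
      qed simp
      finally have e: "(\<Sum>j=1..k. g (N j)) - (\<Sum>m\<in>F. real (card {j \<in> {1..k}. N j = m}) * g m)
          = (\<Sum>j\<in>{1..k} - ?I. g (N j))" by simp
      have inT: "N j \<in> T - F" if "j \<in> {1..k} - ?I" for j using that N by (auto simp: T_def)
      have "(\<Sum>j\<in>{1..k} - ?I. g (N j)) \<le> (\<Sum>j\<in>{1..k} - ?I. \<epsilon>)" using small inT by (intro sum_mono) auto
      also have "\<dots> \<le> (\<Sum>j\<in>{1..k}. \<epsilon>)" using \<epsilon> by (intro sum_mono2) auto
      finally have up: "(\<Sum>j\<in>{1..k} - ?I. g (N j)) \<le> real k * \<epsilon>" by simp
      have low: "0 \<le> (\<Sum>j\<in>{1..k} - ?I. g (N j))" using g(1) inT by (intro sum_nonneg) (auto simp: T_def)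
      have "(\<Sum>j=1..k. g (N j)) / real k - (\<Sum>m\<in>F. real (card {j \<in> {1..k}. N j = m}) / real k * g m)
         = (\<Sum>j\<in>{1..k} - ?I. g (N j)) / real k"
        unfolding e[symmetric] by (simp add: diff_divide_distrib sum_divide_distrib)
      then show ?thesis using up low False by (simp add: divide_le_eq mult.commute)
    qed (use \<epsilon> in simp)
    have "norm ((\<Sum>j=1..k. g (N j)) / real k - (\<Sum>\<^sub>\<infinity>m\<in>T. \<rho> m * g m)) < r" if "k \<ge> k0" for k
      using s1 s2[of k] k0[OF that, unfolded real_norm_def] \<epsilon> unfolding \<epsilon>_def real_norm_def by linarith
    then show "\<exists>no. \<forall>k\<ge>no. norm ((\<Sum>j=1..k. g (N j)) / real k - (\<Sum>\<^sub>\<infinity>m\<in>T. \<rho> m * g m)) < r" by blast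
  qed
qed

lemma gap_weight_enat:
  assumes "n < N'" shows "gap_weight p n (enat N') = (1 / real p) ^ (N' - n)"
proof -
  have "int N' - int n = int (N' - n)" using assms by simp
  then have "gap_weight p n (enat N') = real p powi (- int (N' - n))"
    by (simp only: gap_weight_def enat.case)
  also have "\<dots> = (1 / real p) ^ (N' - n)"
    by (simp only: power_int_minus power_int_of_nat power_one_over inverse_eq_divide)
  finally show ?thesis .
qed

text \<open>With \<open>x = p\<^bsup>-(n-i)\<^esup>\<close> and \<open>w = p\<^bsup>-(N-n)\<^esup>\<close> the difference \<open>1 - corner_factor\<close> equals
  \<open>w (1 - x) / (1 - x w)\<close>, and the denominator lies between \<open>1 - x\<close> and \<open>1\<close>.\<close>

lemma corner_factor_gap:
  assumes p: "p > 1" and i: "i < n" and N: "enat n < N"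
  shows "(1 - (1 / real p) ^ (n - i)) * gap_weight p n N \<le> 1 - corner_factor p n i N"
    and "1 - corner_factor p n i N \<le> gap_weight p n N"
proof -
  have "(1 - (1 / real p) ^ (n - i)) * gap_weight p n N \<le> 1 - corner_factor p n i N
      \<and> 1 - corner_factor p n i N \<le> gap_weight p n N"
  proof (cases N)
    case (enat N')
    then have nN: "n < N'" using N by simp
    define x where "x = (1 / real p) ^ (n - i)"
    define w where "w = (1 / real p) ^ (N' - n)"
    define d where "d = 1 - x * w"
    have xw: "(1 / real p) ^ (N' - i) = x * w" unfolding x_def w_def using i nN by (simp flip: power_add)
    have w: "0 < w" "w < 1" unfolding w_def using p nN by (auto intro!: power_less_one_iff[THEN iffD2])
    have x: "0 < x" "x < 1" unfolding x_def using p i by (auto intro!: power_less_one_iff[THEN iffD2])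
    have xw1: "x * w \<le> x" using w x by (simp add: mult_le_cancel_left1)
    have d: "0 < d" "d \<le> 1" "1 - x \<le> d" unfolding d_def using x w xw1 mult_pos_pos[OF x(1) w(1)] by linarith+
    have s: "1 - corner_factor p n i N = w * (1 - x) / d"
    proof -
      have "corner_factor p n i N = (1 - w) / d"
        unfolding enat corner_factor_def d_def by (simp only: enat.case xw w_def)
      moreover have "1 - (1 - w) / d = (d - (1 - w)) / d" using d by (simp add: diff_divide_distrib)
      moreover have "d - (1 - w) = w * (1 - x)" by (simp add: d_def algebra_simps)
      ultimately show ?thesis by simp
    qed
    have "w * (1 - x) \<le> w * (1 - x) / d" using d w x by (simp add: le_divide_eq mult_le_cancel_left1)
    moreover have "w * (1 - x) / d \<le> w" using d w by (simp add: divide_le_eq)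
    ultimately show ?thesis unfolding s by (simp add: enat gap_weight_enat[OF nN] x_def w_def mult.commute)
  next
    case infinity then show ?thesis by (simp add: corner_factor_def gap_weight_def)
  qed
  then show "(1 - (1 / real p) ^ (n - i)) * gap_weight p n N \<le> 1 - corner_factor p n i N"
      "1 - corner_factor p n i N \<le> gap_weight p n N" by auto
qed

lemma gap_weight_bounds:
  assumes p: "p > 1" and N: "enat n < N"
  shows "0 \<le> gap_weight p n N" "gap_weight p n N \<le> 1 / 2"
proof -
  have "0 \<le> gap_weight p n N \<and> gap_weight p n N \<le> 1 / 2"
  proof (cases N)
    case (enat N')
    then have nN: "n < N'" using N by simp
    have "(1 / real p) ^ (N' - n) \<le> (1 / real p) ^ 1" using p nN by (intro power_decreasing) auto
    also have "\<dots> \<le> 1 / 2" using p by (simp add: divide_le_eq)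
    finally show ?thesis by (simp add: enat gap_weight_enat[OF nN])
  next
    case infinity then show ?thesis by (simp add: gap_weight_def)
  qed
  then show "0 \<le> gap_weight p n N" "gap_weight p n N \<le> 1 / 2" by auto
qed

lemma gap_weight_tendsto_0:
  assumes p: "p > 1" shows "(\<lambda>m. gap_weight p n (enat m)) \<longlonglongrightarrow> 0"
proof (rule LIMSEQ_offset[where k = "Suc n"])
  have "(\<lambda>m. (1 / real p) ^ Suc m) \<longlonglongrightarrow> 0"
    by (rule LIMSEQ_Suc, rule LIMSEQ_realpow_zero) (use p in auto)
  then show "(\<lambda>m. gap_weight p n (enat (m + Suc n))) \<longlonglongrightarrow> 0"
    by (simp add: gap_weight_enat)
qed

lemma corner_factor_tendsto_1:
  assumes p: "p > 1" and i: "i < n" shows "(\<lambda>m. 1 - corner_factor p n i (enat m)) \<longlonglongrightarrow> 0"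
proof (rule tendsto_sandwich[OF _ _ tendsto_const gap_weight_tendsto_0[OF p, of n]])
  show "\<forall>\<^sub>F m in sequentially. 0 \<le> 1 - corner_factor p n i (enat m)"
    using eventually_gt_at_top[of n] by eventually_elim (use corner_factor_bounds(2)[OF p i] in auto)
  show "\<forall>\<^sub>F m in sequentially. 1 - corner_factor p n i (enat m) \<le> gap_weight p n (enat m)"
    using eventually_gt_at_top[of n] by eventually_elim (use corner_factor_gap(2)[OF p i] in auto)
qed

lemma corner_factor_mono:
  assumes p: "p > 1" and ij: "i \<le> j" "j < n" and N: "enat n < N"
  shows "corner_factor p n i N \<le> corner_factor p n j N"
proof (cases N)
  case (enat N')
  then have nN: "n < N'" using N by simp
  have a: "(1 / real p) ^ (N' - i) \<le> (1 / real p) ^ (N' - j)" using p ij nN by (intro power_decreasing) auto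
  have b: "(1 / real p) ^ (N' - j) < 1" using p ij nN by (intro power_less_one_iff[THEN iffD2]) auto
  have c: "(1 / real p) ^ (N' - n) \<le> 1" using p by (intro power_le_one) auto
  show ?thesis unfolding enat corner_factor_def using a b c by (simp add: frac_le)
qed (simp add: corner_factor_def)

context
  fixes N :: "nat \<Rightarrow> enat" and \<rho> :: "enat \<Rightarrow> real" and n p :: nat
  assumes p: "p > 1"
    and N: "\<And>j. 1 \<le> j \<Longrightarrow> enat n < N j"
    and freq: "\<And>m. enat n < m \<Longrightarrow> (\<lambda>k. real (card {j \<in> {1..k}. N j = m}) / real k) \<longlonglongrightarrow> \<rho> m"
begin

text \<open>The loss in the average of \<open>corner_factor\<close> compared with independent entries.\<close>

definition deficit :: "nat \<Rightarrow> real" where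
  "deficit i = (\<Sum>\<^sub>\<infinity>m\<in>{m. enat n < m}. \<rho> m * (1 - corner_factor p n i m))"

text \<open>A variable whose tail at \<open>m \<ge> 1\<close> is \<open>q x\<^sup>m\<close> has mean \<open>q x / (1 - x)\<close>; here \<open>x = p\<^bsup>-(n-i)\<^esup>\<close>
  and \<open>q\<close> is averaged over the steps.\<close>

definition rate :: "nat \<Rightarrow> real" where
  "rate i = (1 / real p) ^ (n - i) / (1 - (1 / real p) ^ (n - i)) * (1 - deficit i)"

lemma rho_nonneg: "enat n < m \<Longrightarrow> 0 \<le> \<rho> m"
  by (rule LIMSEQ_le_const[OF freq]) auto

lemma deficit_facts:
  assumes i: "i < n"
  shows "(\<lambda>m. \<rho> m * (1 - corner_factor p n i m)) summable_on {m. enat n < m}"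
    and "(\<lambda>k. (\<Sum>j=1..k. 1 - corner_factor p n i (N j)) / real k) \<longlonglongrightarrow> deficit i"
    and "deficit i \<le> 1"
proof -
  note g = frequency_average[where g =
      "\<lambda>m. 1 - corner_factor p n i m", OF N freq _ _ corner_factor_tendsto_1[OF p i]]
  show "(\<lambda>m. \<rho> m * (1 - corner_factor p n i m)) summable_on {m. enat n < m}"
    by (rule g(1)) (use corner_factor_bounds[OF p i] in \<open>auto simp: corner_factor_def\<close>)
  show "(\<lambda>k. (\<Sum>j=1..k. 1 - corner_factor p n i (N j)) / real k) \<longlonglongrightarrow> deficit i"
    unfolding deficit_def by (rule g(2)) (use corner_factor_bounds[OF p i] in \<open>auto simp: corner_factor_def\<close>)
  show "deficit i \<le> 1"
    unfolding deficit_def by (rule g(3)) (use corner_factor_bounds[OF p i] in \<open>auto simp: corner_factor_def\<close>)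
qed

lemma rate_mono:
  assumes ij: "i \<le> j" "j < n" shows "rate i \<le> rate j"
proof -
  have x: "(1 / real p) ^ (n - i) \<le> (1 / real p) ^ (n - j)" using p ij by (intro power_decreasing) auto
  have x1: "(1 / real p) ^ (n - j) < 1" using p ij by (intro power_less_one_iff[THEN iffD2]) auto
  have "deficit j \<le> deficit i" unfolding deficit_def
    by (rule infsum_mono[OF deficit_facts(1) deficit_facts(1)])
      (use ij corner_factor_mono[OF p ij] rho_nonneg in \<open>auto intro!: mult_left_mono\<close>)
  moreover have "deficit i \<le> 1" using deficit_facts(3) ij by simp
  moreover have "(1 / real p) ^ (n - i) / (1 - (1 / real p) ^ (n - i))
      \<le> (1 / real p) ^ (n - j) / (1 - (1 / real p) ^ (n - j))"
    using x x1 by (intro frac_le) auto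
  moreover have "0 \<le> (1 / real p) ^ (n - i) / (1 - (1 / real p) ^ (n - i))" using x x1
      by (intro divide_nonneg_nonneg) auto
  ultimately show ?thesis unfolding rate_def by (intro mult_mono) auto
qed

lemma average_rate:
  assumes i: "i < n"
  shows "(\<lambda>k. (\<Sum>j=1..k. corner_factor p n i (N j) * ((1 / real p) ^ (n - i) / (1 - (1 / real p) ^ (n - i)))) / real k) \<longlonglongrightarrow> rate i"
proof -
  define y where "y = (1 / real p) ^ (n - i) / (1 - (1 / real p) ^ (n - i))"
  have "(\<lambda>k. y * (1 - (\<Sum>j=1..k. 1 - corner_factor p n i (N j)) / real k)) \<longlonglongrightarrow> y * (1 - deficit i)"
    by (intro tendsto_intros deficit_facts(2)[OF i])
  moreover have "\<forall>\<^sub>F k in sequentially. y * (1 - (\<Sum>j=1..k. 1 - corner_factor p n i (N j)) / real k)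
      = (\<Sum>j=1..k. corner_factor p n i (N j) * y) / real k"
    using eventually_gt_at_top[of 0]
  proof eventually_elim
    case (elim k)
    have 1: "(\<Sum>j=1..k. 1 - corner_factor p n i (N j)) = real k - (\<Sum>j=1..k. corner_factor p n i (N j))"
        by (simp add: sum_subtractf)
    have 2: "(\<Sum>j=1..k. corner_factor p n i (N j) * y) = y * (\<Sum>j=1..k. corner_factor p n i (N j))"
        by (simp add: sum_distrib_left mult.commute)
    show ?case unfolding 1 2 using elim by (simp add: field_simps)
  qed
  ultimately show ?thesis unfolding rate_def y_def[symmetric] by (rule Lim_transform_eventually)
qed

text \<open>Weighting the bounds for \<open>1 - corner_factor\<close> by the frequencies shows that the deficit lies between
  \<open>(1 - x) c\<close> and \<open>c\<close>, where \<open>x = p\<^bsup>-(n-i)\<^esup>\<close>. As \<open>c \<le> 1/2\<close>, the quotient of \<open>1 - deficit\<close> by \<open>1 - c\<close>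
  lies between \<open>1\<close> and \<open>1 + x\<close>.\<close>

lemma rate_asymptotics:
  assumes i: "i < n" and c: "c = (\<Sum>\<^sub>\<infinity>m\<in>{m. enat n < m}. \<rho> m * gap_weight p n m)"
  shows "real p ^ i \<le> rate i / (real p powi (- int n) * (1 - c))"
    and "rate i / (real p powi (- int n) * (1 - c))
        \<le> real p ^ i * ((1 + (1 / real p) ^ (n - i)) / (1 - (1 / real p) ^ (n - i)))"
proof -
  define x where "x = (1 / real p) ^ (n - i)"
  have x: "0 < x" "x < 1" unfolding x_def using p i by (auto intro!: power_less_one_iff[THEN iffD2])
  note g = frequency_average[where g = "gap_weight p n", OF N freq _ _ gap_weight_tendsto_0[OF p]]
  have gs: "(\<lambda>m. \<rho> m * gap_weight p n m) summable_on {m. enat n < m}"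
    by (rule g(1)) (use gap_weight_bounds[OF p] in \<open>auto simp: gap_weight_def\<close>)
  have c2: "c \<le> 1 / 2" unfolding c
    by (rule g(3)) (use gap_weight_bounds[OF p] in \<open>auto simp: gap_weight_def\<close>)
  have c0: "0 \<le> c" unfolding c by (rule infsum_nonneg) (use gap_weight_bounds[OF p] rho_nonneg in auto)
  have d1: "deficit i \<le> c" unfolding deficit_def c
    by (rule infsum_mono[OF deficit_facts(1)[OF i] gs]) (use corner_factor_gap(2)[OF p i] rho_nonneg in \<open>auto intro!: mult_left_mono\<close>)
  have d2: "(1 - x) * c \<le> deficit i"
  proof -
    have "(1 - x) * c = (\<Sum>\<^sub>\<infinity>m\<in>{m. enat n < m}. (1 - x) * (\<rho> m * gap_weight p n m))"
      unfolding c by (rule infsum_cmult_right[symmetric]) (use gs in auto)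
    also have "\<dots> \<le> deficit i" unfolding deficit_def
    proof (rule infsum_mono[OF summable_on_cmult_right[OF gs] deficit_facts(1)[OF i]])
      fix m assume "m \<in> {m. enat n < m}"
      then show "(1 - x) * (\<rho> m * gap_weight p n m) \<le> \<rho> m * (1 - corner_factor p n i m)"
        using mult_left_mono[OF corner_factor_gap(1)[OF p i, of m] rho_nonneg[of m]]
            by (simp add: x_def mult_ac)
    qed
    finally show ?thesis .
  qed
  have pn: "real p powi (- int n) = (1 / real p) ^ n"
      by (simp add: power_int_minus power_one_over inverse_eq_divide)
  have "(1 / real p) ^ n = (1 / real p) ^ (n - i) * (1 / real p) ^ i" using i by (simp flip: power_add)
  then have xp: "x = real p ^ i * (1 / real p) ^ n" unfolding x_def using p by (simp add: power_one_over)
  have e: "rate i / (real p powi (- int n) * (1 - c)) = real p ^ i * ((1 - deficit i) / ((1 - x) * (1 - c)))"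
  proof -
    have "rate i = real p ^ i * (1 / real p) ^ n / (1 - x) * (1 - deficit i)"
      unfolding rate_def x_def[symmetric] using xp by simp
    moreover have "P * t / u * D / (t * v) = P * (D / (u * v))" if "t \<noteq> 0" for P t u v D :: real
      using that by (simp add: mult.commute mult.left_commute)
    ultimately show ?thesis unfolding pn using p by simp
  qed
  have pos: "0 < (1 - x) * (1 - c)" using x c2 by simp
  have 1: "1 \<le> (1 - deficit i) / ((1 - x) * (1 - c))"
  proof -
    have "0 \<le> x * (1 - c)" using x c2 by simp
    then have "(1 - x) * (1 - c) \<le> 1 - c" by (simp add: algebra_simps)
    then show ?thesis using pos d1 by (simp add: le_divide_eq)
  qed
  have 2: "(1 - deficit i) / ((1 - x) * (1 - c)) \<le> (1 + x) / (1 - x)"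
  proof -
    have "x * c \<le> x * (1 - c)" using x c2 by (intro mult_left_mono) auto
    then have "1 - deficit i \<le> (1 + x) * (1 - c)" using d2 by (simp add: algebra_simps)
    then have "(1 - deficit i) / ((1 - x) * (1 - c)) \<le> ((1 + x) * (1 - c)) / ((1 - x) * (1 - c))"
      using pos by (intro divide_right_mono) auto
    also have "\<dots> = (1 + x) / (1 - x)" using c2 by simp
    finally show ?thesis .
  qed
  show "real p ^ i \<le> rate i / (real p powi (- int n) * (1 - c))"
    unfolding e using mult_left_mono[OF 1, of "real p ^ i"] by simp
  show "rate i / (real p powi (- int n) * (1 - c))
      \<le> real p ^ i * ((1 + (1 / real p) ^ (n - i)) / (1 - (1 / real p) ^ (n - i)))"
    unfolding e x_def[symmetric] using 2 by (intro mult_left_mono) auto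
qed

end

section \<open>Lyapunov exponents\<close>

lemma lyapunov_exponents_exist:
  fixes A :: "nat \<Rightarrow> 'w \<Rightarrow> 'p::prime_card padic_int mat"
  assumes prob: "prob_space M"
    and indep: "prob_space.indep_vars M (\<lambda>_. mat_borel n) A {1..}"
    and law: "\<And>j. 1 \<le> j \<Longrightarrow> corner_or_iid M n (N j) (A j)"
    and N: "\<And>j. 1 \<le> j \<Longrightarrow> enat n < N j"
    and freq: "\<And>m. enat n < m \<Longrightarrow> (\<lambda>k. real (card {j \<in> {1..k}. N j = m}) / real k) \<longlonglongrightarrow> \<rho> m"
    and i: "i < n"
  shows "AE \<omega> in M. (\<lambda>k. real_of_int (SN (map_mat to_fract (mat_lprod n (\<lambda>j. A j \<omega>) k)) ! (n - 1 - i)) / real k) \<longlonglongrightarrow> rate \<rho> n CARD('p) i"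
proof -
  interpret prob_space M by fact
  have p1: "CARD('p) > 1" using prime_card_gt_1[where 'p='p] by simp
  let ?y = "\<lambda>i. (1 / real CARD('p)) ^ (n - i) / (1 - (1 / real CARD('p)) ^ (n - i))"
  have "AE \<omega> in M. \<forall>i\<in>{..<n}. (\<lambda>k. ((\<Sum>j=1..k. real (depth n i (mat_lprod n (\<lambda>j. A j \<omega>) j) - depth n i (mat_lprod n (\<lambda>j. A j \<omega>) (j - 1))))
       - (\<Sum>j=1..k. corner_factor CARD('p) n i (N j) * ?y i)) / real k) \<longlonglongrightarrow> 0"
    by (intro AE_finite_allI depth_increments_slln(2)[OF prob indep law N]) auto
  moreover have "AE \<omega> in M. \<forall>k. regular_below n n (mat_lprod n (\<lambda>j. A j \<omega>) k)"
    by (rule depth_increments_slln(1)[OF prob indep law N])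
  ultimately show ?thesis
    using AE_space
  proof eventually_elim
    case (elim \<omega>)
    have A: "A j \<omega> \<in> carrier_mat n n" if "1 \<le> j" for j
      using law[OF that] measurable_space[of "A j" M "mat_borel n", OF _ elim(3)]
          by (simp add: corner_or_iid_def)
    \<comment> \<open>The value at \<open>0\<close>, which enters no product, is chosen so that every term is an \<open>n \<times> n\<close> matrix.\<close>
    define B where "B j = (if j = 0 then 1\<^sub>m n else A j \<omega>)" for j
    have B: "B j \<in> carrier_mat n n" for j unfolding B_def using A by auto
    have AB: "mat_lprod n (\<lambda>j. A j \<omega>) k = mat_lprod n B k" for k by (rule mat_lprod_cong) (simp add: B_def)
    have lim: "(\<lambda>k. real (depth n i (mat_lprod n B k)) / real k) \<longlonglongrightarrow> rate \<rho> n CARD('p) i" if i: "i < n" for i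
    proof -
      have "(\<lambda>k. (real (depth n i (mat_lprod n (\<lambda>j. A j \<omega>) k)) - (\<Sum>j=1..k. corner_factor CARD('p) n i (N j) * ?y i)) / real k) \<longlonglongrightarrow> 0"
      proof -
        have tel: "(\<Sum>j=1..k. real (depth n i (mat_lprod n (\<lambda>j. A j \<omega>) j) - depth n i (mat_lprod n (\<lambda>j. A j \<omega>) (j - 1))))
          = real (depth n i (mat_lprod n (\<lambda>j. A j \<omega>) k))" for k
          by (rule depth_telescope[OF A spec[OF elim(2)] i])
        have "i \<in> {..<n}" using i by simp
        from bspec[OF elim(1) this] show ?thesis unfolding tel .
      qed
      from tendsto_add[OF this average_rate[OF p1 N freq i]] show ?thesis
        by (simp add: AB add_divide_distrib[symmetric])
    qed
    show ?case unfolding AB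
    proof (rule singular_numbers_growth[OF B _ lim _ i])
      show "regular_below n n (mat_lprod n B k)" for k using elim(2) by (simp add: AB)
      show "rate \<rho> n CARD('p) i \<le> rate \<rho> n CARD('p) j" if "i \<le> j" "j < n" for i j
        by (rule rate_mono[OF p1 N freq that])
    qed
  qed
qed

theorem theorem1p2:
  fixes p :: nat
    and Nn :: "nat \<Rightarrow> nat \<Rightarrow> enat"
    and \<rho> :: "nat \<Rightarrow> enat \<Rightarrow> real"
    and M :: "nat \<Rightarrow> 'w measure"
    and A :: "nat \<Rightarrow> nat \<Rightarrow> 'w \<Rightarrow> 'p::prime_card padic_int mat"
    and c :: "nat \<Rightarrow> real"
  assumes p: "p = CARD('p)"
    and N_gt: "\<And>n j. 1 \<le> n \<Longrightarrow> 1 \<le> j \<Longrightarrow> enat n < Nn n j"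
    and freq: "\<And>n N. 1 \<le> n \<Longrightarrow> enat n < N \<Longrightarrow>
      (\<lambda>k. real (card {j \<in> {1..k}. Nn n j = N}) / real k) \<longlonglongrightarrow> \<rho> n N"
    and prob: "\<And>n. 1 \<le> n \<Longrightarrow> prob_space (M n)"
    and indep: "\<And>n. 1 \<le> n \<Longrightarrow>
      prob_space.indep_vars (M n) (\<lambda>_. mat_borel n) (A n) {1..}"
    and law: "\<And>n j. 1 \<le> n \<Longrightarrow> 1 \<le> j \<Longrightarrow> corner_or_iid (M n) n (Nn n j) (A n j)"
    and c: "\<And>n. c n = (\<Sum>\<^sub>\<infinity>N\<in>{N. enat n < N}. \<rho> n N * gap_weight p n N)"
  shows "\<exists>L :: nat \<Rightarrow> nat \<Rightarrow> real.
    (\<forall>n\<ge>1. \<forall>i\<in>{1..n}. AE \<omega> in M n.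
      (\<lambda>k. real_of_int (SN (map_mat to_fract (mat_lprod n (\<lambda>j. A n j \<omega>) k)) ! (n - i)) / real k)
        \<longlonglongrightarrow> L n i) \<and>
    (\<forall>i\<ge>1. (\<lambda>n. L n i / (real p powi (- int n) * (1 - c n))) \<longlonglongrightarrow> real p ^ (i - 1))"
proof -
  have p1: "p > 1" using prime_card_gt_1[where 'p='p] p by simp
  define L where "L n i = rate (\<rho> n) n p (i - 1)" for n i
  show ?thesis
  proof (intro exI[of _ L] conjI allI impI ballI)
    fix n i :: nat assume n: "1 \<le> n" and i: "i \<in> {1..n}"
    have e: "n - i = n - 1 - (i - 1)" using i by auto
    show "AE \<omega> in M n. (\<lambda>k. real_of_int (SN (map_mat to_fract (mat_lprod n (\<lambda>j. A n j \<omega>) k)) ! (n - i)) / real k) \<longlonglongrightarrow> L n i"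
      unfolding L_def e p
      by (rule lyapunov_exponents_exist[OF prob[OF n] indep[OF n] law[OF n] N_gt[OF n] freq[OF n]]) (use i in auto)
  next
    fix i :: nat assume i: "1 \<le> i"
    let ?x = "\<lambda>n. (1 / real p) ^ (n - (i - 1))"
    have x0: "?x \<longlonglongrightarrow> 0"
    proof (rule LIMSEQ_offset[where k = "i - 1"])
      show "(\<lambda>n. (1 / real p) ^ (n + (i - 1) - (i - 1))) \<longlonglongrightarrow> 0"
        using LIMSEQ_realpow_zero[of "1 / real p"] p1 by simp
    qed
    have up: "(\<lambda>n. real p ^ (i - 1) * ((1 + ?x n) / (1 - ?x n))) \<longlonglongrightarrow> real p ^ (i - 1) * ((1 + 0) / (1 - 0))"
      by (intro tendsto_intros x0) simp
    have ev: "\<forall>\<^sub>F n in sequentially. real p ^ (i - 1) \<le> L n i / (real p powi (- int n) * (1 - c n)) \<and>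
        L n i / (real p powi (- int n) * (1 - c n)) \<le> real p ^ (i - 1) * ((1 + ?x n) / (1 - ?x n))"
      using eventually_ge_at_top[of i]
    proof eventually_elim
      case (elim n)
      then have n: "1 \<le> n" "i - 1 < n" using i by auto
      show ?case unfolding L_def
        using rate_asymptotics[OF p1 N_gt[OF n(1)] freq[OF n(1)] n(2) c] by blast
    qed
    show "(\<lambda>n. L n i / (real p powi (- int n) * (1 - c n))) \<longlonglongrightarrow> real p ^ (i - 1)"
    proof (rule tendsto_sandwich[OF _ _ tendsto_const])
      show "(\<lambda>n. real p ^ (i - 1) * ((1 + ?x n) / (1 - ?x n))) \<longlonglongrightarrow> real p ^ (i - 1)" using up by simp
    qed (use ev in \<open>auto elim: eventually_mono\<close>)
  qed
qed

end
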